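(* Let $(X,X^+)$ be a normally ordered separable Banach space with $\dim X\ge2$, and let $\Phi=((U_\omega(t))_{\omega\in\Omega,t\in\mathbb T^+},(\theta_t)_{t\in\mathbb T})$ be a measurable linear skew-product semidynamical system on $X$ that is integrable, positive and focusing (with data $\mathbf e$, $\varkappa$). Then there exist an invariant set $\tilde\Omega_1\subset\Omega$, $\mathbb P(\tilde\Omega_1)=1$, and an $(\mathfrak F,\mathfrak B(X))$-measurable function $w:\tilde\Omega_1\to X$ with $w(\omega)\in C_{\mathbf e}$ and $\|w(\omega)\|=1$ for all $\omega\in\tilde\Omega_1$, having the following properties. Put $\tilde E_1(\omega)=\mathrm{span}\{w(\omega)\}$. (1) $w(\theta_t\omega)=\dfrac{U_\omega(t)w(\omega)}{\|U_\omega(t)w(\omega)\|}$ for any $\omega\in\tilde\Omega_1$ and $t\in\mathbb T^+$. (2) If for some $\omega\in\tilde\Omega_1$ a function $v_\omega:\mathbb T\to X^+\setminus\{0\}$ is an entire orbit of $U_\omega$, then $v_\omega(t)=\|v_\omega(0)\|\,w_\omega(t)$ for all $t\in\mathbb T$, where $w_\omega(t):=(U_{\theta_t\omega}(-t)|_{\tilde E_1(\theta_t\omega)})^{-1}w(\omega)$ for $t\in\mathbb T$, $t<0$, and $w_\omega(t):=U_\omega(t)w(\omega)$ for $t\in\mathbb T^+$. (3) There exists $\tilde\lambda_1\in[-\infty,\infty)$ such that $$\tilde\lambda_1=\lim_{t\to\pm\infty,\ t\in\mathbb T}\frac1t\ln\rho_t(\omega)=\int_\Omega\ln\rho_1\,d\mathbb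 P$$ for each $\omega\in\tilde\Omega_1$, where $\rho_t(\omega):=\|U_\omega(t)w(\omega)\|$ for $t\ge0$ and $\rho_t(\omega):=1/\|U_{\theta_t\omega}(-t)w(\theta_t\omega)\|$ for $t<0$. (4) Assume, moreover, that $\Phi$ is injective and compact and that $X^+$ is total. If case (O1) of the Oseledets alternative occurs, then $\tilde\lambda_1=-\infty$. If case (O2) or (O3) occurs, then $\tilde\lambda_1=\lambda_1$. Hence for any $u\in X\setminus\{0\}$ and $\omega\in\tilde\Omega_1$, $$\limsup_{t\to\infty,\ t\in\mathbb T^+}\frac1t\ln\|U_\omega(t)u\|\le\tilde\lambda_1,$$ and then $\{\tilde E_1(\omega)\}_{\omega\in\tilde\Omega_1}$ is a family of generalized principal Floquet subspaces of $\Phi$. (5) Assume, moreover, that $(X,X^+)$ is a Banach lattice. Then for any $u\in X\setminus\{0\}$ and $\omega\in\tilde\Omega_1$, $$\limsup_{t\to\infty,\ t\in\mathbb T^+}\frac1t\ln\|U_\omega(t)u\|\le\tilde\lambda_1,$$ and then $\{\tilde E_1(\omega)\}_{\omega\in\tilde\Omega_1}$ is a family of generalized principal Floquet subspaces of $\Phi$.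
   Context: Let $\mathbb T\in\{\mathbb Z,\mathbb R\}$, $\mathbb T^+=\{t\in\mathbb T:t\ge0\}$. $(\Omega,\mathfrak F,\mathbb P)$ is a probability space; $\mathfrak B(Y)$ is the Borel $\sigma$-algebra of a metric space $Y$. A metric dynamical system $(\theta_t)_{t\in\mathbb T}$ is a $(\mathfrak B(\mathbb T)\otimes\mathfrak F,\mathfrak F)$-measurable map $(t,\omega)\mapsto\theta_t\omega$ with $\theta_0=\mathrm{Id}$, $\theta_{t_1+t_2}=\theta_{t_2}\circ\theta_{t_1}$, each $\theta_t$ preserving $\mathbb P$. $\Omega'\subset\Omega$ is invariant if $\theta_t(\Omega')=\Omega'$ for all $t\in\mathbb T$; the system is ergodic if every invariant $F\in\mathfrak F$ has $\mathbb P(F)\in\{0,1\}$. A measurable linear skew-product semidynamical system $\Phi=((U_\omega(t)),(\theta_t))$ on a real Banach space $X$ covering $(\theta_t)$ is a $(\mathfrak B(\mathbb T^+)\otimes\mathfrak F\otimes\mathfrak B(X),\mathfrak B(X))$-measurable map $(t,\omega,u)\mapsto U_\omega(t)u$ with each $U_\omega(t)$ bounded linear on $X$, $U_\omega(0)=\mathrm{Id}_X$ and $U_{\theta_s\omega}(t)U_\omega(s)=U_\omega(t+s)$. Write $\ln^+x=\max(\ln x,0)$, $\ln^+0=0$, $\ln 0=-\infty$. A cone in $X$ is a closed convex set $X^+$ with $\alpha u\in X^+$ for $\alpha\ge0$, $u\in X^+$, and $X^+\cap(-X^+)=\{0\}$; $(X,X^+)$ is then an ordered Banach space and $u\le v$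 means $v-u\in X^+$. For $u,v\in X^+\setminus\{0\}$, $u\sim v$ means $\underline\alpha v\le u\le\overline\alpha v$ for some $\underline\alpha,\overline\alpha>0$, and $C_u=\{v\in X^+\setminus\{0\}:v\sim u\}$. $X^+$ is total if $X^+-X^+$ is dense in $X$; it is normal if for some $K>0$, $0\le u\le v$ implies $\|u\|\le K\|v\|$. A normally ordered Banach space is one with normal cone, and its norm is always assumed monotonic: $0\le u\le v$ implies $\|u\|\le\|v\|$. For a Banach lattice the norm is a lattice norm ($|u|\le|v|$ implies $\|u\|\le\|v\|$). $\Phi$ is integrable if $X$ is separable, $(\theta_t)$ is ergodic, $\mathbb P$ is complete when $\mathbb T=\mathbb R$, and: when $\mathbb T=\mathbb Z$, $\omega\mapsto\ln^+\|U_\omega(1)\|$ is in $L_1$; when $\mathbb T=\mathbb R$, $\omega\mapsto\sup_{0\le s\le1}\ln^+\|U_\omega(s)\|$ and $\omega\mapsto\sup_{0\le s\le1}\ln^+\|U_{\theta_s\omega}(1-s)\|$ are in $L_1$. It is injective if $U_\omega(1)$ is injective for a.e. $\omega$; compact if $U_\omega(1)$ is completely continuous (maps bounded sets to relatively compact sets) for a.e. $\omega$; positive if $U_\omega(t)u_1\le U_\omega(t)u_2$ for all $\omega$, all $t\in\mathbb T^+$ and all $u_1\le u_2$; focusing if there are $\mathbf e\in X^+$, $\|\mathbf e\|=1$, and a measurable $\varkappa:\Omega\to[1,\infty)$ with $\ln^+\ln\varkappa\in L_1$ such that for any $\omega\in\Omega$ and nonzero $u\in X^+$ there is $\beta(\omega,u)>0$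 with $\beta(\omega,u)\mathbf e\le U_\omega(1)u\le\varkappa(\omega)\beta(\omega,u)\mathbf e$. An entire orbit of $U_\omega$ is a map $v_\omega:\mathbb T\to X$ with $v_\omega(s+t)=U_{\theta_s\omega}(t)v_\omega(s)$ for all $s\in\mathbb T$, $t\in\mathbb T^+$. A family of one-dimensional subspaces $\{\tilde E(\omega)\}_{\omega\in\tilde\Omega}$ of $X$ is a family of generalized principal Floquet subspaces of $\Phi$ if $\tilde\Omega$ is invariant, $\mathbb P(\tilde\Omega)=1$ and: (i) $\tilde E(\omega)=\mathrm{span}\{w(\omega)\}$ with $w:\tilde\Omega\to X^+\setminus\{0\}$ measurable; (ii) $U_\omega(t)\tilde E(\omega)=\tilde E(\theta_t\omega)$ for all $\omega\in\tilde\Omega$, $t\in\mathbb T^+$; (iii) there is $\tilde\lambda\in[-\infty,\infty)$ with $\tilde\lambda=\lim_{t\to\infty}\frac1t\ln\|U_\omega(t)w(\omega)\|$ for all $\omega\in\tilde\Omega$; (iv) $\limsup_{t\to\infty}\frac1t\ln\|U_\omega(t)u\|\le\tilde\lambda$ for all $\omega\in\tilde\Omega$, $u\in X\setminus\{0\}$. Oseledets alternative. A family $\{E(\omega)\}_{\omega\in\Omega_0}$ of $l$-dimensional subspaces is measurable if there are measurable $v_1,\dots,v_l:\Omega_0\to X$ forming a basis of $E(\omega)$ for each $\omega$. For a decomposition $E(\omega)\oplus F(\omega)=X$ (with $E(\omega)$ finite-dimensional, $F(\omega)$ closed) the associated projection $P(\omega)$ is onto $F(\omega)$ along $E(\omega)$;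 the family is strongly measurable if $\omega\mapsto P(\omega)u$ is measurable for each $u$, and tempered if $\lim_{t\to\pm\infty}\frac1t\ln\|P(\theta_t\omega)\|=0$ a.s. It is known (Lian–Lu) that if $\Phi$ is integrable, injective and compact then there is an invariant $\Omega_0$ with $\mathbb P(\Omega_0)=1$ for which exactly one of the following holds (for all $\omega\in\Omega_0$, $t\in\mathbb T^+$): (O1) $\lim_{t\to\infty}\frac1t\ln\|U_\omega(t)\|=-\infty$. (O2) There are $k\ge1$, reals $\lambda_1>\dots>\lambda_k$, measurable families $E_1,\dots,E_k$ of finite-dimensional subspaces and a family $F_\infty$ of closed finite-codimensional subspaces with $U_\omega(t)E_i(\omega)=E_i(\theta_t\omega)$, $U_\omega(t)F_\infty(\omega)\subset F_\infty(\theta_t\omega)$, $E_1(\omega)\oplus\dots\oplus E_k(\omega)\oplus F_\infty(\omega)=X$; with $F_i(\omega):=E_{i+1}(\omega)\oplus\dots\oplus E_k(\omega)\oplus F_\infty(\omega)$ (so $F_k=F_\infty$) the projections associated with $(E_1\oplus\dots\oplus E_i)\oplus F_i=X$ are strongly measurable and tempered, $i=1,\dots,k$; $\lim_{t\to\pm\infty}\frac1t\ln\|U_\omega(t)|_{E_i(\omega)}\|=\lim_{t\to\pm\infty}\frac1t\ln\|U_\omega(t)u\|=\lambda_i$ for nonzero $u\in E_i(\omega)$; $\lim_{t\to\infty}\frac1t\ln\|U_\omega(t)u\|=\lambda_i$ for $u\in(E_i(\omega)\oplus F_i(\omega))\setminus F_i(\omega)$; and $\lim_{t\to\infty}\frac1t\ln\|U_\omega(t)|_{F_\infty(\omega)}\|=-\infty$.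 (O3) There are reals $\lambda_1>\lambda_2>\dots$ tending to $-\infty$, measurable families $E_1,E_2,\dots$ of finite-dimensional subspaces and families $F_1,F_2,\dots$ of closed finite-codimensional subspaces with $U_\omega(t)E_i(\omega)=E_i(\theta_t\omega)$, $U_\omega(t)F_i(\omega)\subset F_i(\theta_t\omega)$, $E_1(\omega)\oplus\dots\oplus E_i(\omega)\oplus F_i(\omega)=X$, $F_i(\omega)=E_{i+1}(\omega)\oplus F_{i+1}(\omega)$, the projections associated with $(E_1\oplus\dots\oplus E_i)\oplus F_i=X$ strongly measurable and tempered; $\lim_{t\to\pm\infty}\frac1t\ln\|U_\omega(t)|_{E_i(\omega)}\|=\lim_{t\to\pm\infty}\frac1t\ln\|U_\omega(t)u\|=\lambda_i$ for nonzero $u\in E_i(\omega)$; $\lim_{t\to\infty}\frac1t\ln\|U_\omega(t)u\|=\lambda_i$ for $u\in(E_i(\omega)\oplus F_i(\omega))\setminus F_i(\omega)$; and $\lim_{t\to\infty}\frac1t\ln\|U_\omega(t)|_{F_i(\omega)}\|=\lambda_{i+1}$. For $t=-s<0$ and $u\in E_i(\omega)$, $U_\omega(t)u$ denotes the unique $v\in E_i(\theta_t\omega)$ with $U_{\theta_t\omega}(s)v=u$. *)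

theory Defs
  imports "HOL-Probability.Probability" "HOL-Library.Set_Algebras"
begin

section \<open>Logarithms and limits along the time set\<close>

text \<open>
  Both \<open>\<int>\<close> and \<open>\<real>\<close> occur as a time set \<open>T :: real set\<close>; maps defined on \<open>T\<close> are total functions on
  the reals about which only the arguments in \<open>T\<close> matter.
\<close>

definition nonneg_time :: "real set \<Rightarrow> real set" where
  "nonneg_time T = {t \<in> T. 0 \<le> t}"

definition time_at_top :: "real set \<Rightarrow> real filter" where
  "time_at_top T = inf at_top (principal T)"

definition time_at_bot :: "real set \<Rightarrow> real filter" where
  "time_at_bot T = inf at_bot (principal T)"

text \<open>For \<open>x \<ge> 0\<close>, with \<open>ln 0 = - \<infinity>\<close>.\<close>

definition eln :: "real \<Rightarrow> ereal" where
  "eln x = (if x \<le> 0 then - \<infinity> else ereal (ln x))"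

text \<open>In HOL \<open>ln 0 = 0\<close>, so that \<open>lnplus 0 = 0\<close>.\<close>

definition lnplus :: "real \<Rightarrow> real" where
  "lnplus x = max (ln x) 0"

definition exp_rate :: "real \<Rightarrow> real \<Rightarrow> ereal" where
  "exp_rate t x = ereal (1 / t) * eln x"

text \<open>Integral of an extended real function whose positive or negative part is integrable.\<close>

definition has_extended_integral :: "'w measure \<Rightarrow> ('w \<Rightarrow> ereal) \<Rightarrow> ereal \<Rightarrow> bool" where
  "has_extended_integral M f I \<longleftrightarrow>
     f \<in> borel_measurable M \<and>
     ((\<integral>\<^sup>+ x. e2ennreal (f x) \<partial>M) < \<infinity> \<or> (\<integral>\<^sup>+ x. e2ennreal (- f x) \<partial>M) < \<infinity>) \<and>
     I = enn2ereal (\<integral>\<^sup>+ x. e2ennreal (f x) \<partial>M) - enn2ereal (\<integral>\<^sup>+ x. e2ennreal (- f x) \<partial>M)"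

section \<open>Ordered Banach spaces\<close>

definition order_cone :: "'x::banach set \<Rightarrow> bool" where
  "order_cone C \<longleftrightarrow> closed C \<and> convex C \<and> cone C \<and> C \<inter> uminus ` C = {0}"

definition cone_le :: "'x::banach set \<Rightarrow> 'x \<Rightarrow> 'x \<Rightarrow> bool" where
  "cone_le C u v \<longleftrightarrow> v - u \<in> C"

definition cone_less :: "'x::banach set \<Rightarrow> 'x \<Rightarrow> 'x \<Rightarrow> bool" where
  "cone_less C u v \<longleftrightarrow> cone_le C u v \<and> u \<noteq> v"

definition comparable :: "'x::banach set \<Rightarrow> 'x \<Rightarrow> 'x \<Rightarrow> bool" where
  "comparable C u v \<longleftrightarrow>
     (\<exists>a>0. \<exists>b>0. cone_le C (a *\<^sub>R v) u \<and> cone_le C u (b *\<^sub>R v))"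

definition comparability_class :: "'x::banach set \<Rightarrow> 'x \<Rightarrow> 'x set" where
  "comparability_class C u = {v \<in> C - {0}. comparable C v u}"

definition total_cone :: "'x::banach set \<Rightarrow> bool" where
  "total_cone C \<longleftrightarrow> closure {u - v | u v. u \<in> C \<and> v \<in> C} = UNIV"

definition normal_cone :: "'x::banach set \<Rightarrow> bool" where
  "normal_cone C \<longleftrightarrow>
     (\<exists>K>0. \<forall>u v. cone_le C 0 u \<and> cone_le C u v \<longrightarrow> norm u \<le> K * norm v)"

definition normally_ordered :: "'x::banach set \<Rightarrow> bool" where
  "normally_ordered C \<longleftrightarrow>
     order_cone C \<and> normal_cone C \<and>
     (\<forall>u v. cone_le C 0 u \<and> cone_le C u v \<longrightarrow> norm u \<le> norm v)"

text \<open>The modulus of \<open>u\<close> is \<open>sp u (- u)\<close>.\<close>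

definition banach_lattice :: "'x::banach set \<Rightarrow> bool" where
  "banach_lattice C \<longleftrightarrow>
     order_cone C \<and>
     (\<exists>ip sp. class.lattice ip (cone_le C) (cone_less C) sp \<and>
        (\<forall>u v. cone_le C (sp u (- u)) (sp v (- v)) \<longrightarrow> norm u \<le> norm v))"

section \<open>Skew-product semidynamical systems\<close>

locale metric_dynamical_system = prob_space M
  for M :: "'w measure" +
  fixes T :: "real set" and \<theta> :: "real \<Rightarrow> 'w \<Rightarrow> 'w"
  assumes time_set: "T = \<int> \<or> T = UNIV"
    and flow_measurable:
      "(\<lambda>(t, \<omega>). \<theta> t \<omega>) \<in> restrict_space borel T \<Otimes>\<^sub>M M \<rightarrow>\<^sub>M M"
    and flow_zero: "\<And>\<omega>. \<omega> \<in> space M \<Longrightarrow> \<theta> 0 \<omega> = \<omega>"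
    and flow_add:
      "\<And>s t \<omega>. s \<in> T \<Longrightarrow> t \<in> T \<Longrightarrow> \<omega> \<in> space M \<Longrightarrow> \<theta> (s + t) \<omega> = \<theta> s (\<theta> t \<omega>)"
    and flow_preserving: "\<And>t. t \<in> T \<Longrightarrow> distr M M (\<theta> t) = M"

definition invariant_set :: "'w measure \<Rightarrow> real set \<Rightarrow> (real \<Rightarrow> 'w \<Rightarrow> 'w) \<Rightarrow> 'w set \<Rightarrow> bool" where
  "invariant_set M T \<theta> A \<longleftrightarrow> A \<subseteq> space M \<and> (\<forall>t\<in>T. \<theta> t ` A = A)"

definition full_invariant_set :: "'w measure \<Rightarrow> real set \<Rightarrow> (real \<Rightarrow> 'w \<Rightarrow> 'w) \<Rightarrow> 'w set \<Rightarrow> bool" where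
  "full_invariant_set M T \<theta> A \<longleftrightarrow> invariant_set M T \<theta> A \<and> A \<in> sets M \<and> measure M A = 1"

definition ergodic_flow :: "'w measure \<Rightarrow> real set \<Rightarrow> (real \<Rightarrow> 'w \<Rightarrow> 'w) \<Rightarrow> bool" where
  "ergodic_flow M T \<theta> \<longleftrightarrow>
     (\<forall>A\<in>sets M. invariant_set M T \<theta> A \<longrightarrow> measure M A = 0 \<or> measure M A = 1)"

text \<open>
  \<open>U \<omega> t\<close> is $U_\omega(t)$. For a metric space, separability amounts to the class
  \<open>second_countable_topology\<close>.
\<close>

locale skew_product_semiflow = metric_dynamical_system M T \<theta>
  for M :: "'w measure" and T :: "real set" and \<theta> :: "real \<Rightarrow> 'w \<Rightarrow> 'w" +
  fixes U :: "'w \<Rightarrow> real \<Rightarrow> 'x::{banach, second_countable_topology} \<Rightarrow> 'x"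
  assumes semiflow_measurable:
      "(\<lambda>(t, \<omega>, u). U \<omega> t u)
         \<in> restrict_space borel (nonneg_time T) \<Otimes>\<^sub>M M \<Otimes>\<^sub>M borel \<rightarrow>\<^sub>M borel"
    and semiflow_linear:
      "\<And>\<omega> t. \<omega> \<in> space M \<Longrightarrow> t \<in> nonneg_time T \<Longrightarrow> bounded_linear (U \<omega> t)"
    and semiflow_zero: "\<And>\<omega> u. \<omega> \<in> space M \<Longrightarrow> U \<omega> 0 u = u"
    and semiflow_add:
      "\<And>\<omega> s t u. \<omega> \<in> space M \<Longrightarrow> s \<in> nonneg_time T \<Longrightarrow> t \<in> nonneg_time T \<Longrightarrow>
         U (\<theta> s \<omega>) t (U \<omega> s u) = U \<omega> (t + s) u"

text \<open>
  For continuous time the suprema are taken in \<open>ennreal\<close>, where they exist without any boundedness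
  assumption.
\<close>

definition integrable_semiflow ::
  "'w measure \<Rightarrow> real set \<Rightarrow> (real \<Rightarrow> 'w \<Rightarrow> 'w) \<Rightarrow>
   ('w \<Rightarrow> real \<Rightarrow> 'x::{banach, second_countable_topology} \<Rightarrow> 'x) \<Rightarrow> bool" where
  "integrable_semiflow M T \<theta> U \<longleftrightarrow>
     ergodic_flow M T \<theta> \<and>
     (T = \<int> \<longrightarrow> integrable M (\<lambda>\<omega>. lnplus (onorm (U \<omega> 1)))) \<and>
     (T = UNIV \<longrightarrow>
        complete_measure M \<and>
        (\<lambda>\<omega>. SUP s\<in>{0..1}. ennreal (lnplus (onorm (U \<omega> s)))) \<in> borel_measurable M \<and>
        (\<integral>\<^sup>+ \<omega>. (SUP s\<in>{0..1}. ennreal (lnplus (onorm (U \<omega> s)))) \<partial>M) < \<infinity> \<and>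
        (\<lambda>\<omega>. SUP s\<in>{0..1}. ennreal (lnplus (onorm (U (\<theta> s \<omega>) (1 - s))))) \<in> borel_measurable M \<and>
        (\<integral>\<^sup>+ \<omega>. (SUP s\<in>{0..1}. ennreal (lnplus (onorm (U (\<theta> s \<omega>) (1 - s))))) \<partial>M) < \<infinity>)"

definition injective_semiflow :: "'w measure \<Rightarrow> ('w \<Rightarrow> real \<Rightarrow> 'x::banach \<Rightarrow> 'x) \<Rightarrow> bool" where
  "injective_semiflow M U \<longleftrightarrow> (AE \<omega> in M. inj (U \<omega> 1))"

definition compact_semiflow :: "'w measure \<Rightarrow> ('w \<Rightarrow> real \<Rightarrow> 'x::banach \<Rightarrow> 'x) \<Rightarrow> bool" where
  "compact_semiflow M U \<longleftrightarrow>
     (AE \<omega> in M. \<forall>B. bounded B \<longrightarrow> compact (closure (U \<omega> 1 ` B)))"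

definition positive_semiflow ::
  "'w measure \<Rightarrow> real set \<Rightarrow> ('w \<Rightarrow> real \<Rightarrow> 'x::banach \<Rightarrow> 'x) \<Rightarrow> 'x set \<Rightarrow> bool" where
  "positive_semiflow M T U C \<longleftrightarrow>
     (\<forall>\<omega>\<in>space M. \<forall>t\<in>nonneg_time T. \<forall>u v.
        cone_le C u v \<longrightarrow> cone_le C (U \<omega> t u) (U \<omega> t v))"

definition focusing_semiflow ::
  "'w measure \<Rightarrow> ('w \<Rightarrow> real \<Rightarrow> 'x::banach \<Rightarrow> 'x) \<Rightarrow> 'x set \<Rightarrow> 'x \<Rightarrow> ('w \<Rightarrow> real) \<Rightarrow> bool" where
  "focusing_semiflow M U C e \<kappa> \<longleftrightarrow>
     e \<in> C \<and> norm e = 1 \<and>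
     \<kappa> \<in> borel_measurable M \<and> (\<forall>\<omega>\<in>space M. 1 \<le> \<kappa> \<omega>) \<and>
     integrable M (\<lambda>\<omega>. lnplus (ln (\<kappa> \<omega>))) \<and>
     (\<forall>\<omega>\<in>space M. \<forall>u\<in>C - {0}. \<exists>\<beta>>0.
        cone_le C (\<beta> *\<^sub>R e) (U \<omega> 1 u) \<and> cone_le C (U \<omega> 1 u) ((\<kappa> \<omega> * \<beta>) *\<^sub>R e))"

definition entire_orbit ::
  "real set \<Rightarrow> (real \<Rightarrow> 'w \<Rightarrow> 'w) \<Rightarrow> ('w \<Rightarrow> real \<Rightarrow> 'x \<Rightarrow> 'x) \<Rightarrow> 'w \<Rightarrow> (real \<Rightarrow> 'x) \<Rightarrow> bool" where
  "entire_orbit T \<theta> U \<omega> v \<longleftrightarrow>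
     (\<forall>s\<in>T. \<forall>t\<in>nonneg_time T. v (s + t) = U (\<theta> s \<omega>) t (v s))"

definition principal_floquet_subspaces ::
  "'w measure \<Rightarrow> real set \<Rightarrow> (real \<Rightarrow> 'w \<Rightarrow> 'w) \<Rightarrow> ('w \<Rightarrow> real \<Rightarrow> 'x::banach \<Rightarrow> 'x) \<Rightarrow>
   'x set \<Rightarrow> 'w set \<Rightarrow> ('w \<Rightarrow> 'x set) \<Rightarrow> bool" where
  "principal_floquet_subspaces M T \<theta> U C \<Omega> E \<longleftrightarrow>
     full_invariant_set M T \<theta> \<Omega> \<and>
     (\<exists>w \<mu>.
        w \<in> restrict_space M \<Omega> \<rightarrow>\<^sub>M borel \<and>
        (\<forall>\<omega>\<in>\<Omega>. w \<omega> \<in> C - {0} \<and> E \<omega> = span {w \<omega>}) \<and>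
        (\<forall>\<omega>\<in>\<Omega>. \<forall>t\<in>nonneg_time T. U \<omega> t ` E \<omega> = E (\<theta> t \<omega>)) \<and>
        \<mu> < \<infinity> \<and>
        (\<forall>\<omega>\<in>\<Omega>. ((\<lambda>t. exp_rate t (norm (U \<omega> t (w \<omega>)))) \<longlongrightarrow> \<mu>) (time_at_top T)) \<and>
        (\<forall>\<omega>\<in>\<Omega>. \<forall>u. u \<noteq> 0 \<longrightarrow>
           Limsup (time_at_top T) (\<lambda>t. exp_rate t (norm (U \<omega> t u))) \<le> \<mu>))"

section \<open>The Oseledets alternative\<close>

text \<open>Norm of the restriction of \<open>f\<close> to the subspace \<open>S\<close>.\<close>

definition onorm_on :: "'x::real_normed_vector set \<Rightarrow> ('x \<Rightarrow> 'x) \<Rightarrow> real" where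
  "onorm_on S f = (SUP x\<in>S. norm (f x) / norm x)"

text \<open>\<open>V\<close> is the internal direct sum of the subspaces \<open>S i\<close>; sums of sets are Minkowski sums.\<close>

definition direct_sum :: "'i set \<Rightarrow> ('i \<Rightarrow> 'x::real_vector set) \<Rightarrow> 'x set \<Rightarrow> bool" where
  "direct_sum I S V \<longleftrightarrow>
     (\<forall>i\<in>I. subspace (S i)) \<and> (\<Sum>i\<in>I. S i) = V \<and>
     (\<forall>f. (\<forall>i\<in>I. f i \<in> S i) \<and> (\<Sum>i\<in>I. f i) = 0 \<longrightarrow> (\<forall>i\<in>I. f i = 0))"

text \<open>For a decomposition of the space into \<open>A\<close> and \<open>B\<close>: the projection onto \<open>B\<close> along \<open>A\<close>.\<close>

definition proj_along :: "'x::real_vector set \<Rightarrow> 'x set \<Rightarrow> 'x \<Rightarrow> 'x" where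
  "proj_along A B u = (THE v. v \<in> B \<and> u - v \<in> A)"

definition closed_finite_codim :: "'x::banach set \<Rightarrow> bool" where
  "closed_finite_codim F \<longleftrightarrow> subspace F \<and> closed F \<and> (\<exists>B. finite B \<and> span (F \<union> B) = UNIV)"

definition measurable_subspaces ::
  "'w measure \<Rightarrow> 'w set \<Rightarrow> ('w \<Rightarrow> 'x::banach set) \<Rightarrow> bool" where
  "measurable_subspaces M \<Omega> E \<longleftrightarrow>
     (\<exists>(l::nat) v.
        (\<forall>i<l. v i \<in> restrict_space M \<Omega> \<rightarrow>\<^sub>M borel) \<and>
        (\<forall>\<omega>\<in>\<Omega>. inj_on (\<lambda>i. v i \<omega>) {..<l} \<and> independent ((\<lambda>i. v i \<omega>) ` {..<l}) \<and>
           span ((\<lambda>i. v i \<omega>) ` {..<l}) = E \<omega>))"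

definition strongly_measurable_family ::
  "'w measure \<Rightarrow> 'w set \<Rightarrow> ('w \<Rightarrow> 'x::banach \<Rightarrow> 'x) \<Rightarrow> bool" where
  "strongly_measurable_family M \<Omega> P \<longleftrightarrow>
     (\<forall>u. (\<lambda>\<omega>. P \<omega> u) \<in> restrict_space M \<Omega> \<rightarrow>\<^sub>M borel)"

text \<open>
  This is applied to projections only. A nonzero projection has norm at least \<open>1\<close>. The zero
  projection, which occurs when \<open>F\<^sub>\<infinity>\<close> vanishes in a finite-dimensional space, is tempered here because
  \<open>ln 0 = 0\<close> in HOL; with the convention \<open>ln 0 = - \<infinity>\<close> it would not be, and the finite-dimensional
  case would be excluded.
\<close>

definition tempered_family ::
  "'w measure \<Rightarrow> real set \<Rightarrow> (real \<Rightarrow> 'w \<Rightarrow> 'w) \<Rightarrow> 'w set \<Rightarrow> ('w \<Rightarrow> 'x::banach \<Rightarrow> 'x) \<Rightarrow> bool" where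
  "tempered_family M T \<theta> \<Omega> P \<longleftrightarrow>
     (AE \<omega> in M. \<omega> \<in> \<Omega> \<longrightarrow>
        ((\<lambda>t. 1 / t * ln (onorm (P (\<theta> t \<omega>)))) \<longlongrightarrow> 0) (time_at_top T) \<and>
        ((\<lambda>t. 1 / t * ln (onorm (P (\<theta> t \<omega>)))) \<longlongrightarrow> 0) (time_at_bot T))"

definition two_sided_semiflow ::
  "(real \<Rightarrow> 'w \<Rightarrow> 'w) \<Rightarrow> ('w \<Rightarrow> real \<Rightarrow> 'x \<Rightarrow> 'x) \<Rightarrow> ('w \<Rightarrow> 'x set) \<Rightarrow> 'w \<Rightarrow> real \<Rightarrow> 'x \<Rightarrow> 'x" where
  "two_sided_semiflow \<theta> U E \<omega> t u =
     (if 0 \<le> t then U \<omega> t u else (THE v. v \<in> E (\<theta> t \<omega>) \<and> U (\<theta> t \<omega>) (- t) v = u))"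

definition two_sided_exponent ::
  "real set \<Rightarrow> (real \<Rightarrow> 'w \<Rightarrow> 'w) \<Rightarrow> ('w \<Rightarrow> real \<Rightarrow> 'x::banach \<Rightarrow> 'x) \<Rightarrow>
   'w set \<Rightarrow> ('w \<Rightarrow> 'x set) \<Rightarrow> real \<Rightarrow> bool" where
  "two_sided_exponent T \<theta> U \<Omega> E \<mu> \<longleftrightarrow>
     (\<forall>\<omega>\<in>\<Omega>. \<forall>L\<in>{time_at_top T, time_at_bot T}.
        ((\<lambda>t. exp_rate t (onorm_on (E \<omega>) (two_sided_semiflow \<theta> U E \<omega> t))) \<longlongrightarrow> ereal \<mu>) L \<and>
        (\<forall>u\<in>E \<omega> - {0}.
           ((\<lambda>t. exp_rate t (norm (two_sided_semiflow \<theta> U E \<omega> t u))) \<longlongrightarrow> ereal \<mu>) L))"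

definition oseledets_O1 ::
  "real set \<Rightarrow> ('w \<Rightarrow> real \<Rightarrow> 'x::banach \<Rightarrow> 'x) \<Rightarrow> 'w set \<Rightarrow> bool" where
  "oseledets_O1 T U \<Omega> \<longleftrightarrow>
     (\<forall>\<omega>\<in>\<Omega>. ((\<lambda>t. exp_rate t (onorm (U \<omega> t))) \<longlongrightarrow> - \<infinity>) (time_at_top T))"

text \<open>The subspace $F_i(\omega)$ in the second case, obtained from $F_\infty(\omega)$.\<close>

definition tail_sum :: "nat \<Rightarrow> (nat \<Rightarrow> 'w \<Rightarrow> 'x::real_vector set) \<Rightarrow> ('w \<Rightarrow> 'x set) \<Rightarrow> nat \<Rightarrow> 'w \<Rightarrow> 'x set" where
  "tail_sum k E Finf i \<omega> = (\<Sum>j\<in>{i<..k}. E j \<omega>) + Finf \<omega>"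

text \<open>In both cases the families \<open>\<mu>\<close>, \<open>E\<close> and \<open>F\<close> are indexed from \<open>1\<close>.\<close>

definition oseledets_O2 ::
  "'w measure \<Rightarrow> real set \<Rightarrow> (real \<Rightarrow> 'w \<Rightarrow> 'w) \<Rightarrow> ('w \<Rightarrow> real \<Rightarrow> 'x::banach \<Rightarrow> 'x) \<Rightarrow> 'w set \<Rightarrow>
   nat \<Rightarrow> (nat \<Rightarrow> real) \<Rightarrow> (nat \<Rightarrow> 'w \<Rightarrow> 'x set) \<Rightarrow> ('w \<Rightarrow> 'x set) \<Rightarrow> bool" where
  "oseledets_O2 M T \<theta> U \<Omega> k \<mu> E Finf \<longleftrightarrow>
     1 \<le> k \<and>
     (\<forall>i j. 1 \<le> i \<and> i < j \<and> j \<le> k \<longrightarrow> \<mu> j < \<mu> i) \<and>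
     (\<forall>i\<in>{1..k}. measurable_subspaces M \<Omega> (E i)) \<and>
     (\<forall>\<omega>\<in>\<Omega>. closed_finite_codim (Finf \<omega>)) \<and>
     (\<forall>i\<in>{1..k}. \<forall>\<omega>\<in>\<Omega>. \<forall>t\<in>nonneg_time T. U \<omega> t ` E i \<omega> = E i (\<theta> t \<omega>)) \<and>
     (\<forall>\<omega>\<in>\<Omega>. \<forall>t\<in>nonneg_time T. U \<omega> t ` Finf \<omega> \<subseteq> Finf (\<theta> t \<omega>)) \<and>
     (\<forall>\<omega>\<in>\<Omega>. direct_sum {1..Suc k} ((\<lambda>j. E j \<omega>)(Suc k := Finf \<omega>)) UNIV) \<and>
     (\<forall>i\<in>{1..k}.
        strongly_measurable_family M \<Omega>
          (\<lambda>\<omega>. proj_along (\<Sum>j\<in>{1..i}. E j \<omega>) (tail_sum k E Finf i \<omega>)) \<and>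
        tempered_family M T \<theta> \<Omega>
          (\<lambda>\<omega>. proj_along (\<Sum>j\<in>{1..i}. E j \<omega>) (tail_sum k E Finf i \<omega>))) \<and>
     (\<forall>i\<in>{1..k}. two_sided_exponent T \<theta> U \<Omega> (E i) (\<mu> i)) \<and>
     (\<forall>i\<in>{1..k}. \<forall>\<omega>\<in>\<Omega>. \<forall>u\<in>(E i \<omega> + tail_sum k E Finf i \<omega>) - tail_sum k E Finf i \<omega>.
        ((\<lambda>t. exp_rate t (norm (U \<omega> t u))) \<longlongrightarrow> ereal (\<mu> i)) (time_at_top T)) \<and>
     (\<forall>\<omega>\<in>\<Omega>. ((\<lambda>t. exp_rate t (onorm_on (Finf \<omega>) (U \<omega> t))) \<longlongrightarrow> - \<infinity>) (time_at_top T))"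

definition oseledets_O3 ::
  "'w measure \<Rightarrow> real set \<Rightarrow> (real \<Rightarrow> 'w \<Rightarrow> 'w) \<Rightarrow> ('w \<Rightarrow> real \<Rightarrow> 'x::banach \<Rightarrow> 'x) \<Rightarrow> 'w set \<Rightarrow>
   (nat \<Rightarrow> real) \<Rightarrow> (nat \<Rightarrow> 'w \<Rightarrow> 'x set) \<Rightarrow> (nat \<Rightarrow> 'w \<Rightarrow> 'x set) \<Rightarrow> bool" where
  "oseledets_O3 M T \<theta> U \<Omega> \<mu> E F \<longleftrightarrow>
     (\<forall>i j. 1 \<le> i \<and> i < j \<longrightarrow> \<mu> j < \<mu> i) \<and> filterlim \<mu> at_bot sequentially \<and>
     (\<forall>i\<ge>1. measurable_subspaces M \<Omega> (E i)) \<and>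
     (\<forall>i\<ge>1. \<forall>\<omega>\<in>\<Omega>. closed_finite_codim (F i \<omega>)) \<and>
     (\<forall>i\<ge>1. \<forall>\<omega>\<in>\<Omega>. \<forall>t\<in>nonneg_time T. U \<omega> t ` E i \<omega> = E i (\<theta> t \<omega>)) \<and>
     (\<forall>i\<ge>1. \<forall>\<omega>\<in>\<Omega>. \<forall>t\<in>nonneg_time T. U \<omega> t ` F i \<omega> \<subseteq> F i (\<theta> t \<omega>)) \<and>
     (\<forall>i\<ge>1. \<forall>\<omega>\<in>\<Omega>. direct_sum {1..Suc i} ((\<lambda>j. E j \<omega>)(Suc i := F i \<omega>)) UNIV) \<and>
     (\<forall>i\<ge>1. \<forall>\<omega>\<in>\<Omega>. F i \<omega> = E (Suc i) \<omega> + F (Suc i) \<omega>) \<and>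
     (\<forall>i\<ge>1.
        strongly_measurable_family M \<Omega> (\<lambda>\<omega>. proj_along (\<Sum>j\<in>{1..i}. E j \<omega>) (F i \<omega>)) \<and>
        tempered_family M T \<theta> \<Omega> (\<lambda>\<omega>. proj_along (\<Sum>j\<in>{1..i}. E j \<omega>) (F i \<omega>))) \<and>
     (\<forall>i\<ge>1. two_sided_exponent T \<theta> U \<Omega> (E i) (\<mu> i)) \<and>
     (\<forall>i\<ge>1. \<forall>\<omega>\<in>\<Omega>. \<forall>u\<in>(E i \<omega> + F i \<omega>) - F i \<omega>.
        ((\<lambda>t. exp_rate t (norm (U \<omega> t u))) \<longlongrightarrow> ereal (\<mu> i)) (time_at_top T)) \<and>
     (\<forall>i\<ge>1. \<forall>\<omega>\<in>\<Omega>.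
        ((\<lambda>t. exp_rate t (onorm_on (F i \<omega>) (U \<omega> t))) \<longlongrightarrow> ereal (\<mu> (Suc i))) (time_at_top T))"

section \<open>The entire orbit through \<open>w\<close> and its growth\<close>

definition principal_orbit ::
  "(real \<Rightarrow> 'w \<Rightarrow> 'w) \<Rightarrow> ('w \<Rightarrow> real \<Rightarrow> 'x::banach \<Rightarrow> 'x) \<Rightarrow> ('w \<Rightarrow> 'x) \<Rightarrow> 'w \<Rightarrow> real \<Rightarrow> 'x" where
  "principal_orbit \<theta> U w \<omega> t =
     (if 0 \<le> t then U \<omega> t (w \<omega>)
      else inv_into (span {w (\<theta> t \<omega>)}) (U (\<theta> t \<omega>) (- t)) (w \<omega>))"

definition growth_factor ::
  "(real \<Rightarrow> 'w \<Rightarrow> 'w) \<Rightarrow> ('w \<Rightarrow> real \<Rightarrow> 'x::banach \<Rightarrow> 'x) \<Rightarrow> ('w \<Rightarrow> 'x) \<Rightarrow> real \<Rightarrow> 'w \<Rightarrow> real" where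
  "growth_factor \<theta> U w t \<omega> =
     (if 0 \<le> t then norm (U \<omega> t (w \<omega>)) else 1 / norm (U (\<theta> t \<omega>) (- t) (w (\<theta> t \<omega>))))"

end

(*
  A focusing step contracts the projective distance in the cone, by a factor depending on kappa only,
  and the backward orbit of almost every base point returns infinitely often to a set where kappa
  is bounded. Hence the images of the cone under U from time -n to time 0 shrink to a ray, which
  is spanned by w. The logarithm of the growth of w is an additive cocycle, whose averages converge
  by Birkhoff's theorem; the maximal ergodic inequality behind it also covers
  the case where the negative part is not integrable. Integer and real times are compared through the two
  integrability conditions on U over [0,1].

  Orbits of nonzero vectors of the cone grow exactly as the orbit of w, which settles the case of a
  reproducing cone. If the cone is only total and U is compact, the image of the unit ball under
  one step lies, up to an error as small as desired, in the difference of two bounded pieces of the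
  cone. Iterating this splitting at the times when the constants are under control leaves a
  remainder that decays at any prescribed rate, so that no vector outgrows w. The Oseledets
  alternative is not needed for this; it enters only through the vectors of the cone outside
  the closed proper subspace F_1, whose exponent is lambda_1.
*)

theory Submission
  imports Defs
begin

section \<open>Exponential growth of sequences and of functions along the time set\<close>

text \<open>Two obstacles shape the proof. Ergodicity is assumed for the flow, and for real time
  \<open>\<theta> 1\<close> alone need not be ergodic. A Birkhoff limit for
  \<open>\<theta> 1\<close> is thus known to be constant only if the rate in question is also
  invariant under fractional times, which follows by interlacing the sequences seen from \<omega>
  and from \<open>\<theta> s \<omega>\<close>. The truncation is forced by the exponent -infinity:
  the growth of w then has no linear lower bound, but the splitting argument needs one to compare
  cone vectors that appear late with w started at time zero. Secondly, uncountably many times cannot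
  be intersected. Almost sure facts are collected on a set invariant under integer times only. For
  real time its union over all times is measurable, because it differs from that set by part of a
  null set and the measure is complete.\<close>

text \<open>Says that limsup x n / n \<le> c. With a real \<open>c\<close>, the limit -infinity
  appears as validity for every \<open>c\<close>.\<close>

definition rate_le :: "(nat \<Rightarrow> real) \<Rightarrow> real \<Rightarrow> bool" where
  "rate_le x c \<longleftrightarrow> (\<forall>d>c. eventually (\<lambda>n. x n \<le> d * real n) sequentially)"

lemma rate_le_mono: "rate_le x c \<Longrightarrow> c \<le> d \<Longrightarrow> rate_le x d"
  by (auto simp: rate_le_def)

text \<open>Countably many slopes suffice; this makes \<open>rate_le\<close> a measurable condition
  on the base point.\<close>

lemma rate_le_nat: "rate_le x c \<longleftrightarrow> (\<forall>j. eventually (\<lambda>n. x n \<le> (c + 1 / Suc j) * real n) sequentially)"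
proof
  assume "rate_le x c"
  then show "\<forall>j. eventually (\<lambda>n. x n \<le> (c + 1 / Suc j) * real n) sequentially"
    by (auto simp: rate_le_def)
next
  assume *: "\<forall>j. eventually (\<lambda>n. x n \<le> (c + 1 / Suc j) * real n) sequentially"
  show "rate_le x c"
    unfolding rate_le_def
  proof (intro allI impI)
    fix d assume "c < d"
    then obtain j where j: "1 / real (Suc j) < d - c"
      using nat_approx_posE[of "d - c"] by (auto simp: )
    show "eventually (\<lambda>n. x n \<le> d * real n) sequentially"
      using *[rule_format, of j]
    proof eventually_elim
      case (elim n)
      have "(c + 1 / Suc j) * real n \<le> d * real n"
        using j by (intro mult_right_mono) auto
      with elim show ?case by linarith
    qed
  qed
qed

lemma rate_le_perturb:
  assumes x: "rate_le x c" and r: "(\<lambda>n. r n / real n) \<longlonglongrightarrow> 0"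
    and y: "eventually (\<lambda>n. y n \<le> x n + r n) sequentially"
  shows "rate_le y c"
  unfolding rate_le_def
proof (intro allI impI)
  fix d assume "c < d"
  then obtain d' where d': "c < d'" "d' < d" using dense by blast
  have "eventually (\<lambda>n. x n \<le> d' * real n) sequentially"
    using x d' by (auto simp: rate_le_def)
  moreover have "eventually (\<lambda>n. r n / real n < d - d') sequentially"
    using r d' by (intro order_tendstoD(2)[OF r]) auto
  ultimately show "eventually (\<lambda>n. y n \<le> d * real n) sequentially"
    using y eventually_gt_at_top[of 0]
  proof eventually_elim
    case (elim n)
    then have "r n < (d - d') * real n" by (simp add: pos_divide_less_eq)
    with elim show ?case by (simp add: algebra_simps)
  qed
qed

text \<open>The slack between two slopes d' < d absorbs the index shift once n is large; the
  thresholds below solve the two resulting inequalities for n.\<close>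

lemma rate_le_Suc: "rate_le (\<lambda>n. x (Suc n)) c \<longleftrightarrow> rate_le x c"
proof
  assume x: "rate_le (\<lambda>n. x (Suc n)) c"
  show "rate_le x c"
    unfolding rate_le_def
  proof (intro allI impI)
    fix d assume "c < d"
    then obtain d' where d': "c < d'" "d' < d" using dense by blast
    have "eventually (\<lambda>n. x (Suc n) \<le> d' * real n) sequentially"
      using x d' by (auto simp: rate_le_def)
    moreover have "eventually (\<lambda>n. - d / (d - d') < real n) sequentially"
      by (rule filterlim_at_top_dense[THEN iffD1, rule_format, OF filterlim_real_sequentially])
    ultimately have "eventually (\<lambda>n. x (Suc n) \<le> d * real (Suc n)) sequentially"
    proof eventually_elim
      case (elim n)
      then have "- d < real n * (d - d')" using d' by (simp only: pos_divide_less_eq[of "d - d'"] diff_gt_0_iff_gt)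
      with elim show ?case by (simp add: algebra_simps)
    qed
    then show "eventually (\<lambda>n. x n \<le> d * real n) sequentially"
      by (rule eventually_sequentially_Suc[THEN iffD1])
  qed
next
  assume x: "rate_le x c"
  show "rate_le (\<lambda>n. x (Suc n)) c"
    unfolding rate_le_def
  proof (intro allI impI)
    fix d assume "c < d"
    then obtain d' where d': "c < d'" "d' < d" using dense by blast
    have "eventually (\<lambda>n. x n \<le> d' * real n) sequentially"
      using x d' by (auto simp: rate_le_def)
    then have "eventually (\<lambda>n. x (Suc n) \<le> d' * real (Suc n)) sequentially"
      by (rule eventually_sequentially_Suc[THEN iffD2])
    moreover have "eventually (\<lambda>n. d' / (d - d') < real n) sequentially"
      by (rule filterlim_at_top_dense[THEN iffD1, rule_format, OF filterlim_real_sequentially])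
    ultimately show "eventually (\<lambda>n. x (Suc n) \<le> d * real n) sequentially"
    proof eventually_elim
      case (elim n)
      then have "d' < real n * (d - d')" using d' by (simp add: pos_divide_less_eq)
      with elim show ?case by (simp add: algebra_simps)
    qed
  qed
qed

lemma rate_le_bounded:
  assumes "rate_le x c" "c < d"
  obtains R where "0 \<le> R" "\<And>n. x n \<le> R + d * real n"
proof -
  obtain m where m: "\<And>n. m \<le> n \<Longrightarrow> x n \<le> d * real n"
    using assms unfolding rate_le_def eventually_sequentially by blast
  \<comment> \<open>Only the finitely many indices below m can violate the bound, and R covers the
    violation of each.\<close>
  define R where "R = (\<Sum>n<m. \<bar>x n - d * real n\<bar>)"
  have "x n \<le> R + d * real n" for n
  proof (cases "m \<le> n")
    case True
    have "0 \<le> R" by (simp add: R_def sum_nonneg)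
    with m[OF True] show ?thesis by linarith
  next
    case False
    then have "\<bar>x n - d * real n\<bar> \<le> R" unfolding R_def by (intro member_le_sum) auto
    then show ?thesis by linarith
  qed
  moreover have "0 \<le> R" by (simp add: R_def sum_nonneg)
  ultimately show ?thesis using that by blast
qed

text \<open>Up to sublinear errors \<open>y n\<close> lies between \<open>x n\<close> and
  \<open>x (Suc n)\<close>. This is how growth at integer times looks from a base point shifted by a
  fraction of a unit.\<close>

lemma rate_le_interlace:
  assumes r: "(\<lambda>n. r n / real n) \<longlonglongrightarrow> 0" and r': "(\<lambda>n. r' n / real n) \<longlonglongrightarrow> 0"
    and y: "\<And>n. y n \<le> x n + r n" and x: "\<And>n. x (Suc n) \<le> y n + r' n"
  shows "rate_le y c \<longleftrightarrow> rate_le x c"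
  using rate_le_perturb[OF _ r, of x c y] rate_le_perturb[OF _ r', of y c "\<lambda>n. x (Suc n)"] x y
  by (auto simp: rate_le_Suc)

lemma rate_le_interlace':
  assumes r: "(\<lambda>n. r n / real n) \<longlonglongrightarrow> 0" and r': "(\<lambda>n. r' n / real n) \<longlonglongrightarrow> 0"
    and x: "\<And>n. x n \<le> y n + r n" and y: "\<And>n. y n \<le> x (Suc n) + r' n"
  shows "rate_le y c \<longleftrightarrow> rate_le x c"
  using rate_le_perturb[OF _ r, of y c x] rate_le_perturb[OF _ r', of "\<lambda>n. x (Suc n)" c y] x y
  by (auto simp: rate_le_Suc)

lemma tendsto_0_over_n_Suc:
  assumes "(\<lambda>n. r n / real n) \<longlonglongrightarrow> 0"
  shows "(\<lambda>n. r (Suc n) / real n) \<longlonglongrightarrow> 0"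
proof (rule Lim_null_comparison)
  show "(\<lambda>n. 2 * \<bar>r (Suc n) / real (Suc n)\<bar>) \<longlonglongrightarrow> 0"
    using tendsto_mult_right_zero[OF tendsto_rabs_zero[OF LIMSEQ_Suc[OF assms]], of 2] .
  show "eventually (\<lambda>n. norm (r (Suc n) / real n) \<le> 2 * \<bar>r (Suc n) / real (Suc n)\<bar>) sequentially"
    using eventually_ge_at_top[of 1]
  proof eventually_elim
    case (elim n)
    have "\<bar>r (Suc n)\<bar> * (1 / real n) \<le> \<bar>r (Suc n)\<bar> * (2 / real (Suc n))"
      using elim by (intro mult_left_mono) (auto simp: field_simps)
    then show ?case by (simp add: abs_divide mult.commute)
  qed
qed

lemma tendsto_over_n_add_const:
  assumes "(\<lambda>n. r n / real n) \<longlonglongrightarrow> 0"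
  shows "(\<lambda>n. (r n + k) / real n) \<longlonglongrightarrow> 0"
  using tendsto_add[OF assms lim_const_over_n[of k]] by (simp add: add_divide_distrib)

section \<open>Growth along the time set and limits of \<open>exp_rate\<close>\<close>

text \<open>Multiplicative form of limsup (ln (N t)) / t \<le> c. It stays meaningful when
  \<open>N t = 0\<close>, and lower bounds are obtained by applying it to
  \<open>inverse (N t)\<close>.\<close>

definition growth_le :: "real set \<Rightarrow> (real \<Rightarrow> real) \<Rightarrow> real \<Rightarrow> bool" where
  "growth_le T N c \<longleftrightarrow> (\<forall>d>c. eventually (\<lambda>t. N t \<le> exp (d * t)) (time_at_top T))"

lemma eventually_time_at_top:
  "eventually P (time_at_top T) \<longleftrightarrow> (\<exists>b. \<forall>t\<in>T. b \<le> t \<longrightarrow> P t)"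
  unfolding time_at_top_def eventually_inf_principal eventually_at_top_linorder by auto

lemma eventually_time_at_topI: "(\<And>t. t \<in> T \<Longrightarrow> b \<le> t \<Longrightarrow> P t) \<Longrightarrow> eventually P (time_at_top T)"
  unfolding eventually_time_at_top by auto

lemma time_at_top_neq_bot:
  assumes "T = \<int> \<or> T = (UNIV :: real set)"
  shows "time_at_top T \<noteq> bot"
proof -
  have "\<not> eventually (\<lambda>_. False) (time_at_top T)"
    unfolding eventually_time_at_top
  proof safe
    fix b assume *: "\<forall>t\<in>T. b \<le> t \<longrightarrow> False"
    have "of_int \<lceil>b\<rceil> \<in> T" using assms by auto
    with * show False by (meson le_of_int_ceiling)
  qed
  then show ?thesis by (auto simp: trivial_limit_def)
qed

lemma growth_le_shift:
  assumes N: "growth_le T N c" and s: "\<And>t. t \<in> T \<Longrightarrow> t + s \<in> T"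
    and le: "eventually (\<lambda>t. N' t \<le> k * N (t + s)) (time_at_top T)" and "0 \<le> k"
  shows "growth_le T N' c"
  unfolding growth_le_def
proof (intro allI impI)
  fix d assume "c < d"
  then obtain d' where d': "c < d'" "d' < d" using dense by blast
  obtain b where b: "\<And>t. t \<in> T \<Longrightarrow> b \<le> t \<Longrightarrow> N t \<le> exp (d' * t)"
    using N d' unfolding growth_le_def eventually_time_at_top by blast
  obtain b' where b': "\<And>t. t \<in> T \<Longrightarrow> b' \<le> t \<Longrightarrow> N' t \<le> k * N (t + s)"
    using le unfolding eventually_time_at_top by blast
  \<comment> \<open>\<open>exp q\<close> covers the factor k and the shift s; \<open>k + 1\<close>
    replaces k because k = 0 is allowed.\<close>
  define q where "q = ln (k + 1) + d' * s"
  show "eventually (\<lambda>t. N' t \<le> exp (d * t)) (time_at_top T)"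
  proof (rule eventually_time_at_topI[of _ "max (b - s) (max b' (q / (d - d')))"])
    fix t assume t: "t \<in> T" "max (b - s) (max b' (q / (d - d'))) \<le> t"
    then have "q / (d - d') \<le> t" by auto
    then have "q \<le> t * (d - d')" using d' by (simp add: pos_divide_le_eq)
    then have q: "q + d' * t \<le> d * t" by (simp add: algebra_simps)
    have "N' t \<le> k * N (t + s)" using b' t by auto
    also have "\<dots> \<le> k * exp (d' * (t + s))" using b[of "t + s"] s t \<open>0 \<le> k\<close>
      by (intro mult_left_mono) auto
    also have "\<dots> \<le> (k + 1) * exp (d' * (t + s))" by (simp add: mult_right_mono)
    also have "\<dots> = exp (q + d' * t)" using \<open>0 \<le> k\<close>
      by (simp add: q_def exp_add algebra_simps)
    also have "\<dots> \<le> exp (d * t)" using q by simp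
    finally show "N' t \<le> exp (d * t)" .
  qed
qed

lemma growth_le_cmult:
  assumes N: "growth_le T N c"
    and le: "eventually (\<lambda>t. N' t \<le> k * N t) (time_at_top T)" and "0 \<le> k"
  shows "growth_le T N' c"
  using growth_le_shift[OF N, of 0 N' k] assms by auto

lemma growth_le_add:
  assumes "growth_le T N c" "growth_le T N' c"
  shows "growth_le T (\<lambda>t. N t + N' t) c"
  unfolding growth_le_def
proof (intro allI impI)
  fix d assume "c < d"
  then obtain d' where d': "c < d'" "d' < d" using dense by blast
  have "growth_le T (\<lambda>t. exp (d' * t)) d'"
    unfolding growth_le_def
    by (auto intro!: eventually_time_at_topI[of _ 0] mult_right_mono)
  moreover have "eventually (\<lambda>t. N t + N' t \<le> 2 * exp (d' * t)) (time_at_top T)"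
    using assms[unfolded growth_le_def, rule_format, OF d'(1)] by eventually_elim auto
  ultimately have "growth_le T (\<lambda>t. N t + N' t) d'"
    by (rule growth_le_cmult) auto
  then show "eventually (\<lambda>t. N t + N' t \<le> exp (d * t)) (time_at_top T)"
    using d' by (auto simp: growth_le_def)
qed

text \<open>Passes from integer to arbitrary times: \<open>r n\<close> pays for the motion inside
  the unit interval after n.\<close>

lemma growth_le_interpolate:
  assumes x: "rate_le x c" and r: "(\<lambda>n. r n / real n) \<longlonglongrightarrow> 0"
    and N: "\<And>n s. 0 \<le> s \<Longrightarrow> s \<le> 1 \<Longrightarrow> real n + s \<in> T \<Longrightarrow> N (real n + s) \<le> exp (x n + r n)"
  shows "growth_le T N c"
  unfolding growth_le_def
proof (intro allI impI)
  fix d assume "c < d"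
  then obtain d' where d': "c < d'" "d' < d" using dense by blast
  have "rate_le (\<lambda>n. x n + r n) c" by (rule rate_le_perturb[OF x r]) auto
  then obtain m where m: "\<And>n. m \<le> n \<Longrightarrow> x n + r n \<le> d' * real n"
    using d' unfolding rate_le_def eventually_sequentially by blast
  show "eventually (\<lambda>t. N t \<le> exp (d * t)) (time_at_top T)"
  proof (rule eventually_time_at_topI[of _ "max (real m) (\<bar>d'\<bar> / (d - d'))"])
    fix t assume t: "t \<in> T" "max (real m) (\<bar>d'\<bar> / (d - d')) \<le> t"
    define n where "n = nat \<lfloor>t\<rfloor>"
    have t0: "0 \<le> t" using t by auto
    have n: "real n \<le> t" "t \<le> real n + 1" "m \<le> n"
      using t t0 by (auto simp: n_def le_nat_iff le_floor_iff)
    have "\<bar>d'\<bar> / (d - d') \<le> t" using t by auto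
    then have "\<bar>d'\<bar> \<le> t * (d - d')" using d' by (simp add: pos_divide_le_eq)
    \<comment> \<open>The slope d' may have either sign, so replacing n by t can cost
      \<open>\<bar>d'\<bar>\<close>; the slack d - d' absorbs this for large t.\<close>
    moreover have "d' * real n \<le> d' * t + \<bar>d'\<bar>"
    proof -
      have "d' * (real n - t) \<le> \<bar>d'\<bar> * \<bar>real n - t\<bar>" by (metis abs_ge_self abs_mult)
      also have "\<dots> \<le> \<bar>d'\<bar> * 1" using n by (intro mult_left_mono) auto
      finally show ?thesis by (simp add: algebra_simps)
    qed
    ultimately have d: "d' * real n \<le> d * t" by (simp add: algebra_simps)
    have "N (real n + (t - real n)) \<le> exp (x n + r n)" using n t by (intro N) auto
    also have "\<dots> \<le> exp (d * t)" using m[OF n(3)] d by simp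
    finally show "N t \<le> exp (d * t)" by simp
  qed
qed

lemma exp_rate_le: "0 < t \<Longrightarrow> x \<le> exp (d * t) \<Longrightarrow> exp_rate t x \<le> ereal d"
proof (cases "x \<le> 0")
  case False
  assume "0 < t" "x \<le> exp (d * t)"
  with False have "ln x \<le> d * t" by (metis ln_exp ln_mono not_le)
  with \<open>0 < t\<close> False show ?thesis
    by (simp add: exp_rate_def eln_def pos_divide_le_eq)
qed (simp add: exp_rate_def eln_def)

lemma exp_rate_ge: "0 < t \<Longrightarrow> 0 < x \<Longrightarrow> inverse x \<le> exp (d * t) \<Longrightarrow> ereal (- d) \<le> exp_rate t x"
proof -
  assume *: "0 < t" "0 < x" "inverse x \<le> exp (d * t)"
  then have "ln (inverse x) \<le> d * t" by (metis ln_exp ln_mono positive_imp_inverse_positive)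
  with * have "- (d * t) \<le> ln x" by (simp add: ln_inverse)
  with * show ?thesis
    by (simp add: exp_rate_def eln_def pos_le_divide_eq)
qed

lemma Limsup_exp_rate_le:
  assumes "\<And>c. \<Lambda> < ereal c \<Longrightarrow> growth_le T N c"
  shows "Limsup (time_at_top T) (\<lambda>t. exp_rate t (N t)) \<le> \<Lambda>"
proof (rule dense_ge)
  fix y assume "\<Lambda> < y"
  then obtain c where c: "\<Lambda> < ereal c" "ereal c < y" using ereal_dense2 by blast
  then obtain d where d: "ereal c < ereal d" "ereal d < y" using ereal_dense2 by blast
  have "eventually (\<lambda>t. N t \<le> exp (d * t)) (time_at_top T)"
    using assms[OF c(1)] d by (auto simp: growth_le_def)
  moreover have "eventually (\<lambda>t. 0 < t) (time_at_top T)"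
    by (rule eventually_time_at_topI[of _ 1]) auto
  ultimately have "eventually (\<lambda>t. exp_rate t (N t) \<le> ereal d) (time_at_top T)"
    by eventually_elim (auto intro: exp_rate_le)
  then have "Limsup (time_at_top T) (\<lambda>t. exp_rate t (N t)) \<le> ereal d" by (rule Limsup_bounded)
  with d show "Limsup (time_at_top T) (\<lambda>t. exp_rate t (N t)) \<le> y" by auto
qed

text \<open>The two families of bounds squeeze the limit. For \<Lambda> = -infinity the second
  family is empty, so this value needs no separate argument.\<close>

lemma tendsto_exp_rate:
  assumes up: "\<And>c. \<Lambda> < ereal c \<Longrightarrow> growth_le T N c"
    and lo: "\<And>c. ereal c < \<Lambda> \<Longrightarrow> growth_le T (\<lambda>t. inverse (N t)) (- c)"
    and pos: "eventually (\<lambda>t. 0 < N t) (time_at_top T)"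
  shows "((\<lambda>t. exp_rate t (N t)) \<longlongrightarrow> \<Lambda>) (time_at_top T)"
proof (rule order_tendstoI)
  have t0: "eventually (\<lambda>t. 0 < t) (time_at_top T)"
    by (rule eventually_time_at_topI[of _ 1]) auto
  {
    fix y assume "\<Lambda> < y"
    then obtain c where c: "\<Lambda> < ereal c" "ereal c < y" using ereal_dense2 by blast
    then obtain d where d: "ereal c < ereal d" "ereal d < y" using ereal_dense2 by blast
    have "eventually (\<lambda>t. N t \<le> exp (d * t)) (time_at_top T)"
      using up[OF c(1)] d by (auto simp: growth_le_def)
    with t0 show "eventually (\<lambda>t. exp_rate t (N t) < y) (time_at_top T)"
      by eventually_elim (use d in \<open>auto intro: le_less_trans[OF exp_rate_le]\<close>)
  next
    fix y assume "y < \<Lambda>"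
    then obtain c where c: "y < ereal c" "ereal c < \<Lambda>" using ereal_dense2 by blast
    then obtain d where d: "y < ereal d" "ereal d < ereal c" using ereal_dense2 by blast
    have "eventually (\<lambda>t. inverse (N t) \<le> exp ((- d) * t)) (time_at_top T)"
      using lo[OF c(2), unfolded growth_le_def, rule_format, of "- d"] d by auto
    with t0 pos show "eventually (\<lambda>t. y < exp_rate t (N t)) (time_at_top T)"
    proof eventually_elim
      case (elim t)
      then have "ereal (- (- d)) \<le> exp_rate t (N t)" by (intro exp_rate_ge)
      with d show ?case by auto
    qed
  }
qed

text \<open>Under t to -t both 1 / t and the logarithm of a reciprocal change sign, so the rate is
  the same at both ends.\<close>

lemma tendsto_exp_rate_bot:
  assumes T: "uminus ` T = T"
    and lim: "((\<lambda>t. exp_rate t (N t)) \<longlongrightarrow> \<Lambda>) (time_at_top T)"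
    and N': "\<And>t. t \<in> T \<Longrightarrow> 0 < t \<Longrightarrow> 0 < N t \<and> N' (- t) = 1 / N t"
  shows "((\<lambda>t. exp_rate t (N' t)) \<longlongrightarrow> \<Lambda>) (time_at_bot T)"
proof -
  have "time_at_bot T = filtermap uminus (time_at_top T)"
  proof -
    have "eventually P (time_at_bot T) \<longleftrightarrow> eventually P (filtermap uminus (time_at_top T))" for P
    proof -
      have "eventually P (time_at_bot T) \<longleftrightarrow> (\<exists>b. \<forall>t\<in>T. t \<le> b \<longrightarrow> P t)"
        unfolding time_at_bot_def eventually_inf_principal eventually_at_bot_linorder by auto
      also have "\<dots> \<longleftrightarrow> (\<exists>b. \<forall>t\<in>T. - b \<le> t \<longrightarrow> P (- t))"
        by (subst T[symmetric]) (simp add: minus_le_iff)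
      also have "\<dots> \<longleftrightarrow> (\<exists>b. \<forall>t\<in>T. b \<le> t \<longrightarrow> P (- t))"
        by (metis minus_minus)
      finally show ?thesis by (simp add: eventually_filtermap eventually_time_at_top)
    qed
    then show ?thesis by (simp add: filter_eq_iff)
  qed
  moreover have "((\<lambda>t. exp_rate (- t) (N' (- t))) \<longlongrightarrow> \<Lambda>) (time_at_top T)"
  proof (rule Lim_transform_eventually[OF lim])
    show "eventually (\<lambda>t. exp_rate t (N t) = exp_rate (- t) (N' (- t))) (time_at_top T)"
    proof (rule eventually_time_at_topI[of _ 1])
      fix t assume "t \<in> T" "1 \<le> t"
      with N'[of t] show "exp_rate t (N t) = exp_rate (- t) (N' (- t))"
        by (auto simp: exp_rate_def eln_def ln_div)
    qed
  qed
  ultimately show ?thesis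
    by (simp add: filterlim_filtermap)
qed

section \<open>Birkhoff sums of a measure preserving map\<close>

definition birkhoff_sum :: "('a \<Rightarrow> 'a) \<Rightarrow> ('a \<Rightarrow> real) \<Rightarrow> 'a \<Rightarrow> nat \<Rightarrow> real" where
  "birkhoff_sum \<tau> g \<omega> n = (\<Sum>i<n. g ((\<tau> ^^ i) \<omega>))"

lemma birkhoff_sum_0 [simp]: "birkhoff_sum \<tau> g \<omega> 0 = 0"
  by (simp add: birkhoff_sum_def)

lemma birkhoff_sum_Suc: "birkhoff_sum \<tau> g \<omega> (Suc n) = g \<omega> + birkhoff_sum \<tau> g (\<tau> \<omega>) n"
  unfolding birkhoff_sum_def by (subst sum.lessThan_Suc_shift) (simp add: funpow_swap1)

lemma birkhoff_sum_Suc_right: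
  "birkhoff_sum \<tau> g \<omega> (Suc n) = birkhoff_sum \<tau> g \<omega> n + g ((\<tau> ^^ n) \<omega>)"
  by (simp add: birkhoff_sum_def)

text \<open>Passing to \<open>\<tau> \<omega>\<close> shifts the index and subtracts the constant
  \<open>g \<omega>\<close>. Sets defined by such rates are therefore invariant at every point, as
  the maximal inequality requires.\<close>

lemma rate_le_birkhoff_invariant:
  "rate_le (birkhoff_sum \<tau> g (\<tau> \<omega>)) c \<longleftrightarrow> rate_le (birkhoff_sum \<tau> g \<omega>) c"
proof -
  have "rate_le (birkhoff_sum \<tau> g (\<tau> \<omega>)) c \<longleftrightarrow> rate_le (\<lambda>n. birkhoff_sum \<tau> g \<omega> (Suc n)) c"
  proof
    assume "rate_le (birkhoff_sum \<tau> g (\<tau> \<omega>)) c"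
    then show "rate_le (\<lambda>n. birkhoff_sum \<tau> g \<omega> (Suc n)) c"
      by (rule rate_le_perturb[OF _ lim_const_over_n[of "g \<omega>"]]) (simp add: birkhoff_sum_Suc)
  next
    assume "rate_le (\<lambda>n. birkhoff_sum \<tau> g \<omega> (Suc n)) c"
    then show "rate_le (birkhoff_sum \<tau> g (\<tau> \<omega>)) c"
      by (rule rate_le_perturb[OF _ lim_const_over_n[of "- g \<omega>"]]) (simp add: birkhoff_sum_Suc)
  qed
  then show ?thesis by (simp add: rate_le_Suc)
qed

lemma not_rate_le_imp_ex:
  assumes "\<not> rate_le x c" shows "\<exists>n. c * real n < x n"
proof (rule ccontr)
  assume "\<not> ?thesis"
  then have "x n \<le> c * real n" for n by (simp add: not_less)
  then have "x n \<le> d * real n" if "c < d" for n d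
    using that by (meson less_imp_le mult_right_mono of_nat_0_le_iff order_trans)
  then have "rate_le x c" by (simp add: rate_le_def)
  with assms show False by simp
qed

section \<open>The maximal ergodic inequality\<close>

text \<open>The maximum of the Birkhoff sums of lengths 0 to n, in a recursive form that relates it
  to the maximum at \<open>\<tau> \<omega>\<close>.\<close>

primrec max_birkhoff :: "('a \<Rightarrow> 'a) \<Rightarrow> ('a \<Rightarrow> real) \<Rightarrow> nat \<Rightarrow> 'a \<Rightarrow> real" where
  "max_birkhoff \<tau> h 0 \<omega> = 0"
| "max_birkhoff \<tau> h (Suc n) \<omega> = max 0 (h \<omega> + max_birkhoff \<tau> h n (\<tau> \<omega>))"

lemma max_birkhoff_nonneg: "0 \<le> max_birkhoff \<tau> h n \<omega>"
  by (cases n) auto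

lemma max_birkhoff_Suc: "max_birkhoff \<tau> h n \<omega> \<le> max_birkhoff \<tau> h (Suc n) \<omega>"
proof (induction n arbitrary: \<omega>)
  case (Suc n)
  have "max 0 (h \<omega> + max_birkhoff \<tau> h n (\<tau> \<omega>)) \<le> max 0 (h \<omega> + max_birkhoff \<tau> h (Suc n) (\<tau> \<omega>))"
    by (intro max.mono order_refl add_left_mono Suc)
  then show ?case by simp
qed auto

lemma max_birkhoff_mono: "m \<le> n \<Longrightarrow> max_birkhoff \<tau> h m \<omega> \<le> max_birkhoff \<tau> h n \<omega>"
  by (rule lift_Suc_mono_le[of "\<lambda>n. max_birkhoff \<tau> h n \<omega>"]) (rule max_birkhoff_Suc)

lemma birkhoff_sum_le_max: "birkhoff_sum \<tau> h \<omega> n \<le> max_birkhoff \<tau> h n \<omega>"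
proof (induction n arbitrary: \<omega>)
  case (Suc n)
  show ?case using Suc[of "\<tau> \<omega>"] by (simp add: birkhoff_sum_Suc)
qed auto

locale measure_preserving_map = prob_space M for M :: "'a measure" +
  fixes \<tau> :: "'a \<Rightarrow> 'a"
  assumes map_measurable [measurable]: "\<tau> \<in> M \<rightarrow>\<^sub>M M"
    and map_distr: "distr M M \<tau> = M"
begin

lemma iterate_measurable [measurable]: "\<tau> ^^ n \<in> M \<rightarrow>\<^sub>M M"
  by (induction n) (auto simp: id_def comp_def)

lemma iterate_distr: "distr M M (\<tau> ^^ n) = M"
proof (induction n)
  case (Suc n)
  have "distr M M (\<tau> ^^ Suc n) = distr (distr M M (\<tau> ^^ n)) M \<tau>"
    by (simp add: distr_distr)
  then show ?case by (simp only: Suc map_distr)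
qed (simp add: distr_id id_def)

lemma integrable_map:
  fixes f :: "'a \<Rightarrow> real"
  shows "integrable M f \<Longrightarrow> integrable M (\<lambda>x. f (\<tau> x))"
  by (rule integrable_distr[of \<tau> M M]) (auto simp: map_distr)

lemma integral_map:
  fixes f :: "'a \<Rightarrow> real"
  shows "f \<in> borel_measurable M \<Longrightarrow> (\<integral>x. f (\<tau> x) \<partial>M) = (\<integral>x. f x \<partial>M)"
  by (subst integral_distr[of \<tau> M M, symmetric]) (auto simp: map_distr)

lemma birkhoff_sum_measurable [measurable]:
  "g \<in> borel_measurable M \<Longrightarrow> (\<lambda>\<omega>. birkhoff_sum \<tau> g \<omega> n) \<in> borel_measurable M"
  unfolding birkhoff_sum_def by (intro borel_measurable_sum measurable_compose[OF iterate_measurable])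

lemma rate_le_birkhoff_measurable [measurable]:
  assumes [measurable]: "g \<in> borel_measurable M"
  shows "Measurable.pred M (\<lambda>\<omega>. rate_le (birkhoff_sum \<tau> g \<omega>) c)"
  unfolding rate_le_nat by measurable

lemma integrable_max_birkhoff:
  "integrable M h \<Longrightarrow> integrable M (max_birkhoff \<tau> h n)"
proof (induction n)
  case (Suc n)
  have "integrable M (\<lambda>\<omega>. max 0 (h \<omega> + max_birkhoff \<tau> h n (\<tau> \<omega>)))"
    using Suc integrable_map[of "max_birkhoff \<tau> h n"] by auto
  then show ?case by simp
next
  case 0
  have "max_birkhoff \<tau> h 0 = (\<lambda>_. 0)" by auto
  then show ?case by simp
qed

text \<open>Garsia's argument.\<close>

lemma maximal_ergodic:
  assumes h: "integrable M h" and [measurable]: "A \<in> sets M"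
    and zero: "\<And>\<omega>. \<omega> \<in> space M - A \<Longrightarrow> h \<omega> = 0"
    and pos: "\<And>\<omega>. \<omega> \<in> A \<Longrightarrow> \<exists>n. 0 < birkhoff_sum \<tau> h \<omega> n"
  shows "0 \<le> (\<integral>\<omega>. h \<omega> \<partial>M)"
proof -
  have [measurable]: "h \<in> borel_measurable M" "max_birkhoff \<tau> h n \<in> borel_measurable M" for n
    using h integrable_max_birkhoff[OF h] by auto
  define E where "E n = {\<omega> \<in> space M. 0 < max_birkhoff \<tau> h n \<omega>}" for n
  have [measurable]: "E n \<in> sets M" for n unfolding E_def by measurable
  have ge: "0 \<le> (\<integral>\<omega>. h \<omega> * indicator (E n) \<omega> \<partial>M)" for n
  proof -
    have "0 = (\<integral>\<omega>. max_birkhoff \<tau> h n \<omega> - max_birkhoff \<tau> h n (\<tau> \<omega>) \<partial>M)"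
      using integrable_max_birkhoff[OF h, of n] integrable_map[OF integrable_max_birkhoff[OF h, of n]]
      by (simp add: integral_map)
    also have "\<dots> \<le> (\<integral>\<omega>. h \<omega> * indicator (E n) \<omega> \<partial>M)"
    proof (rule integral_mono)
      fix \<omega> assume "\<omega> \<in> space M"
      show "max_birkhoff \<tau> h n \<omega> - max_birkhoff \<tau> h n (\<tau> \<omega>) \<le> h \<omega> * indicator (E n) \<omega>"
      proof (cases "\<omega> \<in> E n")
        case True
        then obtain m where n: "n = Suc m" unfolding E_def by (cases n) auto
        \<comment> \<open>A positive maximum is attained by a sum of length at least one, so the
          alternative 0 in the recursion drops out.\<close>
        have "max_birkhoff \<tau> h n \<omega> = h \<omega> + max_birkhoff \<tau> h m (\<tau> \<omega>)"
          using True unfolding E_def n by (simp add: max_def split: if_splits)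
        also have "\<dots> \<le> h \<omega> + max_birkhoff \<tau> h n (\<tau> \<omega>)"
          using max_birkhoff_Suc[of \<tau> h m "\<tau> \<omega>"] n by simp
        finally show ?thesis using True by simp
      next
        case False
        then have "max_birkhoff \<tau> h n \<omega> = 0"
          using max_birkhoff_nonneg[of \<tau> h n \<omega>] \<open>\<omega> \<in> space M\<close> unfolding E_def by auto
        then show ?thesis using False max_birkhoff_nonneg[of \<tau> h n "\<tau> \<omega>"] by simp
      qed
    qed (use integrable_max_birkhoff[OF h, of n] integrable_map[OF integrable_max_birkhoff[OF h, of n]] h
        in \<open>auto intro: integrable_real_mult_indicator\<close>)
    finally show ?thesis .
  qed
  \<comment> \<open>Every point of A lies in all late \<open>E n\<close>, and h vanishes off A, so
    the restriction to \<open>E n\<close> disappears in the limit.\<close>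
  have "(\<lambda>n. \<integral>\<omega>. h \<omega> * indicator (E n) \<omega> \<partial>M) \<longlonglongrightarrow> (\<integral>\<omega>. h \<omega> \<partial>M)"
  proof (rule integral_dominated_convergence[where w = "\<lambda>\<omega>. \<bar>h \<omega>\<bar>"])
    show "AE \<omega> in M. (\<lambda>n. h \<omega> * indicator (E n) \<omega>) \<longlonglongrightarrow> h \<omega>"
    proof (rule AE_I2)
      fix \<omega> assume \<omega>: "\<omega> \<in> space M"
      show "(\<lambda>n. h \<omega> * indicator (E n) \<omega>) \<longlonglongrightarrow> h \<omega>"
      proof (cases "\<omega> \<in> A")
        case True
        then obtain m where m: "0 < birkhoff_sum \<tau> h \<omega> m" using pos by blast
        have "eventually (\<lambda>n. h \<omega> * indicator (E n) \<omega> = h \<omega>) sequentially"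
          using eventually_ge_at_top[of m]
        proof eventually_elim
          case (elim n)
          have "0 < max_birkhoff \<tau> h n \<omega>"
            using m birkhoff_sum_le_max[of \<tau> h \<omega> m] max_birkhoff_mono[OF elim, of \<tau> h \<omega>] by linarith
          then show ?case using \<omega> by (simp add: E_def)
        qed
        then show ?thesis by (rule tendsto_eventually)
      qed (use zero \<omega> in simp)
    qed
  qed (use h in \<open>auto simp: indicator_def\<close>)
  then show ?thesis using ge by (auto intro: LIMSEQ_le_const)
qed

lemma birkhoff_sum_restrict_invariant:
  assumes inv: "\<And>\<omega>. \<omega> \<in> space M \<Longrightarrow> \<tau> \<omega> \<in> A \<longleftrightarrow> \<omega> \<in> A" and \<omega>: "\<omega> \<in> A" "\<omega> \<in> space M"
  shows "birkhoff_sum \<tau> (\<lambda>\<omega>. g \<omega> * indicator A \<omega>) \<omega> n = birkhoff_sum \<tau> g \<omega> n"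
proof -
  have "(\<tau> ^^ i) \<omega> \<in> A" for i
  proof (induction i)
    case (Suc i)
    have "(\<tau> ^^ i) \<omega> \<in> space M" using measurable_space[OF iterate_measurable \<omega>(2)] .
    with Suc inv show ?case by simp
  qed (use \<omega> in simp)
  then show ?thesis by (simp add: birkhoff_sum_def)
qed

text \<open>The function f - c cut off to A has positive Birkhoff sums on A: orbits starting in A
  stay there, so the cut-off does not change their sums.\<close>

lemma maximal_inequality:
  assumes f: "integrable M f" and A [measurable]: "A \<in> sets M"
    and inv: "\<And>\<omega>. \<omega> \<in> space M \<Longrightarrow> \<tau> \<omega> \<in> A \<longleftrightarrow> \<omega> \<in> A"
    and gt: "\<And>\<omega>. \<omega> \<in> A \<Longrightarrow> \<exists>n. c * real n < birkhoff_sum \<tau> f \<omega> n"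
  shows "c * prob A \<le> (\<integral>\<omega>. f \<omega> * indicator A \<omega> \<partial>M)"
proof -
  define h where "h \<omega> = (f \<omega> - c) * indicator A \<omega>" for \<omega>
  have h: "integrable M h" unfolding h_def
    by (intro integrable_real_mult_indicator Bochner_Integration.integrable_diff f) auto
  have "0 \<le> (\<integral>\<omega>. h \<omega> \<partial>M)"
  proof (rule maximal_ergodic[OF h A])
    fix \<omega> assume \<omega>: "\<omega> \<in> A"
    then obtain n where n: "c * real n < birkhoff_sum \<tau> f \<omega> n" using gt by blast
    have "birkhoff_sum \<tau> h \<omega> n = birkhoff_sum \<tau> (\<lambda>\<omega>. f \<omega> - c) \<omega> n"
      unfolding h_def using \<omega> sets.sets_into_space[OF A]
      by (intro birkhoff_sum_restrict_invariant inv) auto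
    also have "\<dots> = birkhoff_sum \<tau> f \<omega> n - c * real n"
      by (simp add: birkhoff_sum_def sum_subtractf)
    finally show "\<exists>n. 0 < birkhoff_sum \<tau> h \<omega> n" using n by (auto intro!: exI[of _ n])
  qed (simp add: h_def)
  also have "(\<integral>\<omega>. h \<omega> \<partial>M) = (\<integral>\<omega>. f \<omega> * indicator A \<omega> - c * indicator A \<omega> \<partial>M)"
    by (simp add: h_def algebra_simps)
  also have "\<dots> = (\<integral>\<omega>. f \<omega> * indicator A \<omega> \<partial>M) - c * prob A"
    by (subst Bochner_Integration.integral_diff)
      (use f in \<open>auto intro: integrable_real_mult_indicator
        simp: Int_absorb1 sets.sets_into_space less_top[symmetric]\<close>)
  finally show ?thesis by simp
qed

lemma integrable_truncation:
  assumes f [measurable]: "f \<in> borel_measurable M" and fin: "(\<integral>\<^sup>+\<omega>. ennreal (f \<omega>) \<partial>M) < \<infinity>"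
  shows "integrable M (\<lambda>\<omega>. max (f \<omega>) (- real N))"
proof (rule Bochner_Integration.integrable_bound)
  have "integrable M (\<lambda>\<omega>. max (f \<omega>) 0)"
  proof -
    have "(\<integral>\<^sup>+\<omega>. ennreal (max (f \<omega>) 0) \<partial>M) = (\<integral>\<^sup>+\<omega>. ennreal (f \<omega>) \<partial>M)"
      by (intro nn_integral_cong) (auto simp: max_def ennreal_neg)
    then show ?thesis
      using fin by (simp add: real_integrable_def ennreal_neg)
  qed
  then show "integrable M (\<lambda>\<omega>. max (f \<omega>) 0 + real N)" by auto
  show "AE \<omega> in M. norm (max (f \<omega>) (- real N)) \<le> norm (max (f \<omega>) 0 + real N)"
    by (auto simp: max_def)
qed measurable

text \<open>Integrability on A is a conclusion here. The truncated integrals decrease in N but stay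
  above \<open>c * prob A\<close>, so monotone convergence applies to their negatives and passes the
  bound on to f.\<close>

lemma maximal_inequality_truncation:
  assumes f [measurable]: "f \<in> borel_measurable M" and fin: "(\<integral>\<^sup>+\<omega>. ennreal (f \<omega>) \<partial>M) < \<infinity>"
    and A [measurable]: "A \<in> sets M"
    and inv: "\<And>\<omega>. \<omega> \<in> space M \<Longrightarrow> \<tau> \<omega> \<in> A \<longleftrightarrow> \<omega> \<in> A"
    and gt: "\<And>\<omega> N. \<omega> \<in> A \<Longrightarrow>
      \<exists>n. c * real n < birkhoff_sum \<tau> (\<lambda>\<omega>. max (f \<omega>) (- real N)) \<omega> n"
  shows "integrable M (\<lambda>\<omega>. f \<omega> * indicator A \<omega>)"
    and "c * prob A \<le> (\<integral>\<omega>. f \<omega> * indicator A \<omega> \<partial>M)"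
proof -
  define F where "F N \<omega> = max (f \<omega>) (- real N) * indicator A \<omega>" for N :: nat and \<omega>
  have F: "integrable M (F N)" for N
    unfolding F_def by (intro integrable_real_mult_indicator integrable_truncation f fin) simp
  have ge: "c * prob A \<le> (\<integral>\<omega>. F N \<omega> \<partial>M)" for N
    unfolding F_def by (intro maximal_inequality integrable_truncation f fin inv gt A)
  have anti: "F n \<omega> \<le> F m \<omega>" if "m \<le> n" for m n \<omega>
    using that by (auto simp: F_def indicator_def)
  have "decseq (\<lambda>N. \<integral>\<omega>. F N \<omega> \<partial>M)"
    unfolding decseq_def by (auto intro!: integral_mono F anti)
  then obtain L where L: "(\<lambda>N. \<integral>\<omega>. F N \<omega> \<partial>M) \<longlonglongrightarrow> L"
    using decseq_convergent[of "\<lambda>N. \<integral>\<omega>. F N \<omega> \<partial>M" "c * prob A"] ge by blast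
  have 1: "integrable M (\<lambda>\<omega>. - F N \<omega>)" for N using F by simp
  have 2: "AE \<omega> in M. mono (\<lambda>N. - F N \<omega>)" using anti by (auto simp: mono_def)
  have 3: "AE \<omega> in M. (\<lambda>N. - F N \<omega>) \<longlonglongrightarrow> - (f \<omega> * indicator A \<omega>)"
  proof (intro AE_I2 tendsto_eventually)
    fix \<omega>
    obtain N where N: "- f \<omega> \<le> real N" using real_arch_simple by blast
    show "eventually (\<lambda>N. - F N \<omega> = - (f \<omega> * indicator A \<omega>)) sequentially"
      using eventually_ge_at_top[of N] by eventually_elim (use N in \<open>auto simp: F_def\<close>)
  qed
  have 4: "(\<lambda>N. \<integral>\<omega>. - F N \<omega> \<partial>M) \<longlonglongrightarrow> - L"
    using tendsto_minus[OF L] by simp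
  have 5: "(\<lambda>\<omega>. - (f \<omega> * indicator A \<omega>)) \<in> borel_measurable M" by measurable
  show "integrable M (\<lambda>\<omega>. f \<omega> * indicator A \<omega>)"
    using integrable_monotone_convergence[OF 1 2 3 4 5] by simp
  have "(\<integral>\<omega>. f \<omega> * indicator A \<omega> \<partial>M) = L"
    using integral_monotone_convergence[OF 1 2 3 4 5] by simp
  then show "c * prob A \<le> (\<integral>\<omega>. f \<omega> * indicator A \<omega> \<partial>M)"
    using LIMSEQ_le_const[OF L] ge by blast
qed

lemma maximal_inequality_extended:
  assumes f [measurable]: "f \<in> borel_measurable M" and fin: "(\<integral>\<^sup>+\<omega>. ennreal (f \<omega>) \<partial>M) < \<infinity>"
    and A [measurable]: "A \<in> sets M"
    and inv: "\<And>\<omega>. \<omega> \<in> space M \<Longrightarrow> \<tau> \<omega> \<in> A \<longleftrightarrow> \<omega> \<in> A"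
    and gt: "\<And>\<omega>. \<omega> \<in> A \<Longrightarrow> \<exists>n. c * real n < birkhoff_sum \<tau> f \<omega> n"
  shows "integrable M (\<lambda>\<omega>. f \<omega> * indicator A \<omega>)"
    and "c * prob A \<le> (\<integral>\<omega>. f \<omega> * indicator A \<omega> \<partial>M)"
proof -
  have "\<exists>n. c * real n < birkhoff_sum \<tau> (\<lambda>\<omega>. max (f \<omega>) (- real N)) \<omega> n" if \<omega>: "\<omega> \<in> A" for \<omega> N
  proof -
    obtain n where "c * real n < birkhoff_sum \<tau> f \<omega> n" using gt \<omega> by blast
    also have "\<dots> \<le> birkhoff_sum \<tau> (\<lambda>\<omega>. max (f \<omega>) (- real N)) \<omega> n"
      by (auto simp: birkhoff_sum_def intro!: sum_mono)
    finally show ?thesis by blast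
  qed
  from maximal_inequality_truncation[OF f fin A inv this]
  show "integrable M (\<lambda>\<omega>. f \<omega> * indicator A \<omega>)"
    and "c * prob A \<le> (\<integral>\<omega>. f \<omega> * indicator A \<omega> \<partial>M)" by blast+
qed

end

section \<open>Almost sure limits: Birkhoff averages, temperedness, recurrence\<close>

definition extended_integral :: "'a measure \<Rightarrow> ('a \<Rightarrow> real) \<Rightarrow> ereal" where
  "extended_integral M f =
     enn2ereal (\<integral>\<^sup>+\<omega>. ennreal (f \<omega>) \<partial>M) - enn2ereal (\<integral>\<^sup>+\<omega>. ennreal (- f \<omega>) \<partial>M)"

lemma extended_integral_eq: "integrable M f \<Longrightarrow> extended_integral M f = ereal (\<integral>\<omega>. f \<omega> \<partial>M)"
  by (erule integrableE) (simp add: extended_integral_def)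

lemma extended_integral_eq_minf:
  assumes "f \<in> borel_measurable M" "(\<integral>\<^sup>+\<omega>. ennreal (f \<omega>) \<partial>M) < \<infinity>" "\<not> integrable M f"
  shows "extended_integral M f = - \<infinity>"
proof -
  have "(\<integral>\<^sup>+\<omega>. ennreal (- f \<omega>) \<partial>M) = \<infinity>"
    using assms by (auto simp: real_integrable_def)
  moreover obtain r where "(\<integral>\<^sup>+\<omega>. ennreal (f \<omega>) \<partial>M) = ennreal r" "0 \<le> r"
    using assms(2) by (cases "\<integral>\<^sup>+\<omega>. ennreal (f \<omega>) \<partial>M") auto
  ultimately show ?thesis by (simp add: extended_integral_def)
qed

lemma extended_integral_less_top:
  assumes "f \<in> borel_measurable M" "(\<integral>\<^sup>+\<omega>. ennreal (f \<omega>) \<partial>M) < \<infinity>"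
  shows "extended_integral M f < \<infinity>"
  using extended_integral_eq[of M f] extended_integral_eq_minf[OF assms] by (cases "integrable M f") auto

context measure_preserving_map
begin

text \<open>The hypothesis \<open>zero_one\<close> stands in for ergodicity of \<tau>. If the bound
  failed almost everywhere for some c above the integral, the maximal inequality on an invariant set
  of full measure would bound the integral below by c.\<close>

lemma AE_rate_le_birkhoff:
  assumes f [measurable]: "f \<in> borel_measurable M" and fin: "(\<integral>\<^sup>+\<omega>. ennreal (f \<omega>) \<partial>M) < \<infinity>"
    and zero_one: "\<And>c. (AE \<omega> in M. rate_le (birkhoff_sum \<tau> f \<omega>) c) \<or>
                        (AE \<omega> in M. \<not> rate_le (birkhoff_sum \<tau> f \<omega>) c)"
  shows "AE \<omega> in M. \<forall>c. extended_integral M f < ereal c \<longrightarrow> rate_le (birkhoff_sum \<tau> f \<omega>) c"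
proof -
  have each: "AE \<omega> in M. rate_le (birkhoff_sum \<tau> f \<omega>) c" if c: "extended_integral M f < ereal c" for c
  proof (rule ccontr)
    assume "\<not> ?thesis"
    then have ae: "AE \<omega> in M. \<not> rate_le (birkhoff_sum \<tau> f \<omega>) c" using zero_one by blast
    define A where "A = {\<omega> \<in> space M. \<not> rate_le (birkhoff_sum \<tau> f \<omega>) c}"
    have A [measurable]: "A \<in> sets M" unfolding A_def by measurable
    have aeA: "AE \<omega> in M. \<omega> \<in> A" using ae unfolding A_def by auto
    then have pA: "prob A = 1" by (simp add: AE_in_set_eq_1)
    have inv: "\<tau> \<omega> \<in> A \<longleftrightarrow> \<omega> \<in> A" if "\<omega> \<in> space M" for \<omega>
      using that measurable_space[OF map_measurable that]
      by (simp add: A_def rate_le_birkhoff_invariant)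
    have gt: "\<exists>n. c * real n < birkhoff_sum \<tau> f \<omega> n" if "\<omega> \<in> A" for \<omega>
      using that not_rate_le_imp_ex by (auto simp: A_def)
    have mx: "integrable M (\<lambda>\<omega>. f \<omega> * indicator A \<omega>)"
      "c * prob A \<le> (\<integral>\<omega>. f \<omega> * indicator A \<omega> \<partial>M)"
      by (rule maximal_inequality_extended[OF f fin A]; use inv gt in blast)+
    have "integrable M f"
      by (rule integrable_cong_AE_imp[OF mx(1) f]) (use aeA in \<open>eventually_elim, simp\<close>)
    moreover have "(\<integral>\<omega>. f \<omega> * indicator A \<omega> \<partial>M) = (\<integral>\<omega>. f \<omega> \<partial>M)"
      by (rule integral_cong_AE) (use aeA in \<open>auto elim: eventually_mono\<close>)
    ultimately show False using mx(2) pA c by (simp add: extended_integral_eq)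
  qed
  \<comment> \<open>Rational bounds keep the number of exceptional sets countable; monotonicity in c
    then covers all reals.\<close>
  have "AE \<omega> in M. \<forall>q::rat. extended_integral M f < ereal (of_rat q) \<longrightarrow>
    rate_le (birkhoff_sum \<tau> f \<omega>) (of_rat q)"
    unfolding AE_all_countable by (auto intro: each)
  then show ?thesis
  proof eventually_elim
    case (elim \<omega>)
    show ?case
    proof (intro allI impI)
      fix c assume "extended_integral M f < ereal c"
      then obtain d where d: "extended_integral M f < ereal d" "ereal d < ereal c"
        using ereal_dense2 by blast
      then obtain q where q: "d < of_rat q" "of_rat q < c" using of_rat_dense[of d c] by auto
      have "extended_integral M f < ereal (of_rat q)" using d(1) q(1)
        by (meson ereal_less_eq(3) less_le_trans less_imp_le)
      with elim q(2) show "rate_le (birkhoff_sum \<tau> f \<omega>) c" by (auto intro: rate_le_mono)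
    qed
  qed
qed

text \<open>
  Without ergodicity the limits of the Birkhoff averages of the truncations of \<open>f\<close> need not be
  constant, but on an invariant set where all of them exceed \<open>c\<close> the integral of \<open>f\<close> does as well.
\<close>

lemma AE_rate_le_truncation:
  assumes f [measurable]: "f \<in> borel_measurable M" and fin: "(\<integral>\<^sup>+\<omega>. ennreal (f \<omega>) \<partial>M) < \<infinity>"
    and up: "AE \<omega> in M. \<forall>c. \<Lambda> < ereal c \<longrightarrow> rate_le (birkhoff_sum \<tau> f \<omega>) c"
  shows "AE \<omega> in M. \<forall>c. \<Lambda> < ereal c \<longrightarrow>
    (\<exists>N. rate_le (birkhoff_sum \<tau> (\<lambda>\<omega>. max (f \<omega>) (- real N)) \<omega>) c)"
proof -
  define fN where "fN N \<omega> = max (f \<omega>) (- real N)" for N :: nat and \<omega>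
  have [measurable]: "fN N \<in> borel_measurable M" for N unfolding fN_def by measurable
  have each: "AE \<omega> in M. \<exists>N. rate_le (birkhoff_sum \<tau> (fN N) \<omega>) c" if c: "\<Lambda> < ereal c" for c
  proof -
    obtain d where d: "\<Lambda> < ereal d" "ereal d < ereal c" using ereal_dense2[OF c] by blast
    then have dc: "d < c" by simp
    \<comment> \<open>On A every truncation has upper rate above c, which bounds the integral of f
      over A below by \<open>c * prob A\<close>. The rate of f is at most d, and the maximal
      inequality for -f bounds the same integral above by \<open>d' * prob A\<close> with d' < c.
      Hence A is null.\<close>
    define A where "A = {\<omega> \<in> space M. (\<forall>N. \<not> rate_le (birkhoff_sum \<tau> (fN N) \<omega>) c) \<and>
      rate_le (birkhoff_sum \<tau> f \<omega>) d}"
    have A [measurable]: "A \<in> sets M" unfolding A_def by measurable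
    have inv: "\<tau> \<omega> \<in> A \<longleftrightarrow> \<omega> \<in> A" if "\<omega> \<in> space M" for \<omega>
      using that measurable_space[OF map_measurable that]
      by (simp add: A_def rate_le_birkhoff_invariant)
    have gt: "\<exists>n. c * real n < birkhoff_sum \<tau> (\<lambda>\<omega>. max (f \<omega>) (- real N)) \<omega> n" if "\<omega> \<in> A" for \<omega> N
      using that not_rate_le_imp_ex[of "birkhoff_sum \<tau> (fN N) \<omega>" c] by (auto simp: A_def fN_def[abs_def])
    have mx: "integrable M (\<lambda>\<omega>. f \<omega> * indicator A \<omega>)"
      "c * prob A \<le> (\<integral>\<omega>. f \<omega> * indicator A \<omega> \<partial>M)"
      by (rule maximal_inequality_truncation[OF f fin A]; use inv gt in blast)+
    define g where "g \<omega> = - (f \<omega> * indicator A \<omega>)" for \<omega>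
    have g: "integrable M g" unfolding g_def using mx(1) by simp
    obtain d' where d': "d < d'" "d' < c" using dense dc by blast
    have "- d' * prob A \<le> (\<integral>\<omega>. g \<omega> * indicator A \<omega> \<partial>M)"
    proof (rule maximal_inequality[OF g A inv])
      fix \<omega> assume \<omega>: "\<omega> \<in> A"
      then have r: "rate_le (birkhoff_sum \<tau> f \<omega>) d" by (simp add: A_def)
      obtain d'' where d'': "d < d''" "d'' < d'" using dense d' by blast
      have "eventually (\<lambda>n. birkhoff_sum \<tau> f \<omega> n \<le> d'' * real n) sequentially"
        using r d'' unfolding rate_le_def by blast
      \<comment> \<open>A positive n is required for the strict inequality between the slopes d''
        and d'.\<close>
      then obtain n where n: "birkhoff_sum \<tau> f \<omega> n \<le> d'' * real n" "0 < n"
        unfolding eventually_sequentially by (metis gt_ex less_imp_le_nat max.cobounded1 max.cobounded2 max.strict_coboundedI2 zero_less_Suc)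
      have "birkhoff_sum \<tau> g \<omega> n = - birkhoff_sum \<tau> (\<lambda>\<omega>. f \<omega> * indicator A \<omega>) \<omega> n"
        by (simp add: birkhoff_sum_def g_def sum_negf)
      also have "\<dots> = - birkhoff_sum \<tau> f \<omega> n"
        using \<omega> sets.sets_into_space[OF A] by (subst birkhoff_sum_restrict_invariant[OF inv]) auto
      finally have "birkhoff_sum \<tau> g \<omega> n = - birkhoff_sum \<tau> f \<omega> n" .
      moreover have "d'' * real n < d' * real n" using d'' n by simp
      ultimately have "- (d' * real n) < birkhoff_sum \<tau> g \<omega> n" using n by linarith
      then show "\<exists>n. - d' * real n < birkhoff_sum \<tau> g \<omega> n" by auto
    qed
    also have "(\<integral>\<omega>. g \<omega> * indicator A \<omega> \<partial>M) = (\<integral>\<omega>. - (f \<omega> * indicator A \<omega>) \<partial>M)"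
      by (rule Bochner_Integration.integral_cong) (auto simp: g_def indicator_def)
    also have "\<dots> = - (\<integral>\<omega>. f \<omega> * indicator A \<omega> \<partial>M)" by simp
    also have "\<dots> \<le> - (c * prob A)" using mx(2) by simp
    finally have "(c - d') * prob A \<le> 0" by (simp add: algebra_simps)
    then have "prob A = 0" using d' measure_nonneg[of M A] by (simp add: mult_le_0_iff order_antisym)
    then have "AE \<omega> in M. \<omega> \<notin> A" by (simp add: prob_eq_0)
    with up AE_space show ?thesis
      by eventually_elim (use d in \<open>auto simp: A_def\<close>)
  qed
  have "AE \<omega> in M. \<forall>q::rat. \<Lambda> < ereal (of_rat q) \<longrightarrow>
    (\<exists>N. rate_le (birkhoff_sum \<tau> (fN N) \<omega>) (of_rat q))"
    unfolding AE_all_countable by (auto intro: each)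
  then show ?thesis
  proof eventually_elim
    case (elim \<omega>)
    show ?case
    proof (intro allI impI)
      fix c assume "\<Lambda> < ereal c"
      then obtain d where d: "\<Lambda> < ereal d" "ereal d < ereal c"
        using ereal_dense2 by blast
      then obtain q where q: "d < of_rat q" "of_rat q < c" using of_rat_dense[of d c] by auto
      have "\<Lambda> < ereal (of_rat q)" using d(1) q(1)
        by (meson ereal_less_eq(3) less_le_trans less_imp_le)
      with elim obtain N where "rate_le (birkhoff_sum \<tau> (fN N) \<omega>) (of_rat q)" by blast
      with q(2) have "rate_le (birkhoff_sum \<tau> (fN N) \<omega>) c" by (auto intro: rate_le_mono)
      then show "\<exists>N. rate_le (birkhoff_sum \<tau> (\<lambda>\<omega>. max (f \<omega>) (- real N)) \<omega>) c"
        unfolding fN_def by blast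
    qed
  qed
qed

text \<open>On the invariant set A where the bound fails for all K, the maximal inequality holds for
  every \<open>f K\<close>, and dominated convergence yields
  \<open>c * prob A \<le> l * prob A\<close>. The index K depends on \<omega>, since the averages of
  a single \<open>f K\<close> need not be constant.\<close>

lemma AE_ex_rate_le_of_tendsto:
  fixes f :: "nat \<Rightarrow> 'a \<Rightarrow> real"
  assumes f [measurable]: "\<And>K. f K \<in> borel_measurable M" and b: "integrable M b"
    and dom: "\<And>K. AE \<omega> in M. \<bar>f K \<omega>\<bar> \<le> b \<omega>"
    and lim: "AE \<omega> in M. (\<lambda>K. f K \<omega>) \<longlonglongrightarrow> l" and "l < c"
  shows "AE \<omega> in M. \<exists>K. rate_le (birkhoff_sum \<tau> (f K) \<omega>) c"
proof -
  define A where "A = {\<omega> \<in> space M. \<forall>K. \<not> rate_le (birkhoff_sum \<tau> (f K) \<omega>) c}"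
  have A [measurable]: "A \<in> sets M" unfolding A_def by measurable
  have inv: "\<tau> \<omega> \<in> A \<longleftrightarrow> \<omega> \<in> A" if "\<omega> \<in> space M" for \<omega>
    using that measurable_space[OF map_measurable that]
    by (simp add: A_def rate_le_birkhoff_invariant)
  have int: "integrable M (f K)" for K
    by (rule Bochner_Integration.integrable_bound[OF b f]) (use dom[of K] in \<open>auto elim!: eventually_mono\<close>)
  have ge: "c * prob A \<le> (\<integral>\<omega>. f K \<omega> * indicator A \<omega> \<partial>M)" for K
    by (rule maximal_inequality[OF int A inv]) (auto simp: A_def intro: not_rate_le_imp_ex)
  have "(\<lambda>K. \<integral>\<omega>. f K \<omega> * indicator A \<omega> \<partial>M) \<longlonglongrightarrow> (\<integral>\<omega>. l * indicator A \<omega> \<partial>M)"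
  proof (rule integral_dominated_convergence[where w = b])
    show "AE \<omega> in M. (\<lambda>K. f K \<omega> * indicator A \<omega>) \<longlonglongrightarrow> l * indicator A \<omega>"
      using lim by eventually_elim (auto intro: tendsto_mult)
    show "AE \<omega> in M. norm (f K \<omega> * indicator A \<omega>) \<le> b \<omega>" for K
      using dom[of K] by eventually_elim (auto simp: indicator_def)
  qed (use b in auto)
  then have "c * prob A \<le> (\<integral>\<omega>. l * indicator A \<omega> \<partial>M)"
    using ge by (auto intro: LIMSEQ_le_const)
  also have "\<dots> = l * prob A" by (simp add: Int_absorb1 sets.sets_into_space)
  finally have "(c - l) * prob A \<le> 0" by (simp add: algebra_simps)
  then have "prob A = 0" using \<open>l < c\<close> measure_nonneg[of M A] by (simp add: mult_le_0_iff order_antisym)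
  then have "AE \<omega> in M. \<omega> \<notin> A" by (simp add: prob_eq_0)
  with AE_space show ?thesis by eventually_elim (auto simp: A_def)
qed

text \<open>By invariance, the event that a exceeds d * n after n steps is as likely as a > d * n.
  These probabilities sum to at most the integral of a / d + 1, so Borel-Cantelli applies.\<close>

lemma AE_tempered:
  assumes a: "integrable M a" and nonneg: "\<And>\<omega>. 0 \<le> a \<omega>"
  shows "AE \<omega> in M. (\<lambda>n. a ((\<tau> ^^ n) \<omega>) / real n) \<longlonglongrightarrow> 0"
proof -
  have [measurable]: "a \<in> borel_measurable M" using a by simp
  have each: "AE \<omega> in M. eventually (\<lambda>n. a ((\<tau> ^^ n) \<omega>) \<le> d * real n) sequentially" if d: "0 < d" for d
  proof -
    define A where "A n = {\<omega> \<in> space M. d * real n < a \<omega>}" for n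
    have A [measurable]: "A n \<in> sets M" for n unfolding A_def by measurable
    define B where "B n = (\<tau> ^^ n) -` A n \<inter> space M" for n
    have B [measurable]: "B n \<in> sets M" for n
      unfolding B_def by (rule measurable_sets[OF iterate_measurable A])
    have eq: "prob (B n) = prob (A n)" for n
    proof -
      have "prob (A n) = measure (distr M M (\<tau> ^^ n)) (A n)" by (simp add: iterate_distr)
      also have "\<dots> = prob (B n)" unfolding B_def by (rule measure_distr) auto
      finally show ?thesis by simp
    qed
    \<comment> \<open>The bound by m drives the induction: if \<omega> lies in \<open>A m\<close>,
      then m < a / d, and at most m indices have been counted before.\<close>
    have count: "(\<Sum>n<m. indicator (A n) \<omega>) \<le> real m \<and> (\<Sum>n<m. indicator (A n) \<omega>) \<le> a \<omega> / d + 1"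
      for m \<omega>
    proof (induction m)
      case (Suc m)
      then show ?case
      proof (cases "\<omega> \<in> A m")
        case True
        then have "real m < a \<omega> / d" using d by (simp add: A_def pos_less_divide_eq mult.commute)
        with Suc True show ?thesis by simp
      qed simp
    qed (use nonneg d in simp)
    have "summable (\<lambda>n. prob (B n))"
    proof (rule summableI_nonneg_bounded)
      fix m
      have "(\<Sum>n<m. prob (B n)) = (\<integral>\<omega>. (\<Sum>n<m. indicator (A n) \<omega>) \<partial>M)"
        by (subst Bochner_Integration.integral_sum)
          (auto simp: eq Int_absorb1 sets.sets_into_space less_top[symmetric])
      also have "\<dots> \<le> (\<integral>\<omega>. a \<omega> / d + 1 \<partial>M)"
      proof (rule integral_mono)
        show "integrable M (\<lambda>\<omega>. \<Sum>n<m. indicator (A n) \<omega> :: real)"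
          by (intro Bochner_Integration.integrable_sum) (simp add: less_top[symmetric])
        show "integrable M (\<lambda>\<omega>. a \<omega> / d + 1)" using a by simp
      qed (use count in blast)
      finally show "(\<Sum>n<m. prob (B n)) \<le> (\<integral>\<omega>. a \<omega> / d + 1 \<partial>M)" .
    qed simp
    then have "AE \<omega> in M. eventually (\<lambda>n. \<omega> \<in> space M - B n) sequentially"
      by (intro borel_cantelli_AE1 B) (auto simp: less_top[symmetric])
    then show ?thesis
    proof eventually_elim
      case (elim \<omega>)
      then show ?case
      proof eventually_elim
        case (elim n)
        then have "(\<tau> ^^ n) \<omega> \<in> space M" by (auto intro: measurable_space[OF iterate_measurable])
        with elim show ?case by (auto simp: B_def A_def)
      qed
    qed
  qed
  have "AE \<omega> in M. \<forall>j. eventually (\<lambda>n. a ((\<tau> ^^ n) \<omega>) \<le> (1 / Suc j) * real n) sequentially"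
    unfolding AE_all_countable by (intro allI each) simp
  then show ?thesis
  proof eventually_elim
    case (elim \<omega>)
    show ?case
    proof (rule tendstoI)
      fix r :: real assume "0 < r"
      then obtain j where j: "1 / real (Suc j) < r" using nat_approx_posE by blast
      show "eventually (\<lambda>n. dist (a ((\<tau> ^^ n) \<omega>) / real n) 0 < r) sequentially"
        using elim[rule_format, of j] eventually_gt_at_top[of 0]
      proof eventually_elim
        case (elim n)
        then have "a ((\<tau> ^^ n) \<omega>) / real n \<le> 1 / Suc j" by (simp add: pos_divide_le_eq)
        with j nonneg[of "(\<tau> ^^ n) \<omega>"] show ?case by simp
      qed
    qed
  qed
qed

text \<open>Poincare recurrence: \<open>F m\<close> is the preimage of \<open>F 0\<close> under the
  m-th iterate, so it has the measure of \<open>F 0\<close>, in which it is contained.\<close>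

lemma AE_recurrent:
  assumes E [measurable]: "E \<in> sets M"
  shows "AE \<omega> in M. \<omega> \<in> E \<longrightarrow> (\<forall>m. \<exists>n\<ge>m. (\<tau> ^^ n) \<omega> \<in> E)"
proof -
  define F where "F m = {\<omega> \<in> space M. \<exists>n\<ge>m. (\<tau> ^^ n) \<omega> \<in> E}" for m
  have F [measurable]: "F m \<in> sets M" for m unfolding F_def by measurable
  have sub: "F m \<subseteq> F 0" for m by (auto simp: F_def)
  have vim: "F m = (\<tau> ^^ m) -` F 0 \<inter> space M" for m
  proof (intro equalityI subsetI)
    fix \<omega> assume "\<omega> \<in> F m"
    then obtain n where n: "m \<le> n" "(\<tau> ^^ n) \<omega> \<in> E" and s: "\<omega> \<in> space M" by (auto simp: F_def)
    have "(\<tau> ^^ (n - m)) ((\<tau> ^^ m) \<omega>) = (\<tau> ^^ n) \<omega>"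
      using n(1) by (metis comp_apply funpow_add le_add_diff_inverse2)
    then have "\<exists>k. (\<tau> ^^ k) ((\<tau> ^^ m) \<omega>) \<in> E" using n(2) by metis
    then show "\<omega> \<in> (\<tau> ^^ m) -` F 0 \<inter> space M"
      using s measurable_space[OF iterate_measurable s, of m] unfolding F_def by blast
  next
    fix \<omega> assume "\<omega> \<in> (\<tau> ^^ m) -` F 0 \<inter> space M"
    then obtain n where s: "\<omega> \<in> space M" and "(\<tau> ^^ n) ((\<tau> ^^ m) \<omega>) \<in> E" by (auto simp: F_def)
    then have "(\<tau> ^^ (n + m)) \<omega> \<in> E" by (simp add: funpow_add)
    with s show "\<omega> \<in> F m" by (auto simp: F_def intro!: exI[of _ "n + m"])
  qed
  have "prob (F m) = measure (distr M M (\<tau> ^^ m)) (F 0)" for m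
    by (subst vim, subst measure_distr) auto
  then have eq: "prob (F m) = prob (F 0)" for m by (simp add: iterate_distr)
  have "AE \<omega> in M. \<omega> \<notin> F 0 - F m" for m
  proof -
    have "prob (F 0 - F m) = 0" using finite_measure_Diff[OF F F sub, of m] eq[of m] by linarith
    then show ?thesis by (subst prob_eq_0[symmetric]) auto
  qed
  then have "AE \<omega> in M. \<forall>m. \<omega> \<notin> F 0 - F m" unfolding AE_all_countable by blast
  with AE_space show ?thesis
  proof eventually_elim
    case (elim \<omega>)
    show ?case
    proof (intro impI allI)
      fix m assume "\<omega> \<in> E"
      then have "\<omega> \<in> F 0" using elim by (auto simp: F_def intro!: exI[of _ 0])
      then have "\<omega> \<in> F m" using elim by blast
      then show "\<exists>n\<ge>m. (\<tau> ^^ n) \<omega> \<in> E" by (simp add: F_def)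
    qed
  qed
qed

end

section \<open>Flows\<close>

context metric_dynamical_system
begin

lemma time_0 [simp]: "0 \<in> T" and time_1 [simp]: "1 \<in> T"
  and time_add: "s \<in> T \<Longrightarrow> t \<in> T \<Longrightarrow> s + t \<in> T"
  and time_diff: "s \<in> T \<Longrightarrow> t \<in> T \<Longrightarrow> s - t \<in> T"
  and time_minus: "t \<in> T \<Longrightarrow> - t \<in> T"
  and time_of_int [simp]: "of_int k \<in> T"
  and time_of_nat [simp]: "of_nat n \<in> T"
  using time_set by auto

lemma uminus_time: "uminus ` T = T"
  using time_minus by (force simp: image_iff)

lemma nonneg_timeI: "t \<in> T \<Longrightarrow> 0 \<le> t \<Longrightarrow> t \<in> nonneg_time T"
  by (simp add: nonneg_time_def)

lemma flow_in_space: "t \<in> T \<Longrightarrow> \<omega> \<in> space M \<Longrightarrow> \<theta> t \<omega> \<in> space M"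
  using measurable_space[OF flow_measurable, of "(t, \<omega>)"]
  by (auto simp: space_pair_measure space_restrict_space)

lemma flow_map_measurable [measurable]: "t \<in> T \<Longrightarrow> \<theta> t \<in> M \<rightarrow>\<^sub>M M"
proof -
  assume t: "t \<in> T"
  have "(\<lambda>\<omega>. (t, \<omega>)) \<in> M \<rightarrow>\<^sub>M restrict_space borel T \<Otimes>\<^sub>M M"
    using t by (intro measurable_Pair) (auto simp: space_restrict_space)
  from measurable_compose[OF this flow_measurable] show ?thesis by simp
qed

lemma flow_inverse: "t \<in> T \<Longrightarrow> \<omega> \<in> space M \<Longrightarrow> \<theta> t (\<theta> (- t) \<omega>) = \<omega>"
  using flow_add[of t "- t" \<omega>] time_minus flow_zero by simp

lemma flow_add': "s \<in> T \<Longrightarrow> t \<in> T \<Longrightarrow> \<omega> \<in> space M \<Longrightarrow> \<theta> s (\<theta> t \<omega>) = \<theta> (s + t) \<omega>"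
  by (simp add: flow_add)

lemma measure_preserving_flow: "t \<in> T \<Longrightarrow> measure_preserving_map M (\<theta> t)"
  by unfold_locales (auto simp: flow_preserving)

lemma flow_iterate: "t \<in> T \<Longrightarrow> \<omega> \<in> space M \<Longrightarrow> (\<theta> t ^^ n) \<omega> = \<theta> (real n * t) \<omega> \<and> real n * t \<in> T"
proof (induction n)
  case (Suc n)
  then show ?case using flow_add[of t "real n * t" \<omega>] time_add[of t "real n * t"]
    by (simp add: algebra_simps)
qed (simp add: flow_zero)

lemma AE_flow: "t \<in> T \<Longrightarrow> AE \<omega> in M. P \<omega> \<Longrightarrow> AE \<omega> in M. P (\<theta> t \<omega>)"
  by (rule AE_distrD[OF flow_map_measurable, of t]) (simp_all only: flow_preserving)

text \<open>A measurable null set is removed together with all its integer translates, a countable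
  operation; a union over all real times might be neither measurable nor null.\<close>

lemma AE_imp_shift_invariant:
  assumes "AE \<omega> in M. P \<omega>"
  obtains G where "G \<in> sets M" "prob G = 1" "\<And>\<omega>. \<omega> \<in> G \<Longrightarrow> P \<omega>"
    "\<And>\<omega> (k::int). \<omega> \<in> G \<Longrightarrow> \<theta> (of_int k) \<omega> \<in> G"
proof -
  obtain N where N: "{\<omega> \<in> space M. \<not> P \<omega>} \<subseteq> N" "emeasure M N = 0" "N \<in> sets M"
    using assms by (elim AE_E)
  define G where "G = {\<omega> \<in> space M. \<forall>k::int. \<theta> (of_int k) \<omega> \<notin> N}"
  have [measurable]: "N \<in> sets M" by fact
  have G: "G \<in> sets M" unfolding G_def by measurable
  have "AE \<omega> in M. \<omega> \<notin> N" using N by (intro AE_not_in) (auto simp: null_sets_def)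
  then have "AE \<omega> in M. \<forall>k::int. \<theta> (of_int k) \<omega> \<notin> N"
    unfolding AE_all_countable by (intro allI AE_flow[where P = "\<lambda>\<omega>. \<omega> \<notin> N"] time_of_int)
  then have "AE \<omega> in M. \<omega> \<in> G" unfolding G_def by auto
  then have "prob G = 1" using G by (simp add: AE_in_set_eq_1)
  moreover have "P \<omega>" if "\<omega> \<in> G" for \<omega>
    using that N(1) spec[of "\<lambda>k::int. \<theta> (of_int k) \<omega> \<notin> N" 0] by (auto simp: G_def flow_zero)
  moreover have "\<theta> (of_int k) \<omega> \<in> G" if "\<omega> \<in> G" for \<omega> and k :: int
  proof -
    have s: "\<omega> \<in> space M" using that by (simp add: G_def)
    have "\<theta> (of_int j) (\<theta> (of_int k) \<omega>) = \<theta> (of_int (j + k)) \<omega>" for j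
      using flow_add[of "of_int j" "of_int k" \<omega>] s by simp
    moreover have "\<theta> (of_int (j + k)) \<omega> \<notin> N" for j using that unfolding G_def by blast
    ultimately show ?thesis using s flow_in_space[of "of_int k" \<omega>] by (simp add: G_def)
  qed
  ultimately show ?thesis using G that by blast
qed

section \<open>Saturation under the flow and the zero-one law\<close>

definition saturation :: "'w set \<Rightarrow> 'w set" where
  "saturation Q = (\<Union>t\<in>T. \<theta> t ` Q)"

lemma saturationI: "t \<in> T \<Longrightarrow> \<omega> \<in> Q \<Longrightarrow> \<theta> t \<omega> \<in> saturation Q"
  by (auto simp: saturation_def)

lemma subset_saturation: "Q \<subseteq> space M \<Longrightarrow> Q \<subseteq> saturation Q"
  using saturationI[of 0] by (force simp: flow_zero)

lemma saturation_invariant: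
  assumes Q: "Q \<subseteq> space M" shows "invariant_set M T \<theta> (saturation Q)"
proof -
  have sub: "\<theta> t ` saturation Q \<subseteq> saturation Q" if "t \<in> T" for t
    unfolding saturation_def using that Q by (fastforce simp: flow_add' intro: time_add)
  have "saturation Q \<subseteq> space M" unfolding saturation_def using Q by (auto intro: flow_in_space)
  moreover have "\<theta> t ` saturation Q = saturation Q" if t: "t \<in> T" for t
  proof
    show "saturation Q \<subseteq> \<theta> t ` saturation Q"
    proof
      fix \<omega> assume \<omega>: "\<omega> \<in> saturation Q"
      then have "\<theta> (- t) \<omega> \<in> saturation Q" using sub[OF time_minus[OF t]] by blast
      moreover have "\<omega> = \<theta> t (\<theta> (- t) \<omega>)" using \<omega> calculation \<open>saturation Q \<subseteq> space M\<close> t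
        by (auto simp: flow_inverse)
      ultimately show "\<omega> \<in> \<theta> t ` saturation Q" by blast
    qed
  qed (rule sub[OF t])
  ultimately show ?thesis by (simp add: invariant_set_def)
qed

text \<open>A point of the saturation outside Q lies outside G, hence in a null set. For real time
  completeness makes this difference measurable; for integer time it is empty.\<close>

lemma full_saturation_measurable:
  assumes complete: "T = UNIV \<longrightarrow> complete_measure M"
    and G: "G \<in> sets M" "prob G = 1" "\<And>\<omega> (k::int). \<omega> \<in> G \<Longrightarrow> \<theta> (of_int k) \<omega> \<in> G"
    and Q: "Q \<in> sets M" "Q \<subseteq> G" "\<And>\<omega> (k::int). \<omega> \<in> Q \<Longrightarrow> \<theta> (of_int k) \<omega> \<in> Q"
    and sat: "saturation Q \<inter> G \<subseteq> Q"
  shows "saturation Q \<in> sets M" "prob (saturation Q) = prob Q"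
proof -
  have sub: "Q \<subseteq> saturation Q" using subset_saturation sets.sets_into_space[OF Q(1)] by blast
  have spc: "saturation Q \<subseteq> space M"
    using saturation_invariant[OF sets.sets_into_space[OF Q(1)]] by (simp add: invariant_set_def)
  have "saturation Q - Q \<in> null_sets M"
  proof (cases "T = UNIV")
    case True
    have "saturation Q - Q \<subseteq> space M - G" using sat spc by blast
    moreover have "space M - G \<in> null_sets M"
      using G by (auto simp: null_sets_def emeasure_eq_measure prob_compl)
    ultimately show ?thesis using True complete
      by (meson complete_measure.complete null_sets_subset)
  next
    case False
    then have "T = \<int>" using time_set by blast
    have "saturation Q \<subseteq> Q"
    proof
      fix \<omega> assume "\<omega> \<in> saturation Q"
      then obtain t \<omega>' where t: "t \<in> T" "\<omega>' \<in> Q" "\<omega> = \<theta> t \<omega>'" by (auto simp: saturation_def)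
      then obtain k :: int where "t = of_int k" using \<open>T = \<int>\<close> by (auto elim: Ints_cases)
      with Q(3) t show "\<omega> \<in> Q" by simp
    qed
    then have "saturation Q = Q" using sub by blast
    then show ?thesis by simp
  qed
  moreover have "saturation Q = Q \<union> (saturation Q - Q)" using sub by blast
  ultimately show "saturation Q \<in> sets M" "prob (saturation Q) = prob Q"
    using Q(1) by (metis null_setsD2 sets.Un, metis measure_Un_null_set)
qed

lemma full_saturation:
  assumes complete: "T = UNIV \<longrightarrow> complete_measure M"
    and G: "G \<in> sets M" "prob G = 1" "\<And>\<omega> (k::int). \<omega> \<in> G \<Longrightarrow> \<theta> (of_int k) \<omega> \<in> G"
  shows "full_invariant_set M T \<theta> (saturation G)"
proof -
  note * = full_saturation_measurable[OF complete G G(1) subset_refl G(3)]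
  show ?thesis
    unfolding full_invariant_set_def
    using saturation_invariant[OF sets.sets_into_space[OF G(1)]] *(1) *(2) G(2) by auto
qed

lemma time_split:
  assumes "t \<in> T"
  obtains k :: int and s where "t = of_int k + s" "0 \<le> s" "s \<le> 1" "s \<in> T"
proof
  show "t = of_int \<lfloor>t\<rfloor> + (t - of_int \<lfloor>t\<rfloor>)" by simp
  show "0 \<le> t - of_int \<lfloor>t\<rfloor>" by simp
  show "t - of_int \<lfloor>t\<rfloor> \<le> 1" by linarith
  show "t - of_int \<lfloor>t\<rfloor> \<in> T" using assms time_diff time_of_int by blast
qed

text \<open>Ergodicity concerns sets invariant under all times, while P is controlled on G only and
  G only under integer times. Saturating the part of G where P holds adds no point of G and keeps
  the probability, so ergodicity decides P.\<close>

lemma AE_zero_one: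
  assumes complete: "T = UNIV \<longrightarrow> complete_measure M" and erg: "ergodic_flow M T \<theta>"
    and G: "G \<in> sets M" "prob G = 1" "\<And>\<omega> (k::int). \<omega> \<in> G \<Longrightarrow> \<theta> (of_int k) \<omega> \<in> G"
    and P: "Measurable.pred M P"
    and inv: "\<And>\<omega> s. \<omega> \<in> G \<Longrightarrow> s \<in> T \<Longrightarrow> 0 \<le> s \<Longrightarrow> s \<le> 1 \<Longrightarrow> \<theta> s \<omega> \<in> G \<Longrightarrow> P (\<theta> s \<omega>) \<longleftrightarrow> P \<omega>"
  shows "(AE \<omega> in M. P \<omega>) \<or> (AE \<omega> in M. \<not> P \<omega>)"
proof -
  define Q where "Q = {\<omega> \<in> space M. P \<omega>} \<inter> G"
  have [measurable]: "G \<in> sets M" "Measurable.pred M P" using G P by auto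
  have Q: "Q \<in> sets M" "Q \<subseteq> G" unfolding Q_def by auto
  have GS: "G \<subseteq> space M" using sets.sets_into_space[OF G(1)] .
  have int: "P (\<theta> (of_int k) \<omega>) \<longleftrightarrow> P \<omega>" if "\<omega> \<in> G" for \<omega> and k :: int
  proof -
    \<comment> \<open>Integer times are chains of unit steps inside G, each an instance of the
      hypothesis with s = 1; negative times are read backwards.\<close>
    have nat: "P (\<theta> (of_nat n) \<omega>) \<longleftrightarrow> P \<omega>" if "\<omega> \<in> G" for \<omega> and n :: nat
    proof (induction n)
      case 0 then show ?case using that GS by (auto simp: flow_zero)
    next
      case (Suc n)
      have g: "\<theta> (of_nat n) \<omega> \<in> G" using G(3)[OF that, of "int n"] by simp
      have "\<theta> 1 (\<theta> (of_nat n) \<omega>) = \<theta> (of_nat (Suc n)) \<omega>"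
        using flow_add'[of 1 "of_nat n" \<omega>] that GS by (auto simp: algebra_simps)
      with inv[OF g, of 1] G(3)[OF g, of 1] Suc show ?case by simp
    qed
    show ?thesis
    proof (cases "0 \<le> k")
      case True
      then show ?thesis using nat[OF that, of "nat k"] by simp
    next
      case False
      have g: "\<theta> (of_int k) \<omega> \<in> G" using G(3) that by blast
      have "\<theta> (of_nat (nat (- k))) (\<theta> (of_int k) \<omega>) = \<omega>"
        using False flow_inverse[of "- of_int k" \<omega>] that GS time_of_int[of "- k"] by auto
      with nat[OF g, of "nat (- k)"] show ?thesis by simp
    qed
  qed
  have Qk: "\<theta> (of_int k) \<omega> \<in> Q" if "\<omega> \<in> Q" for \<omega> and k :: int
    using that int[of \<omega> k] G(3)[of \<omega> k] GS by (auto simp: Q_def)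
  have sat: "saturation Q \<inter> G \<subseteq> Q"
  proof
    fix \<omega> assume "\<omega> \<in> saturation Q \<inter> G"
    then obtain t \<omega>' where t: "t \<in> T" "\<omega>' \<in> Q" "\<omega> = \<theta> t \<omega>'" and \<omega>: "\<omega> \<in> G"
      by (auto simp: saturation_def)
    obtain k :: int and s where s: "t = of_int k + s" "0 \<le> s" "s \<le> 1" "s \<in> T"
      using time_split[OF t(1)] .
    define \<eta> where "\<eta> = \<theta> (of_int k) \<omega>'"
    have \<eta>: "\<eta> \<in> Q" unfolding \<eta>_def using Qk t by blast
    have "\<omega> = \<theta> s \<eta>" unfolding t(3) s(1) \<eta>_def
      using s t(2) Q(2) GS by (subst flow_add') (auto simp: add.commute)
    with inv[of \<eta> s] \<eta> s \<omega> show "\<omega> \<in> Q" using GS by (auto simp: Q_def)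
  qed
  note satQ = full_saturation_measurable[OF complete G Q Qk sat, simplified]
  have "prob (saturation Q) = 0 \<or> prob (saturation Q) = 1"
    using erg saturation_invariant[OF order_trans[OF Q(2) GS]] satQ(1) by (auto simp: ergodic_flow_def)
  then have "prob Q = 0 \<or> prob Q = 1" using satQ(2) by simp
  then show ?thesis
  proof
    assume "prob Q = 0"
    then have "AE \<omega> in M. \<omega> \<notin> Q" using Q by (simp add: prob_eq_0)
    moreover have "AE \<omega> in M. \<omega> \<in> G" using G by (simp add: AE_in_set_eq_1)
    ultimately have "AE \<omega> in M. \<not> P \<omega>" using AE_space by eventually_elim (auto simp: Q_def)
    then show ?thesis ..
  next
    assume "prob Q = 1"
    then have "AE \<omega> in M. \<omega> \<in> Q" using Q by (simp add: AE_in_set_eq_1)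
    then have "AE \<omega> in M. P \<omega>" by eventually_elim (auto simp: Q_def)
    then show ?thesis ..
  qed
qed

end

section \<open>Comparison in a cone\<close>

text \<open>The two bounds have ratio 1 + d, so for d \<ge> 0 the number \<open>ln (1 + d)\<close>
  bounds Hilbert's projective distance of u and v. Asking for one scale a avoids suprema, and d
  itself contracts linearly under focusing.\<close>

definition near :: "'x::banach set \<Rightarrow> real \<Rightarrow> 'x \<Rightarrow> 'x \<Rightarrow> bool" where
  "near C d u v \<longleftrightarrow> (\<exists>a>0. u - a *\<^sub>R v \<in> C \<and> (a * (1 + d)) *\<^sub>R v - u \<in> C)"

locale normal_order_cone =
  fixes C :: "'x::{banach, second_countable_topology} set"
  assumes normally_ordered: "normally_ordered C"
begin

lemma cone_closed: "closed C"
  using normally_ordered by (simp add: normally_ordered_def order_cone_def)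

lemma cone_add: "x \<in> C \<Longrightarrow> y \<in> C \<Longrightarrow> x + y \<in> C"
  and cone_scale: "x \<in> C \<Longrightarrow> 0 \<le> c \<Longrightarrow> c *\<^sub>R x \<in> C"
  using normally_ordered convex_cone[of C] by (auto simp: normally_ordered_def order_cone_def)

lemma cone_0: "0 \<in> C"
  using normally_ordered by (auto simp: normally_ordered_def order_cone_def)

lemma cone_antisym: "x \<in> C \<Longrightarrow> - x \<in> C \<Longrightarrow> x = 0"
proof -
  assume "x \<in> C" "- x \<in> C"
  then have "x \<in> C \<inter> uminus ` C" by (auto intro!: image_eqI[of x uminus "- x"])
  then show "x = 0" using normally_ordered by (auto simp: normally_ordered_def order_cone_def)
qed

lemma norm_mono: "x \<in> C \<Longrightarrow> y - x \<in> C \<Longrightarrow> norm x \<le> norm y"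
  using normally_ordered unfolding normally_ordered_def cone_le_def by (metis diff_zero)

lemma near_mono: "near C d u v \<Longrightarrow> d \<le> d' \<Longrightarrow> v \<in> C \<Longrightarrow> near C d' u v"
proof -
  assume "near C d u v" "d \<le> d'" "v \<in> C"
  then obtain a where a: "0 < a" "u - a *\<^sub>R v \<in> C" "(a * (1 + d)) *\<^sub>R v - u \<in> C"
    by (auto simp: near_def)
  have "((a * (1 + d)) *\<^sub>R v - u) + (a * (d' - d)) *\<^sub>R v \<in> C"
    using a \<open>d \<le> d'\<close> \<open>v \<in> C\<close> by (intro cone_add cone_scale) auto
  then have "(a * (1 + d')) *\<^sub>R v - u \<in> C" by (simp add: algebra_simps)
  with a show ?thesis by (auto simp: near_def)
qed

lemma near_scale: "near C d u v \<Longrightarrow> 0 < c \<Longrightarrow> 0 < c' \<Longrightarrow> near C d (c *\<^sub>R u) (c' *\<^sub>R v)"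
proof -
  assume *: "near C d u v" "0 < c" "0 < c'"
  then obtain a where a: "0 < a" "u - a *\<^sub>R v \<in> C" "(a * (1 + d)) *\<^sub>R v - u \<in> C"
    by (auto simp: near_def)
  have "c *\<^sub>R (u - a *\<^sub>R v) \<in> C" "c *\<^sub>R ((a * (1 + d)) *\<^sub>R v - u) \<in> C"
    using a * by (auto intro: cone_scale)
  moreover have "(c * a / c' * (1 + d)) * c' = c * (a * (1 + d))" using * by simp
  ultimately have "c *\<^sub>R u - (c * a / c') *\<^sub>R c' *\<^sub>R v \<in> C \<and> (c * a / c' * (1 + d)) *\<^sub>R c' *\<^sub>R v - c *\<^sub>R u \<in> C"
    using * by (simp add: scaleR_diff_right mult.assoc)
  with a * show ?thesis unfolding near_def by (intro exI[of _ "c * a / c'"]) auto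
qed

lemma near_image:
  assumes "near C d u v" and F: "bounded_linear F" "\<And>x. x \<in> C \<Longrightarrow> F x \<in> C"
  shows "near C d (F u) (F v)"
proof -
  interpret F: bounded_linear F by fact
  obtain a where a: "0 < a" "u - a *\<^sub>R v \<in> C" "(a * (1 + d)) *\<^sub>R v - u \<in> C"
    using assms by (auto simp: near_def)
  from F(2)[OF a(2)] F(2)[OF a(3)] a(1) show ?thesis
    by (auto simp: near_def F.diff F.scale)
qed

text \<open>For unit vectors the monotone norm forces \<open>a \<le> 1 \<le> a * (1 + d)\<close>,
  which eliminates the unknown scale. The bounds obtained have fixed constants and survive
  limits.\<close>

lemma near_unit:
  assumes near: "near C d u v" and uv: "u \<in> C" "v \<in> C" "norm u = 1" "norm v = 1" and d: "0 \<le> d"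
  shows "u - (1 / (1 + d)) *\<^sub>R v \<in> C" "(1 + d) *\<^sub>R v - u \<in> C" "norm (u - v) \<le> 2 * d"
proof -
  obtain a where a: "0 < a" "u - a *\<^sub>R v \<in> C" "(a * (1 + d)) *\<^sub>R v - u \<in> C"
    using near by (auto simp: near_def)
  have "norm (a *\<^sub>R v) \<le> norm u" using a uv by (intro norm_mono cone_scale) auto
  then have a1: "a \<le> 1" using a uv by simp
  have "norm u \<le> norm ((a * (1 + d)) *\<^sub>R v)" using a uv by (intro norm_mono) auto
  then have a2: "1 \<le> a * (1 + d)" using a d uv by simp
  then have a3: "1 / (1 + d) \<le> a" using d by (simp add: pos_divide_le_eq)
  have "(u - a *\<^sub>R v) + (a - 1 / (1 + d)) *\<^sub>R v \<in> C"
    using a a3 uv by (intro cone_add cone_scale) auto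
  then show "u - (1 / (1 + d)) *\<^sub>R v \<in> C" by (simp add: algebra_simps)
  have "((a * (1 + d)) *\<^sub>R v - u) + ((1 - a) * (1 + d)) *\<^sub>R v \<in> C"
    using a a1 uv d by (intro cone_add cone_scale) auto
  then show "(1 + d) *\<^sub>R v - u \<in> C" by (simp add: algebra_simps)
  have "norm (u - a *\<^sub>R v) \<le> norm ((a * d) *\<^sub>R v)"
    using a by (intro norm_mono) (auto simp: algebra_simps)
  also have "\<dots> = a * d" using a d uv by simp
  also have "\<dots> \<le> d" using a1 d mult_right_mono[of a 1 d] by simp
  finally have 1: "norm (u - a *\<^sub>R v) \<le> d" .
  have "norm (a *\<^sub>R v - v) = norm ((a - 1) *\<^sub>R v)" by (simp add: algebra_simps)
  also have "\<dots> = 1 - a" using a1 uv by simp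
  also have "\<dots> \<le> a * d" using a2 by (simp add: algebra_simps)
  also have "\<dots> \<le> d" using a1 d mult_right_mono[of a 1 d] by simp
  finally have "norm (a *\<^sub>R v - v) \<le> d" .
  with 1 show "norm (u - v) \<le> 2 * d"
    using norm_triangle_ineq[of "u - a *\<^sub>R v" "a *\<^sub>R v - v"] by simp
qed

text \<open>The gaps x and y between u and its two bounds add up to a * d times v. Their images are
  comparable to the same e with ratio K, so each contains a definite share of
  \<open>F x + F y\<close>. Moving both bounds inwards by these shares, together the fraction 1 / K,
  leaves 1 - 1 / K of the gap.\<close>

lemma near_focus:
  assumes F: "bounded_linear F" "\<And>x. x \<in> C \<Longrightarrow> F x \<in> C" and K: "1 \<le> K"
    and focus: "\<And>x. x \<in> C - {0} \<Longrightarrow> \<exists>b>0. F x - b *\<^sub>R e \<in> C \<and> (K * b) *\<^sub>R e - F x \<in> C"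
    and near: "near C d u v" and v: "v \<in> C" and d: "0 \<le> d"
  shows "near C ((1 - 1 / K) * d) (F u) (F v)"
proof -
  interpret F: bounded_linear F by fact
  obtain a where a: "0 < a" "u - a *\<^sub>R v \<in> C" "(a * (1 + d)) *\<^sub>R v - u \<in> C"
    using near by (auto simp: near_def)
  define x where "x = u - a *\<^sub>R v"
  define y where "y = (a * (1 + d)) *\<^sub>R v - u"
  have Fv: "F v \<in> C" using v F by blast
  have d': "0 \<le> (1 - 1 / K) * d" using K d by simp
  \<comment> \<open>Focusing is available for nonzero vectors only; if a gap vanishes,
    \<open>F u\<close> is an exact multiple of \<open>F v\<close>.\<close>
  consider "x = 0" | "y = 0" | "x \<noteq> 0" "y \<noteq> 0" by blast
  then show ?thesis
  proof cases
    case 1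
    then have "F u = a *\<^sub>R F v" unfolding x_def by (metis F.scale eq_iff_diff_eq_0)
    then have "F u - a *\<^sub>R F v \<in> C" "(a * (1 + (1 - 1 / K) * d)) *\<^sub>R F v - F u = (a * ((1 - 1 / K) * d)) *\<^sub>R F v"
      using cone_0 by (auto simp: algebra_simps)
    moreover have "(a * ((1 - 1 / K) * d)) *\<^sub>R F v \<in> C" using a d' Fv by (intro cone_scale) auto
    ultimately show ?thesis using a by (auto simp: near_def)
  next
    case 2
    define a' where "a' = a * (1 + d)"
    have a': "0 < a'" using a d by (simp add: a'_def)
    from 2 have "F u = a' *\<^sub>R F v" unfolding y_def a'_def by (metis F.scale eq_iff_diff_eq_0)
    then have "F u - a' *\<^sub>R F v \<in> C" "(a' * (1 + (1 - 1 / K) * d)) *\<^sub>R F v - F u = (a' * ((1 - 1 / K) * d)) *\<^sub>R F v"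
      using cone_0 by (auto simp: algebra_simps)
    moreover have "(a' * ((1 - 1 / K) * d)) *\<^sub>R F v \<in> C" using a' d' Fv by (intro cone_scale) auto
    ultimately show ?thesis using a' by (auto simp: near_def)
  next
    case 3
    obtain b where b: "0 < b" "F x - b *\<^sub>R e \<in> C" "(K * b) *\<^sub>R e - F x \<in> C"
      using focus[of x] 3 a by (auto simp: x_def)
    obtain c where c: "0 < c" "F y - c *\<^sub>R e \<in> C" "(K * c) *\<^sub>R e - F y \<in> C"
      using focus[of y] 3 a by (auto simp: y_def)
    \<comment> \<open>The weights of the two gaps measured in e. As \<open>F x + F y\<close> is at
      most \<open>K * (b + c)\<close> times e, the vector \<open>b *\<^sub>R e\<close> below
      \<open>F x\<close> is at least p / K times that sum, and likewise for y.\<close>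
    define p where "p = b / (b + c)"
    define q where "q = c / (b + c)"
    have pq: "0 \<le> p" "p + q = 1" "p * (b + c) = b" "0 \<le> q" "q * (b + c) = c"
      using b c by (auto simp: p_def q_def add_divide_distrib[symmetric])
    have xy: "F x + F y = (a * d) *\<^sub>R F v"
      unfolding F.add[symmetric] F.scale[symmetric] x_def y_def by (simp add: algebra_simps)
    have up: "(K * (b + c)) *\<^sub>R e - (F x + F y) \<in> C"
      using cone_add[OF b(3) c(3)] by (simp add: algebra_simps)
    have xl: "F x - (p / K * (a * d)) *\<^sub>R F v \<in> C"
    proof -
      have "(F x - b *\<^sub>R e) + (p / K) *\<^sub>R ((K * (b + c)) *\<^sub>R e - (F x + F y)) \<in> C"
        using b up pq K by (intro cone_add cone_scale) auto
      also have "(p / K) *\<^sub>R ((K * (b + c)) *\<^sub>R e - (F x + F y)) = b *\<^sub>R e - (p / K) *\<^sub>R (F x + F y)"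
        using K pq by (simp add: scaleR_diff_right)
      finally show ?thesis by (simp add: xy)
    qed
    have yl: "F y - (q / K * (a * d)) *\<^sub>R F v \<in> C"
    proof -
      have "(F y - c *\<^sub>R e) + (q / K) *\<^sub>R ((K * (b + c)) *\<^sub>R e - (F x + F y)) \<in> C"
        using c up pq K by (intro cone_add cone_scale) auto
      also have "(q / K) *\<^sub>R ((K * (b + c)) *\<^sub>R e - (F x + F y)) = c *\<^sub>R e - (q / K) *\<^sub>R (F x + F y)"
        using K pq by (simp add: scaleR_diff_right)
      finally show ?thesis by (simp add: xy)
    qed
    define a' where "a' = a * (1 + d * p / K)"
    have a': "0 < a'" "a \<le> a'" using a d pq K by (auto simp: a'_def intro!: mult_pos_pos add_pos_nonneg)
    have Fu: "F u = F x + a *\<^sub>R F v" by (simp add: x_def F.diff F.scale)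
    have Fu': "F u = (a * (1 + d)) *\<^sub>R F v - F y" by (simp add: y_def F.diff F.scale)
    have "F u - a' *\<^sub>R F v \<in> C"
      using xl unfolding Fu a'_def by (simp add: algebra_simps)
    moreover have "(a' * (1 + (1 - 1 / K) * d)) *\<^sub>R F v - F u \<in> C"
    proof -
      \<comment> \<open>The new width is exactly (1 - 1 / K) * d times a; since a \<le> a', it may
        be measured against the new lower bound a'.\<close>
      have "a' + a * ((1 - 1 / K) * d) \<le> a' * (1 + (1 - 1 / K) * d)"
        using mult_right_mono[OF a'(2) d'] by (simp add: algebra_simps)
      moreover have "a' + a * ((1 - 1 / K) * d) = a * (1 + d) - q / K * (a * d)"
      proof -
        have p: "p = 1 - q" using pq(2) by simp
        show ?thesis unfolding a'_def p using K by (simp add: field_simps)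
      qed
      ultimately have "(F y - (q / K * (a * d)) *\<^sub>R F v) +
         (a' * (1 + (1 - 1 / K) * d) - (a * (1 + d) - q / K * (a * d))) *\<^sub>R F v \<in> C"
        using yl Fv by (intro cone_add cone_scale) auto
      then show ?thesis unfolding Fu' by (simp add: algebra_simps)
    qed
    ultimately show ?thesis using a' by (auto simp: near_def)
  qed
qed

text \<open>Comparing u with v through e loses the factor K twice.\<close>

lemma near_focused:
  assumes "0 < b" "u - b *\<^sub>R e \<in> C" "(K * b) *\<^sub>R e - u \<in> C"
    and "0 < c" "v - c *\<^sub>R e \<in> C" "(K * c) *\<^sub>R e - v \<in> C" and K: "1 \<le> K"
  shows "near C (K\<^sup>2 - 1) u v"
proof -
  have "(u - b *\<^sub>R e) + (b / (K * c)) *\<^sub>R ((K * c) *\<^sub>R e - v) \<in> C"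
    using assms by (intro cone_add cone_scale) auto
  then have "u - (b / (K * c)) *\<^sub>R v \<in> C" using assms by (simp add: scaleR_diff_right)
  moreover have "((K * b) *\<^sub>R e - u) + (K * b / c) *\<^sub>R (v - c *\<^sub>R e) \<in> C"
    using assms by (intro cone_add cone_scale) auto
  then have "(K * b / c) *\<^sub>R v - u \<in> C" using assms by (simp add: scaleR_diff_right)
  moreover have "b / (K * c) * (1 + (K\<^sup>2 - 1)) = K * b / c"
    using assms by (simp add: power2_eq_square)
  ultimately show ?thesis unfolding near_def using assms
    by (intro exI[of _ "b / (K * c)"]) auto
qed

end

section \<open>The principal direction\<close>

locale focusing_flow = skew_product_semiflow M T \<theta> U + normal_order_cone C
  for M :: "'w measure" and T :: "real set" and \<theta> :: "real \<Rightarrow> 'w \<Rightarrow> 'w"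
    and U :: "'w \<Rightarrow> real \<Rightarrow> 'x::{banach, second_countable_topology} \<Rightarrow> 'x" and C :: "'x set" +
  fixes e :: 'x and \<kappa> :: "'w \<Rightarrow> real"
  assumes integrable: "integrable_semiflow M T \<theta> U"
    and positive: "positive_semiflow M T U C"
    and focusing: "focusing_semiflow M U C e \<kappa>"
begin

lemma nonneg_time_simps [simp]: "0 \<in> nonneg_time T" "1 \<in> nonneg_time T" "real n \<in> nonneg_time T"
  by (auto intro: nonneg_timeI)

lemma time_simps [simp]: "1 + real n \<in> T" "- real n \<in> T" "- 1 \<in> T" "- 1 - real n \<in> T"
  using time_of_nat[of "Suc n"] time_minus[of "real n"] time_minus[of 1] time_diff[of "- 1" "real n"] by auto

lemma nonneg_time_diff: "s \<in> T \<Longrightarrow> t \<in> T \<Longrightarrow> s \<le> t \<Longrightarrow> t - s \<in> nonneg_time T"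
  by (auto intro: nonneg_timeI time_diff)

lemma nonneg_timeD: "t \<in> nonneg_time T \<Longrightarrow> t \<in> T \<and> 0 \<le> t"
  by (simp add: nonneg_time_def)

lemma U_measurable [measurable (raw)]:
  assumes t: "t \<in> nonneg_time T" and f: "f \<in> N \<rightarrow>\<^sub>M M" and g: "g \<in> N \<rightarrow>\<^sub>M borel"
  shows "(\<lambda>z. U (f z) t (g z)) \<in> N \<rightarrow>\<^sub>M borel"
proof -
  have "(\<lambda>z. (t, f z, g z)) \<in> N \<rightarrow>\<^sub>M restrict_space borel (nonneg_time T) \<Otimes>\<^sub>M M \<Otimes>\<^sub>M borel"
    using t f g by (intro measurable_Pair) (auto simp: space_restrict_space)
  from measurable_compose[OF this semiflow_measurable] show ?thesis by simp
qed

lemma e: "e \<in> C" "norm e = 1" "e \<in> C - {0}"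
  using focusing by (auto simp: focusing_semiflow_def)

lemma kappa_measurable [measurable]: "\<kappa> \<in> borel_measurable M"
  and kappa_ge: "\<omega> \<in> space M \<Longrightarrow> 1 \<le> \<kappa> \<omega>"
  using focusing by (auto simp: focusing_semiflow_def)

lemma U_focus:
  "\<omega> \<in> space M \<Longrightarrow> u \<in> C - {0} \<Longrightarrow>
     \<exists>b>0. U \<omega> 1 u - b *\<^sub>R e \<in> C \<and> (\<kappa> \<omega> * b) *\<^sub>R e - U \<omega> 1 u \<in> C"
  using focusing unfolding focusing_semiflow_def cone_le_def by blast

lemma U_cone: "\<omega> \<in> space M \<Longrightarrow> t \<in> nonneg_time T \<Longrightarrow> u \<in> C \<Longrightarrow> U \<omega> t u \<in> C"
proof -
  assume a: "\<omega> \<in> space M" "t \<in> nonneg_time T" "u \<in> C"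
  interpret bounded_linear "U \<omega> t" by (rule semiflow_linear[OF a(1,2)])
  have "cone_le C 0 u" using a by (simp add: cone_le_def)
  then have "cone_le C (U \<omega> t 0) (U \<omega> t u)"
    using positive a(1,2) unfolding positive_semiflow_def by blast
  then show ?thesis by (simp add: cone_le_def zero)
qed

lemma U_split:
  assumes "\<omega> \<in> space M" "s \<in> nonneg_time T" "t \<in> T" "s \<le> t"
  shows "U \<omega> t u = U (\<theta> s \<omega>) (t - s) (U \<omega> s u)"
  using semiflow_add[of \<omega> s "t - s" u] assms nonneg_time_diff[of s t] nonneg_timeD[of s] by simp

text \<open>A unit step lifts u above a positive multiple of e. Shorter times are factors of a unit
  step, and longer ones are reduced by splitting off unit steps.\<close>

lemma U_cone_nonzero:
  assumes "\<omega> \<in> space M" "t \<in> nonneg_time T" "u \<in> C - {0}"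
  shows "U \<omega> t u \<in> C - {0}"
proof -
  have one: "U \<omega> 1 u \<noteq> 0" if \<omega>: "\<omega> \<in> space M" and u: "u \<in> C - {0}" for \<omega> u
  proof
    assume "U \<omega> 1 u = 0"
    then obtain b where b: "0 < b" "- (b *\<^sub>R e) \<in> C" using U_focus[OF \<omega> u] by auto
    then have "b *\<^sub>R e = 0" using e by (intro cone_antisym cone_scale) auto
    then show False using b e by simp
  qed
  have "U \<omega> t u \<noteq> 0" if "t \<le> real n" "\<omega> \<in> space M" "t \<in> nonneg_time T" "u \<in> C - {0}" for n t \<omega> u
    using that
  proof (induction n arbitrary: t \<omega> u)
    case 0
    then have "t = 0" using nonneg_timeD[of t] by simp
    with 0 show ?case by (simp add: semiflow_zero)
  next
    case (Suc n)
    show ?case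
    proof (cases "t \<le> 1")
      case True
      have "U \<omega> 1 u = U (\<theta> t \<omega>) (1 - t) (U \<omega> t u)"
        using Suc True by (intro U_split) auto
      moreover have "U (\<theta> t \<omega>) (1 - t) 0 = 0"
      proof -
        interpret bounded_linear "U (\<theta> t \<omega>) (1 - t)"
          using Suc True nonneg_timeD[of t] by (intro semiflow_linear flow_in_space nonneg_time_diff) auto
        show ?thesis by (rule zero)
      qed
      ultimately show ?thesis using one[of \<omega> u] Suc by auto
    next
      case False
      have "U \<omega> t u = U (\<theta> 1 \<omega>) (t - 1) (U \<omega> 1 u)"
        using Suc False nonneg_timeD[of t] by (intro U_split) auto
      moreover have "U (\<theta> 1 \<omega>) (t - 1) (U \<omega> 1 u) \<noteq> 0"
        using Suc False nonneg_timeD[of t] one U_cone[of \<omega> 1 u]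
        by (intro Suc.IH) (auto intro: flow_in_space nonneg_time_diff)
      ultimately show ?thesis by simp
    qed
  qed
  from this[of t "nat \<lceil>t\<rceil>"] show ?thesis using assms U_cone by (auto simp: real_nat_ceiling_ge)
qed

lemma U_near:
  "\<omega> \<in> space M \<Longrightarrow> t \<in> nonneg_time T \<Longrightarrow> near C d u v \<Longrightarrow> near C d (U \<omega> t u) (U \<omega> t v)"
  by (rule near_image[OF _ semiflow_linear U_cone])

text \<open>The bound is independent of u and v: one step gives the image of the whole cone finite
  projective diameter.\<close>

lemma U_near_one:
  assumes \<omega>: "\<omega> \<in> space M" and uv: "u \<in> C - {0}" "v \<in> C - {0}"
  shows "near C ((\<kappa> \<omega>)\<^sup>2 - 1) (U \<omega> 1 u) (U \<omega> 1 v)"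
proof -
  obtain b where b: "0 < b" "U \<omega> 1 u - b *\<^sub>R e \<in> C" "(\<kappa> \<omega> * b) *\<^sub>R e - U \<omega> 1 u \<in> C"
    using U_focus[OF \<omega> uv(1)] by blast
  obtain c where c: "0 < c" "U \<omega> 1 v - c *\<^sub>R e \<in> C" "(\<kappa> \<omega> * c) *\<^sub>R e - U \<omega> 1 v \<in> C"
    using U_focus[OF \<omega> uv(2)] by blast
  show ?thesis by (rule near_focused[OF b c kappa_ge[OF \<omega>]])
qed

lemma U_contraction:
  assumes "\<omega> \<in> space M" "u \<in> C" "v \<in> C" "near C d u v" "0 \<le> d"
  shows "near C ((\<Prod>i<m. 1 - 1 / \<kappa> (\<theta> (real i) \<omega>)) * d) (U \<omega> (real m) u) (U \<omega> (real m) v)"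
proof (induction m)
  case 0
  then show ?case using assms by (simp add: semiflow_zero)
next
  case (Suc m)
  let ?\<omega> = "\<theta> (real m) \<omega>"
  have s: "?\<omega> \<in> space M" using assms by (intro flow_in_space) auto
  have split: "U \<omega> (real (Suc m)) x = U ?\<omega> 1 (U \<omega> (real m) x)" for x
    using U_split[of \<omega> "real m" "real (Suc m)" x] assms by simp
  have "0 \<le> (\<Prod>i<m. 1 - 1 / \<kappa> (\<theta> (real i) \<omega>)) * d"
    using assms kappa_ge[OF flow_in_space, of _ \<omega>]
    by (intro mult_nonneg_nonneg prod_nonneg) (auto simp: divide_le_eq_1 intro: order_trans[OF zero_le_one])
  then have "near C ((1 - 1 / \<kappa> ?\<omega>) * ((\<Prod>i<m. 1 - 1 / \<kappa> (\<theta> (real i) \<omega>)) * d))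
      (U ?\<omega> 1 (U \<omega> (real m) u)) (U ?\<omega> 1 (U \<omega> (real m) v))"
    using assms s Suc
    by (intro near_focus[where e = e] semiflow_linear U_cone kappa_ge U_focus) auto
  then show ?case unfolding split by (simp add: mult_ac)
qed

lemma U_back_split:
  assumes "\<omega> \<in> space M" "s \<in> nonneg_time T" "t \<in> nonneg_time T" "s \<le> t"
  shows "U (\<theta> (- t) \<omega>) t u = U (\<theta> (- s) \<omega>) s (U (\<theta> (- t) \<omega>) (t - s) u)"
proof -
  have t: "t - s \<in> nonneg_time T" "- t \<in> T" "t - s \<in> T"
    using nonneg_timeD[OF assms(2)] nonneg_timeD[OF assms(3)] assms(4)
    by (simp_all add: nonneg_time_diff time_diff time_minus)
  have "\<theta> (t - s) (\<theta> (- t) \<omega>) = \<theta> (- s) \<omega>"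
    using flow_add'[of "t - s" "- t" \<omega>] t assms by simp
  then show ?thesis
    using semiflow_add[of "\<theta> (- t) \<omega>" "t - s" s u] t assms by (simp add: flow_in_space)
qed

lemma back_cone_nonzero:
  assumes "\<omega> \<in> space M" "t \<in> nonneg_time T" "u \<in> C - {0}"
  shows "U (\<theta> (- t) \<omega>) t u \<in> C - {0}"
  using assms nonneg_timeD[OF assms(2)] by (intro U_cone_nonzero flow_in_space time_minus) auto

section \<open>Contraction of the cone along the past\<close>

text \<open>The image of the cone from time -n to time 0 gets arbitrarily small projective diameter.
  One n per d suffices, as these images decrease with n.\<close>

definition absorbing :: "'w \<Rightarrow> bool" where
  "absorbing \<omega> \<longleftrightarrow> (\<forall>d>0. \<exists>n::nat. \<forall>u\<in>C - {0}. \<forall>v\<in>C - {0}.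
     near C d (U (\<theta> (- real n) \<omega>) (real n) u) (U (\<theta> (- real n) \<omega>) (real n) v))"

lemma AE_absorbing: "AE \<omega> in M. absorbing \<omega>"
proof -
  interpret backward: measure_preserving_map M "\<theta> (- 1)"
    by (rule measure_preserving_flow) (simp add: time_minus)
  define E where "E K = {\<omega> \<in> space M. \<kappa> \<omega> \<le> real K}" for K :: nat
  have E: "E K \<in> sets M" for K unfolding E_def by measurable
  have "AE \<omega> in M. \<forall>K. \<omega> \<in> E K \<longrightarrow> (\<forall>m. \<exists>n\<ge>m. (\<theta> (- 1) ^^ n) \<omega> \<in> E K)"
    unfolding AE_all_countable by (rule allI) (rule backward.AE_recurrent[OF E])
  with AE_space show ?thesis
  proof eventually_elim
    case (elim \<omega>)
    then have \<omega>: "\<omega> \<in> space M" by simp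
    \<comment> \<open>K is taken from \<omega> itself, so that \<omega> lies in \<open>E K\<close>
      and recurrence applies to it.\<close>
    obtain K :: nat where K: "\<kappa> \<omega> \<le> real K" using real_arch_simple by blast
    have K1: "1 \<le> real K" using kappa_ge[OF \<omega>] K by linarith
    have "\<omega> \<in> E K" using \<omega> K by (simp add: E_def)
    then have "\<exists>n\<ge>m. (\<theta> (- 1) ^^ n) \<omega> \<in> E K" for m using elim by blast
    then have rec: "\<exists>n\<ge>m. \<kappa> (\<theta> (- real n) \<omega>) \<le> real K" for m
      using flow_iterate[of "- 1" \<omega>] \<omega> by (simp add: E_def) blast
    \<comment> \<open>The contraction accumulated over the m unit steps before time 0; each visit to
      \<open>E K\<close> contributes a factor at most q.\<close>
    define p where "p m = (\<Prod>j<m. 1 - 1 / \<kappa> (\<theta> (- real (Suc j)) \<omega>))" for m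
    define q where "q = 1 - 1 / real K"
    have q: "0 \<le> q" "q < 1" using K1 by (auto simp: q_def)
    have \<kappa>1: "1 \<le> \<kappa> (\<theta> (- real j) \<omega>)" for j
      using \<omega> by (intro kappa_ge flow_in_space time_minus) auto
    have f01: "0 \<le> 1 - 1 / \<kappa> (\<theta> (- real j) \<omega>)" "1 - 1 / \<kappa> (\<theta> (- real j) \<omega>) \<le> 1" for j
      using \<kappa>1[of j] by auto
    have p0: "0 \<le> p m" for m unfolding p_def using f01 by (intro prod_nonneg) blast
    have pS: "p (Suc m) = p m * (1 - 1 / \<kappa> (\<theta> (- real (Suc m)) \<omega>))" for m
      by (simp add: p_def)
    have pdec: "p (Suc m) \<le> p m" for m
      unfolding pS using mult_left_mono[OF f01(2)[of "Suc m"] p0[of m]] by simp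
    have anti: "p n \<le> p m" if "m \<le> n" for m n
      by (rule lift_Suc_antimono_le[of p, OF pdec that])
    have small: "\<exists>m. p m \<le> q ^ l" for l
    proof (induction l)
      case 0
      show ?case by (rule exI[of _ 0]) (simp add: p_def)
    next
      case (Suc l)
      then obtain m where m: "p m \<le> q ^ l" by blast
      obtain n where n: "Suc m \<le> n" "\<kappa> (\<theta> (- real n) \<omega>) \<le> real K" using rec by blast
      then obtain n' where n': "n = Suc n'" "m \<le> n'" by (cases n) auto
      have "1 - 1 / \<kappa> (\<theta> (- real n) \<omega>) \<le> q"
        using n(2) \<kappa>1[of n] by (simp add: q_def frac_le)
      then have "p n \<le> p n' * q" unfolding n'(1) pS by (intro mult_left_mono p0)
      also have "\<dots> \<le> q ^ l * q" using anti[OF n'(2)] m q by (intro mult_right_mono) auto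
      finally show ?case by (intro exI[of _ n]) (simp add: mult.commute)
    qed
    show ?case
      unfolding absorbing_def
    proof (intro allI impI)
      fix d :: real assume d: "0 < d"
      have "0 < d / (real K)\<^sup>2" using d K1 by simp
      then obtain l where l: "q ^ l < d / (real K)\<^sup>2" using real_arch_pow_inv q by blast
      obtain m where m: "p m \<le> q ^ l" using small by blast
      \<comment> \<open>The starting time must be a return as well: the first step only creates a
        distance, which is then at most \<open>(real K)\<^sup>2\<close>, and the remaining n' steps
        contract it.\<close>
      obtain n where n: "Suc m \<le> n" "\<kappa> (\<theta> (- real n) \<omega>) \<le> real K" using rec by blast
      then obtain n' where n': "n = Suc n'" "m \<le> n'" by (cases n) auto
      define \<eta> where "\<eta> = \<theta> (- real n) \<omega>"
      have \<eta>: "\<eta> \<in> space M" unfolding \<eta>_def using \<omega> by (intro flow_in_space time_minus) auto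
      have sq: "(\<kappa> \<eta>)\<^sup>2 - 1 \<le> (real K)\<^sup>2" "0 \<le> (\<kappa> \<eta>)\<^sup>2 - 1"
      proof -
        have "1 \<le> \<kappa> \<eta>" "\<kappa> \<eta> \<le> real K" using n(2) \<kappa>1[of n] by (auto simp: \<eta>_def)
        then have "(\<kappa> \<eta>)\<^sup>2 \<le> (real K)\<^sup>2" "1 \<le> (\<kappa> \<eta>)\<^sup>2"
          by (auto intro: power_mono one_le_power)
        then show "(\<kappa> \<eta>)\<^sup>2 - 1 \<le> (real K)\<^sup>2" "0 \<le> (\<kappa> \<eta>)\<^sup>2 - 1" by linarith+
      qed
      have "p n' * ((\<kappa> \<eta>)\<^sup>2 - 1) \<le> p n' * (real K)\<^sup>2" using sq p0 by (intro mult_left_mono) auto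
      also have "\<dots> \<le> q ^ l * (real K)\<^sup>2" using anti[OF n'(2)] m by (intro mult_right_mono) auto
      also have "\<dots> \<le> d" using l K1 by (simp add: pos_less_divide_eq)
      finally have le: "p n' * ((\<kappa> \<eta>)\<^sup>2 - 1) \<le> d" .
      have "near C d (U \<eta> (real n) u) (U \<eta> (real n) v)" if uv: "u \<in> C - {0}" "v \<in> C - {0}" for u v
      proof -
        have split: "U \<eta> (real n) x = U (\<theta> 1 \<eta>) (real n') (U \<eta> 1 x)" for x
          using U_split[of \<eta> 1 "real n" x] \<eta> n' by simp
        have "near C ((\<Prod>i<n'. 1 - 1 / \<kappa> (\<theta> (real i) (\<theta> 1 \<eta>))) * ((\<kappa> \<eta>)\<^sup>2 - 1))
           (U (\<theta> 1 \<eta>) (real n') (U \<eta> 1 u)) (U (\<theta> 1 \<eta>) (real n') (U \<eta> 1 v))"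
          using uv \<eta> sq by (intro U_contraction flow_in_space U_near_one U_cone) auto
        \<comment> \<open>The factors met on the way forward from \<open>\<theta> 1 \<eta>\<close>
          are those of \<open>p n'\<close> in reverse order.\<close>
        moreover have "(\<Prod>i<n'. 1 - 1 / \<kappa> (\<theta> (real i) (\<theta> 1 \<eta>))) = p n'"
        proof -
          have "(\<Prod>i<n'. 1 - 1 / \<kappa> (\<theta> (real i) (\<theta> 1 \<eta>))) =
                (\<Prod>i<n'. 1 - 1 / \<kappa> (\<theta> (- real (Suc (n' - Suc i))) \<omega>))"
          proof (rule prod.cong[OF refl])
            fix i assume i: "i \<in> {..<n'}"
            have "\<theta> (real i) (\<theta> 1 \<eta>) = \<theta> (real i + (1 - real n)) \<omega>"
              unfolding \<eta>_def using \<omega> flow_add'[of 1 "- real n" \<omega>] flow_add'[of "real i" "1 - real n" \<omega>]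
              by (simp add: time_minus time_diff)
            also have "real i + (1 - real n) = - real (Suc (n' - Suc i))" using i n' by auto
            finally show "1 - 1 / \<kappa> (\<theta> (real i) (\<theta> 1 \<eta>)) = 1 - 1 / \<kappa> (\<theta> (- real (Suc (n' - Suc i))) \<omega>)"
              by simp
          qed
          also have "\<dots> = p n'" unfolding p_def by (rule prod.nat_diff_reindex)
          finally show ?thesis .
        qed
        ultimately have "near C (p n' * ((\<kappa> \<eta>)\<^sup>2 - 1)) (U \<eta> (real n) u) (U \<eta> (real n) v)"
          by (simp add: split)
        then show ?thesis by (rule near_mono[OF _ le]) (use uv \<eta> in \<open>auto intro: U_cone\<close>)
      qed
      then show "\<exists>n::nat. \<forall>u\<in>C - {0}. \<forall>v\<in>C - {0}.
          near C d (U (\<theta> (- real n) \<omega>) (real n) u) (U (\<theta> (- real n) \<omega>) (real n) v)"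
        unfolding \<eta>_def by blast
    qed
  qed
qed

section \<open>The ray common to all images of the cone\<close>

text \<open>An intrinsic description of the spanning vector: it determines x, and U transports it
  also by fractional times, where no almost sure information is at hand.\<close>

definition principal :: "'w \<Rightarrow> 'x \<Rightarrow> bool" where
  "principal \<omega> x \<longleftrightarrow> x \<in> C \<and> norm x = 1 \<and>
     (\<forall>d>0. \<exists>n::nat. \<forall>u\<in>C - {0}. near C d x (U (\<theta> (- real n) \<omega>) (real n) u))"

lemma principalD:
  "principal \<omega> x \<Longrightarrow> 0 < d \<Longrightarrow> \<exists>n::nat. \<forall>u\<in>C - {0}. near C d x (U (\<theta> (- real n) \<omega>) (real n) u)"
  by (simp add: principal_def)

definition pullback :: "'w \<Rightarrow> nat \<Rightarrow> 'x" where
  "pullback \<omega> n = sgn (U (\<theta> (- real n) \<omega>) (real n) e)"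

definition direction :: "'w \<Rightarrow> 'x" where
  "direction \<omega> = lim (pullback \<omega>)"

lemma sgn_cone: "u \<in> C - {0} \<Longrightarrow> sgn u \<in> C \<and> norm (sgn u) = 1"
  by (auto simp: sgn_div_norm intro: cone_scale)

lemma near_sgn: "near C d x u \<Longrightarrow> u \<in> C - {0} \<Longrightarrow> near C d x (sgn u)"
  using near_scale[of d x u 1 "inverse (norm u)"] by (simp add: sgn_div_norm)

lemma near_sgn_left: "near C d u x \<Longrightarrow> u \<in> C - {0} \<Longrightarrow> near C d (sgn u) x"
  using near_scale[of d u x "inverse (norm u)" 1] by (simp add: sgn_div_norm)

text \<open>For every n the vector y is itself one of the images to which x is compared, so
  \<open>sgn y\<close> and x agree to any accuracy.\<close>

lemma principal_orbit_unique:
  assumes p: "principal \<omega> x" and y: "y \<in> C - {0}"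
    and orbit: "\<And>n::nat. \<exists>u\<in>C - {0}. y = U (\<theta> (- real n) \<omega>) (real n) u"
  shows "y = norm y *\<^sub>R x"
proof -
  have "norm (x - sgn y) \<le> d" if d: "0 < d" for d
  proof -
    obtain n :: nat where n: "\<forall>u\<in>C - {0}. near C (d / 2) x (U (\<theta> (- real n) \<omega>) (real n) u)"
      using principalD[OF p, of "d / 2"] d by auto
    obtain u where u: "u \<in> C - {0}" "y = U (\<theta> (- real n) \<omega>) (real n) u" using orbit by blast
    have "near C (d / 2) x (sgn y)" using n u y by (intro near_sgn) auto
    from near_unit(3)[OF this] p sgn_cone[OF y] that show ?thesis by (simp add: principal_def)
  qed
  then have "norm (x - sgn y) = 0" by (meson dense_ge norm_ge_zero order_antisym)
  then have "x = sgn y" by simp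
  then show ?thesis using y by (simp add: sgn_div_norm)
qed

text \<open>Beyond n every pullback is the image of a cone vector from time -n and inherits the
  closeness to x valid there.\<close>

lemma principal_pullback:
  assumes p: "principal \<omega> x" and \<omega>: "\<omega> \<in> space M"
  shows "pullback \<omega> \<longlonglongrightarrow> x"
proof (rule LIMSEQ_I)
  fix r :: real assume r: "0 < r"
  then obtain n :: nat where n: "\<forall>u\<in>C - {0}. near C (r / 3) x (U (\<theta> (- real n) \<omega>) (real n) u)"
    using principalD[OF p, of "r / 3"] r by auto
  have "norm (pullback \<omega> m - x) < r" if "n \<le> m" for m
  proof -
    have split: "U (\<theta> (- real m) \<omega>) (real m) e =
        U (\<theta> (- real n) \<omega>) (real n) (U (\<theta> (- real m) \<omega>) (real m - real n) e)"
      using \<omega> that by (intro U_back_split) auto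
    have "U (\<theta> (- real m) \<omega>) (real m - real n) e \<in> C - {0}"
      using \<omega> that e by (intro U_cone_nonzero flow_in_space time_minus nonneg_timeI time_diff) auto
    then have "near C (r / 3) x (U (\<theta> (- real m) \<omega>) (real m) e)" unfolding split using n by blast
    then have "near C (r / 3) x (pullback \<omega> m)"
      unfolding pullback_def using \<omega> e by (intro near_sgn back_cone_nonzero) auto
    from near_unit(3)[OF this] sgn_cone[OF back_cone_nonzero[OF \<omega> _ e(3), of "real m"]] p r
    have "norm (x - pullback \<omega> m) < r" by (simp add: principal_def pullback_def)
    then show ?thesis by (simp add: norm_minus_commute)
  qed
  then show "\<exists>no. \<forall>m\<ge>no. norm (pullback \<omega> m - x) < r" by blast
qed

lemma principal_direction: "principal \<omega> x \<Longrightarrow> \<omega> \<in> space M \<Longrightarrow> direction \<omega> = x"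
  unfolding direction_def by (rule limI[OF principal_pullback])

lemma absorbing_imp_principal:
  assumes a: "absorbing \<omega>" and \<omega>: "\<omega> \<in> space M"
  shows "principal \<omega> (direction \<omega>)"
proof -
  have pb: "pullback \<omega> m \<in> C" "norm (pullback \<omega> m) = 1" for m
    unfolding pullback_def using sgn_cone[OF back_cone_nonzero[OF \<omega> _ e(3), of "real m"]] by auto
  have key: "\<exists>n::nat. \<forall>m\<ge>n. \<forall>u\<in>C - {0}. near C d (pullback \<omega> m) (sgn (U (\<theta> (- real n) \<omega>) (real n) u))"
    if d: "0 < d" for d
  proof -
    obtain n :: nat where n: "\<And>u v. u \<in> C - {0} \<Longrightarrow> v \<in> C - {0} \<Longrightarrow>
       near C d (U (\<theta> (- real n) \<omega>) (real n) u) (U (\<theta> (- real n) \<omega>) (real n) v)"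
      using a[unfolded absorbing_def, rule_format, OF d] by auto
    have "near C d (pullback \<omega> m) (sgn (U (\<theta> (- real n) \<omega>) (real n) u))" if "n \<le> m" "u \<in> C - {0}" for m u
    proof -
      have split: "U (\<theta> (- real m) \<omega>) (real m) e =
          U (\<theta> (- real n) \<omega>) (real n) (U (\<theta> (- real m) \<omega>) (real m - real n) e)"
        using \<omega> that by (intro U_back_split) auto
      have "U (\<theta> (- real m) \<omega>) (real m - real n) e \<in> C - {0}"
        using \<omega> that e by (intro U_cone_nonzero flow_in_space time_minus nonneg_timeI time_diff) auto
      then have "near C d (U (\<theta> (- real m) \<omega>) (real m) e) (U (\<theta> (- real n) \<omega>) (real n) u)"
        unfolding split using n that by blast
      then show ?thesis unfolding pullback_def using \<omega> e that
        by (intro near_sgn near_sgn_left back_cone_nonzero) auto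
    qed
    then show ?thesis by blast
  qed
  have "Cauchy (pullback \<omega>)"
  proof (rule CauchyI)
    fix r :: real assume r: "0 < r"
    \<comment> \<open>All later pullbacks are within 2 * r / 5 of z, hence within 4 * r / 5 of each
      other.\<close>
    obtain n :: nat where n: "\<And>m u. n \<le> m \<Longrightarrow> u \<in> C - {0} \<Longrightarrow>
        near C (r / 5) (pullback \<omega> m) (sgn (U (\<theta> (- real n) \<omega>) (real n) u))"
      using key[of "r / 5"] r by auto
    define z where "z = sgn (U (\<theta> (- real n) \<omega>) (real n) e)"
    have z: "z \<in> C" "norm z = 1"
      unfolding z_def using sgn_cone[OF back_cone_nonzero[OF \<omega> _ e(3), of "real n"]] by auto
    have le: "norm (pullback \<omega> m - z) \<le> 2 * (r / 5)" if "n \<le> m" for m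
      using near_unit(3)[OF n[OF that e(3)] pb(1) _ pb(2)] z r by (simp add: z_def)
    have "norm (pullback \<omega> m - pullback \<omega> m') < r" if "n \<le> m" "n \<le> m'" for m m'
      using le[OF that(1)] le[OF that(2)] norm_triangle_ineq4[of "pullback \<omega> m - z" "pullback \<omega> m' - z"] r
      by simp
    then show "\<exists>no. \<forall>m\<ge>no. \<forall>m'\<ge>no. norm (pullback \<omega> m - pullback \<omega> m') < r" by blast
  qed
  then have lim: "pullback \<omega> \<longlonglongrightarrow> direction \<omega>"
    unfolding direction_def by (simp add: Cauchy_convergent_iff convergent_LIMSEQ_iff)
  have "direction \<omega> \<in> C"
    using closed_sequentially[OF cone_closed pb(1) lim] .
  moreover have "norm (direction \<omega>) = 1"
    using LIMSEQ_unique[OF tendsto_norm[OF lim]] pb(2) by simp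
  moreover have "\<exists>n::nat. \<forall>u\<in>C - {0}. near C d (direction \<omega>) (U (\<theta> (- real n) \<omega>) (real n) u)"
    if d: "0 < d" for d
  proof -
    \<comment> \<open>The limit is taken in the closed conditions with constants
      \<open>1 / (1 + d')\<close> and \<open>1 + d'\<close>, whose ratio is the square of 1 + d';
      this d' keeps the square below 1 + d.\<close>
    define d' where "d' = min (d / 3) 1"
    have d': "0 < d'" "(1 + d') * (1 + d') \<le> 1 + d"
    proof -
      show "0 < d'" using d by (simp add: d'_def)
      have "d' * d' \<le> d' * 1" using \<open>0 < d'\<close> by (intro mult_left_mono) (auto simp: d'_def)
      moreover have "3 * d' \<le> d" by (simp add: d'_def)
      ultimately show "(1 + d') * (1 + d') \<le> 1 + d" by (simp add: algebra_simps)
    qed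
    obtain n :: nat where n: "\<And>m u. n \<le> m \<Longrightarrow> u \<in> C - {0} \<Longrightarrow>
        near C d' (pullback \<omega> m) (sgn (U (\<theta> (- real n) \<omega>) (real n) u))"
      using key[of d'] d' by auto
    have "near C d (direction \<omega>) (U (\<theta> (- real n) \<omega>) (real n) u)" if u: "u \<in> C - {0}" for u
    proof -
      define y where "y = U (\<theta> (- real n) \<omega>) (real n) u"
      define z where "z = sgn y"
      have y: "y \<in> C - {0}" unfolding y_def using \<omega> u by (intro back_cone_nonzero) auto
      have z: "z \<in> C" "norm z = 1" unfolding z_def using sgn_cone[OF y] by auto
      have nz: "near C d' (pullback \<omega> m) z" if "n \<le> m" for m
        using n[OF that u] by (simp add: z_def y_def)
      have "direction \<omega> - (1 / (1 + d')) *\<^sub>R z \<in> C"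
      proof (rule Lim_in_closed_set[OF cone_closed])
        show "((\<lambda>m. pullback \<omega> m - (1 / (1 + d')) *\<^sub>R z) \<longlongrightarrow> direction \<omega> - (1 / (1 + d')) *\<^sub>R z) sequentially"
          by (intro tendsto_intros lim)
        show "eventually (\<lambda>m. pullback \<omega> m - (1 / (1 + d')) *\<^sub>R z \<in> C) sequentially"
          using eventually_ge_at_top[of n]
          by eventually_elim (use near_unit(1)[OF nz pb(1) z(1) pb(2) z(2)] d' in auto)
      qed simp
      moreover have "(1 + d') *\<^sub>R z - direction \<omega> \<in> C"
      proof (rule Lim_in_closed_set[OF cone_closed])
        show "((\<lambda>m. (1 + d') *\<^sub>R z - pullback \<omega> m) \<longlongrightarrow> (1 + d') *\<^sub>R z - direction \<omega>) sequentially"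
          by (intro tendsto_intros lim)
        show "eventually (\<lambda>m. (1 + d') *\<^sub>R z - pullback \<omega> m \<in> C) sequentially"
          using eventually_ge_at_top[of n]
          by eventually_elim (use near_unit(2)[OF nz pb(1) z(1) pb(2) z(2)] d' in auto)
      qed simp
      ultimately have "near C ((1 + d') * (1 + d') - 1) (direction \<omega>) z"
        unfolding near_def using d' by (intro exI[of _ "1 / (1 + d')"]) auto
      then have "near C d (direction \<omega>) z" using d' z by (elim near_mono) auto
      then have "near C d (1 *\<^sub>R direction \<omega>) (norm y *\<^sub>R z)" using y by (intro near_scale) auto
      then show ?thesis using y by (simp add: z_def sgn_div_norm y_def)
    qed
    then show ?thesis by blast
  qed
  ultimately show ?thesis by (simp add: principal_def)
qed

lemma principal_flow:
  assumes p: "principal \<omega> x" and \<omega>: "\<omega> \<in> space M" and t: "t \<in> nonneg_time T"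
  shows "principal (\<theta> t \<omega>) (sgn (U \<omega> t x))"
proof -
  have x: "x \<in> C - {0}" using p by (auto simp: principal_def)
  have y: "U \<omega> t x \<in> C - {0}" by (rule U_cone_nonzero[OF \<omega> t x])
  have tT: "t \<in> T" "0 \<le> t" using t nonneg_timeD by auto
  have "\<exists>m::nat. \<forall>u\<in>C - {0}. near C d (sgn (U \<omega> t x)) (U (\<theta> (- real m) (\<theta> t \<omega>)) (real m) u)"
    if d: "0 < d" for d
  proof -
    obtain n :: nat where n: "\<And>u. u \<in> C - {0} \<Longrightarrow> near C d x (U (\<theta> (- real n) \<omega>) (real n) u)"
      using principalD[OF p d] by auto
    \<comment> \<open>Start times are integers counted back from \<open>\<theta> t \<omega>\<close>;
      rounding up makes the path from time -m pass through
      \<open>\<theta> (- real n) \<omega>\<close>.\<close>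
    define m where "m = nat \<lceil>t\<rceil> + n"
    have m: "real n + t \<le> real m" unfolding m_def using real_nat_ceiling_ge[of t] by simp
    have s: "\<theta> t \<omega> \<in> space M" using \<omega> tT by (intro flow_in_space)
    have "near C d (sgn (U \<omega> t x)) (U (\<theta> (- real m) (\<theta> t \<omega>)) (real m) u)" if u: "u \<in> C - {0}" for u
    proof -
      define v where "v = U (\<theta> (- real m) (\<theta> t \<omega>)) (real m - (t + real n)) u"
      have tn: "t + real n \<in> T" "t + real n \<in> nonneg_time T"
        using time_add[OF tT(1) time_of_nat] tT by (auto intro: nonneg_timeI)
      have "real m - (t + real n) \<in> nonneg_time T" using m tn by (intro nonneg_time_diff) auto
      then have v: "v \<in> C - {0}" unfolding v_def
        using s u by (intro U_cone_nonzero flow_in_space[OF _ s]) auto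
      have "U (\<theta> (- real m) (\<theta> t \<omega>)) (real m) u = U (\<theta> (- (t + real n)) (\<theta> t \<omega>)) (t + real n) v"
        unfolding v_def by (rule U_back_split) (use s m tn in auto)
      also have "\<theta> (- (t + real n)) (\<theta> t \<omega>) = \<theta> (- real n) \<omega>"
        using flow_add'[OF time_minus[OF tn(1)] tT(1) \<omega>] by simp
      also have "U (\<theta> (- real n) \<omega>) (t + real n) v = U \<omega> t (U (\<theta> (- real n) \<omega>) (real n) v)"
        using semiflow_add[of "\<theta> (- real n) \<omega>" "real n" t v] \<omega> t
        by (simp add: flow_in_space time_minus flow_inverse)
      finally have eq: "U (\<theta> (- real m) (\<theta> t \<omega>)) (real m) u = U \<omega> t (U (\<theta> (- real n) \<omega>) (real n) v)" .
      show ?thesis unfolding eq by (intro near_sgn_left y U_near \<omega> t n v)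
    qed
    then show ?thesis by blast
  qed
  then show ?thesis using sgn_cone[OF y] by (simp add: principal_def)
qed

text \<open>x is comparable to an image of e, whose last unit step puts it between multiples of e by
  focusing; for n = 0 the image is e itself.\<close>

lemma principal_comparable:
  assumes p: "principal \<omega> x" and \<omega>: "\<omega> \<in> space M"
  shows "x \<in> comparability_class C e"
proof -
  obtain n :: nat where n: "\<And>u. u \<in> C - {0} \<Longrightarrow> near C 1 x (U (\<theta> (- real n) \<omega>) (real n) u)"
    using principalD[OF p zero_less_one] by auto
  define y where "y = U (\<theta> (- real n) \<omega>) (real n) e"
  have "\<exists>b>0. \<exists>c>0. y - b *\<^sub>R e \<in> C \<and> c *\<^sub>R e - y \<in> C"
  proof (cases n)
    case 0
    then have "y = e" using \<omega> by (simp add: y_def flow_zero semiflow_zero)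
    then have "y - 1 *\<^sub>R e \<in> C" "1 *\<^sub>R e - y \<in> C" using cone_0 by auto
    then show ?thesis by (meson zero_less_one)
  next
    case (Suc m)
    define \<eta> where "\<eta> = \<theta> (- real n) \<omega>"
    have \<eta>: "\<eta> \<in> space M" unfolding \<eta>_def using \<omega> by (intro flow_in_space time_minus) auto
    have s: "\<theta> (real m) \<eta> \<in> space M" using \<eta> by (intro flow_in_space) auto
    have "y = U (\<theta> (real m) \<eta>) 1 (U \<eta> (real m) e)"
      unfolding y_def \<eta>_def[symmetric] using U_split[of \<eta> "real m" "real n" e] \<eta> Suc by simp
    then obtain b where b: "0 < b" "y - b *\<^sub>R e \<in> C" "(\<kappa> (\<theta> (real m) \<eta>) * b) *\<^sub>R e - y \<in> C"
      using U_focus[OF s U_cone_nonzero[OF \<eta> _ e(3), of "real m"]] by auto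
    moreover have "0 < \<kappa> (\<theta> (real m) \<eta>) * b" using kappa_ge[OF s] b by simp
    ultimately show ?thesis by blast
  qed
  then obtain b c where bc: "0 < b" "0 < c" "y - b *\<^sub>R e \<in> C" "c *\<^sub>R e - y \<in> C" by blast
  obtain a where a: "0 < a" "x - a *\<^sub>R y \<in> C" "(a * (1 + 1)) *\<^sub>R y - x \<in> C"
    using n[OF e(3)] unfolding near_def y_def by blast
  have "(x - a *\<^sub>R y) + a *\<^sub>R (y - b *\<^sub>R e) \<in> C" "((a * (1 + 1)) *\<^sub>R y - x) + (a * (1 + 1)) *\<^sub>R (c *\<^sub>R e - y) \<in> C"
    using a bc by (auto intro!: cone_add cone_scale)
  then have "x - (a * b) *\<^sub>R e \<in> C" "(a * 2 * c) *\<^sub>R e - x \<in> C" by (auto simp: scaleR_diff_right)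
  then have "comparable C x e" unfolding comparable_def cone_le_def
    using a bc by (intro exI[of _ "a * b"] exI[of _ "a * 2 * c"] conjI) auto
  then show ?thesis using p by (auto simp: comparability_class_def principal_def)
qed

lemma direction_measurable [measurable]: "direction \<in> borel_measurable M"
proof -
  have "(\<lambda>\<omega>. pullback \<omega> n) \<in> borel_measurable M" for n
  proof -
    have [measurable]: "\<theta> (- real n) \<in> M \<rightarrow>\<^sub>M M" by (intro flow_map_measurable time_minus) simp
    have [measurable]: "(\<lambda>\<omega>. U (\<theta> (- real n) \<omega>) (real n) e) \<in> borel_measurable M"
      by (rule U_measurable) auto
    show ?thesis unfolding pullback_def sgn_div_norm by measurable
  qed
  then show ?thesis unfolding direction_def by measurable
qed

end

section \<open>Integrable bounds over one unit of time\<close>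

lemma le_exp_lnplus: "0 \<le> x \<Longrightarrow> x \<le> exp (lnplus x)"
proof (cases "x = 0")
  case False
  assume "0 \<le> x"
  with False have "x = exp (ln x)" by simp
  also have "\<dots> \<le> exp (lnplus x)" unfolding lnplus_def by simp
  finally show ?thesis .
qed simp

context focusing_flow
begin

lemma complete_if_continuous: "T = UNIV \<longrightarrow> complete_measure M"
  and ergodic: "ergodic_flow M T \<theta>"
  using integrable by (auto simp: integrable_semiflow_def)

text \<open>One function serves both norms and both time sets: for integers only s = 0 and s = 1
  occur, for reals it is the sum of the two suprema.\<close>

lemma ex_integrable_bound:
  obtains a where "integrable M a" "\<And>\<omega>. 0 \<le> a \<omega>"
    "AE \<omega> in M. \<forall>s\<in>T. 0 \<le> s \<and> s \<le> 1 \<longrightarrow>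
       onorm (U \<omega> s) \<le> exp (a \<omega>) \<and> onorm (U (\<theta> s \<omega>) (1 - s)) \<le> exp (a \<omega>)"
proof -
  have pos: "0 \<le> onorm (U \<omega> s)" if "\<omega> \<in> space M" "s \<in> nonneg_time T" for \<omega> s
    using that by (intro onorm_pos_le semiflow_linear)
  from time_set show ?thesis
  proof
    assume T: "T = \<int>"
    define a where "a \<omega> = lnplus (onorm (U \<omega> 1))" for \<omega>
    have a: "integrable M a" "\<And>\<omega>. 0 \<le> a \<omega>"
      using integrable T unfolding integrable_semiflow_def a_def lnplus_def by auto
    have "onorm (U \<omega> s) \<le> exp (a \<omega>) \<and> onorm (U (\<theta> s \<omega>) (1 - s)) \<le> exp (a \<omega>)"
      if \<omega>: "\<omega> \<in> space M" and s: "s \<in> T" "0 \<le> s" "s \<le> 1" for \<omega> s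
    proof -
      have id: "onorm (U \<eta> 0) \<le> 1" if "\<eta> \<in> space M" for \<eta>
        using that by (intro onorm_bound) (auto simp: semiflow_zero)
      have one: "1 \<le> exp (a \<omega>)" using a(2) by simp
      have u1: "onorm (U \<omega> 1) \<le> exp (a \<omega>)"
        unfolding a_def using pos[OF \<omega>] by (intro le_exp_lnplus) auto
      obtain k :: int where k: "s = of_int k" using s T by (auto elim: Ints_cases)
      with s have "s = 0 \<or> s = 1" by auto
      then show ?thesis
        using order_trans[OF id[OF \<omega>] one] order_trans[OF id[OF flow_in_space[OF time_1 \<omega>]] one]
          u1 flow_zero[OF \<omega>] by auto
    qed
    then show ?thesis using a by (intro that[of a]) auto
  next
    assume T: "T = UNIV"
    define A where "A \<omega> = (SUP s\<in>{0..1}. ennreal (lnplus (onorm (U \<omega> s))))" for \<omega>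
    define B where "B \<omega> = (SUP s\<in>{0..1}. ennreal (lnplus (onorm (U (\<theta> s \<omega>) (1 - s)))))" for \<omega>
    have AB [measurable]: "A \<in> borel_measurable M" "B \<in> borel_measurable M"
      and fin: "(\<integral>\<^sup>+\<omega>. A \<omega> \<partial>M) < \<infinity>" "(\<integral>\<^sup>+\<omega>. B \<omega> \<partial>M) < \<infinity>"
      using integrable T by (auto simp: integrable_semiflow_def A_def[abs_def] B_def[abs_def])
    define a where "a \<omega> = enn2real (A \<omega>) + enn2real (B \<omega>)" for \<omega>
    have int: "integrable M (\<lambda>\<omega>. enn2real (F \<omega>))"
      if [measurable]: "F \<in> borel_measurable M" and F: "(\<integral>\<^sup>+\<omega>. F \<omega> \<partial>M) < \<infinity>" for F
    proof (rule integrableI_bounded)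
      have "(\<integral>\<^sup>+\<omega>. ennreal (norm (enn2real (F \<omega>))) \<partial>M) \<le> (\<integral>\<^sup>+\<omega>. F \<omega> \<partial>M)"
        by (intro nn_integral_mono) (simp add: ennreal_enn2real_if)
      with F show "(\<integral>\<^sup>+\<omega>. ennreal (norm (enn2real (F \<omega>))) \<partial>M) < \<infinity>" by (rule le_less_trans[rotated])
    qed measurable
    have a: "integrable M a" "\<And>\<omega>. 0 \<le> a \<omega>"
      using int[OF AB(1) fin(1)] int[OF AB(2) fin(2)] by (auto simp: a_def[abs_def])
    \<comment> \<open>\<open>enn2real\<close> sends infinity to 0, so the real function bounds the
      norms only where the suprema are finite.\<close>
    have "AE \<omega> in M. A \<omega> \<noteq> \<infinity>" "AE \<omega> in M. B \<omega> \<noteq> \<infinity>"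
      using nn_integral_PInf_AE[OF AB(1)] nn_integral_PInf_AE[OF AB(2)] fin by (auto simp: less_top)
    with AE_space have "AE \<omega> in M. \<forall>s\<in>T. 0 \<le> s \<and> s \<le> 1 \<longrightarrow>
       onorm (U \<omega> s) \<le> exp (a \<omega>) \<and> onorm (U (\<theta> s \<omega>) (1 - s)) \<le> exp (a \<omega>)"
    proof eventually_elim
      case (elim \<omega>)
      have bound: "x \<le> exp (a \<omega>)"
        if "0 \<le> x" "ennreal (lnplus x) \<le> F" "F \<noteq> \<infinity>" "enn2real F \<le> a \<omega>" for x F
      proof -
        have "0 \<le> lnplus x" by (simp add: lnplus_def)
        then have "lnplus x = enn2real (ennreal (lnplus x))" by simp
        also have "\<dots> \<le> enn2real F" using that by (intro enn2real_mono) (auto simp: less_top)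
        finally have "lnplus x \<le> a \<omega>" using that by simp
        then have "exp (lnplus x) \<le> exp (a \<omega>)" by simp
        with le_exp_lnplus[OF that(1)] show ?thesis by linarith
      qed
      show ?case
      proof (intro ballI impI conjI)
        fix s assume s: "s \<in> T" "0 \<le> s \<and> s \<le> 1"
        show "onorm (U \<omega> s) \<le> exp (a \<omega>)"
        proof (rule bound[of _ "A \<omega>"])
          show "ennreal (lnplus (onorm (U \<omega> s))) \<le> A \<omega>"
            unfolding A_def using s by (intro SUP_upper) auto
        qed (use elim s in \<open>auto simp: a_def intro: pos nonneg_timeI\<close>)
        have pos': "0 \<le> onorm (U (\<theta> s \<omega>) (1 - s))"
          by (rule pos[OF flow_in_space nonneg_time_diff]) (use elim s in auto)
        show "onorm (U (\<theta> s \<omega>) (1 - s)) \<le> exp (a \<omega>)"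
        proof (rule bound[of _ "B \<omega>"])
          show "ennreal (lnplus (onorm (U (\<theta> s \<omega>) (1 - s)))) \<le> B \<omega>"
            unfolding B_def using s by (intro SUP_upper) auto
        qed (use elim s pos' in \<open>auto simp: a_def\<close>)
      qed
    qed
    then show ?thesis using a by (intro that[of a]) auto
  qed
qed

end

section \<open>The growth of the principal direction\<close>

text \<open>The basic almost sure facts hold pointwise on G, which is invariant under integer times.
  Statements at arbitrary times refer to \<open>saturation G\<close>.\<close>

locale regular_flow = focusing_flow M T \<theta> U C e \<kappa>
  for M :: "'w measure" and T \<theta> and U :: "'w \<Rightarrow> real \<Rightarrow> 'x::{banach, second_countable_topology} \<Rightarrow> 'x"
    and C e \<kappa> +
  fixes a :: "'w \<Rightarrow> real" and G :: "'w set"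
  assumes a: "integrable M a" "\<And>\<omega>. 0 \<le> a \<omega>"
    and G: "G \<in> sets M" "prob G = 1" "\<And>\<omega> (k::int). \<omega> \<in> G \<Longrightarrow> \<theta> (of_int k) \<omega> \<in> G"
    and G_absorbing: "\<And>\<omega>. \<omega> \<in> G \<Longrightarrow> absorbing \<omega>"
    and G_bound: "\<And>\<omega> s. \<omega> \<in> G \<Longrightarrow> s \<in> T \<Longrightarrow> 0 \<le> s \<Longrightarrow> s \<le> 1 \<Longrightarrow>
      onorm (U \<omega> s) \<le> exp (a \<omega>) \<and> onorm (U (\<theta> s \<omega>) (1 - s)) \<le> exp (a \<omega>)"
    and G_tempered: "\<And>\<omega>. \<omega> \<in> G \<Longrightarrow> (\<lambda>n. a (\<theta> (real n) \<omega>) / real n) \<longlonglongrightarrow> 0"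
      "\<And>\<omega>. \<omega> \<in> G \<Longrightarrow> (\<lambda>n. a (\<theta> (- real n) \<omega>) / real n) \<longlonglongrightarrow> 0"

lemma (in focusing_flow) ex_regular: "\<exists>a G. regular_flow M T \<theta> U C e \<kappa> a G"
proof -
  obtain a where a: "integrable M a" "\<And>\<omega>. 0 \<le> a \<omega>"
    and bound: "AE \<omega> in M. \<forall>s\<in>T. 0 \<le> s \<and> s \<le> 1 \<longrightarrow>
       onorm (U \<omega> s) \<le> exp (a \<omega>) \<and> onorm (U (\<theta> s \<omega>) (1 - s)) \<le> exp (a \<omega>)"
    using ex_integrable_bound by blast
  interpret fwd: measure_preserving_map M "\<theta> 1" by (rule measure_preserving_flow) simp
  interpret bwd: measure_preserving_map M "\<theta> (- 1)" by (rule measure_preserving_flow) simp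
  have "AE \<omega> in M. absorbing \<omega> \<and> (\<forall>s\<in>T. 0 \<le> s \<and> s \<le> 1 \<longrightarrow>
       onorm (U \<omega> s) \<le> exp (a \<omega>) \<and> onorm (U (\<theta> s \<omega>) (1 - s)) \<le> exp (a \<omega>)) \<and>
       (\<lambda>n. a (\<theta> (real n) \<omega>) / real n) \<longlonglongrightarrow> 0 \<and> (\<lambda>n. a (\<theta> (- real n) \<omega>) / real n) \<longlonglongrightarrow> 0"
    using AE_space AE_absorbing bound fwd.AE_tempered[OF a] bwd.AE_tempered[OF a]
  proof eventually_elim
    case (elim \<omega>)
    then show ?case using flow_iterate[of 1 \<omega>] flow_iterate[of "- 1" \<omega>] by simp
  qed
  then obtain G where "G \<in> sets M" "prob G = 1"
    "\<And>\<omega>. \<omega> \<in> G \<Longrightarrow> absorbing \<omega> \<and> (\<forall>s\<in>T. 0 \<le> s \<and> s \<le> 1 \<longrightarrow>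
       onorm (U \<omega> s) \<le> exp (a \<omega>) \<and> onorm (U (\<theta> s \<omega>) (1 - s)) \<le> exp (a \<omega>)) \<and>
       (\<lambda>n. a (\<theta> (real n) \<omega>) / real n) \<longlonglongrightarrow> 0 \<and> (\<lambda>n. a (\<theta> (- real n) \<omega>) / real n) \<longlonglongrightarrow> 0"
    "\<And>\<omega> (k::int). \<omega> \<in> G \<Longrightarrow> \<theta> (of_int k) \<omega> \<in> G"
    by (rule AE_imp_shift_invariant) blast
  then have "regular_flow M T \<theta> U C e \<kappa> a G"
    using a by unfold_locales blast+
  then show ?thesis by blast
qed

context regular_flow
begin

abbreviation "w \<equiv> direction"
abbreviation "growth \<equiv> growth_factor \<theta> U w"

lemma G_space: "G \<subseteq> space M" using sets.sets_into_space[OF G(1)] .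

lemma saturation_space: "saturation G \<subseteq> space M"
  using saturation_invariant[OF G_space] by (simp add: invariant_set_def)

lemma G_subset_saturation: "G \<subseteq> saturation G" by (rule subset_saturation[OF G_space])

lemma saturation_flow: "\<omega> \<in> saturation G \<Longrightarrow> t \<in> T \<Longrightarrow> \<theta> t \<omega> \<in> saturation G"
  using saturation_invariant[OF G_space] by (auto simp: invariant_set_def)

text \<open>A point of the saturation is \<open>\<theta> s \<eta>\<close> with \<eta> in G and s in
  [0, 1]; U carries the principal vector of \<eta> to it, though the point itself may lie outside
  G.\<close>

lemma principal_w: "\<omega> \<in> saturation G \<Longrightarrow> principal \<omega> (w \<omega>)"
proof -
  assume "\<omega> \<in> saturation G"
  then obtain t \<omega>' where t: "t \<in> T" "\<omega>' \<in> G" "\<omega> = \<theta> t \<omega>'" by (auto simp: saturation_def)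
  obtain k :: int and s where s: "t = of_int k + s" "0 \<le> s" "s \<le> 1" "s \<in> T"
    using time_split[OF t(1)] .
  define \<eta> where "\<eta> = \<theta> (of_int k) \<omega>'"
  have \<eta>: "\<eta> \<in> G" unfolding \<eta>_def using G t by blast
  then have \<eta>s: "\<eta> \<in> space M" using G_space by blast
  have "\<omega> = \<theta> s \<eta>" unfolding t(3) s(1) \<eta>_def
    using s t(2) G_space by (subst flow_add') (auto simp: add.commute)
  moreover have "principal (\<theta> s \<eta>) (sgn (U \<eta> s (w \<eta>)))"
    using s \<eta> \<eta>s by (intro principal_flow absorbing_imp_principal G_absorbing nonneg_timeI)
  ultimately have "principal \<omega> (sgn (U \<eta> s (w \<eta>)))" "\<omega> \<in> space M"
    using flow_in_space[OF s(4) \<eta>s] by auto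
  then show ?thesis using principal_direction by simp
qed

lemma w_flow: "\<omega> \<in> saturation G \<Longrightarrow> t \<in> nonneg_time T \<Longrightarrow> w (\<theta> t \<omega>) = sgn (U \<omega> t (w \<omega>))"
  using principal_direction[OF principal_flow[OF principal_w]] saturation_space
    flow_in_space nonneg_timeD by blast

lemma w_cone: "\<omega> \<in> saturation G \<Longrightarrow> w \<omega> \<in> C - {0} \<and> norm (w \<omega>) = 1"
  using principal_w[of \<omega>] by (auto simp: principal_def)

lemma growth_nonneg_time: "0 \<le> t \<Longrightarrow> growth t \<omega> = norm (U \<omega> t (w \<omega>))"
  by (simp add: growth_factor_def)

lemma growth_pos: assumes "\<omega> \<in> saturation G" "t \<in> T" shows "0 < growth t \<omega>"
proof (cases "0 \<le> t")
  case True
  then have "U \<omega> t (w \<omega>) \<in> C - {0}"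
    using assms saturation_space w_cone by (intro U_cone_nonzero nonneg_timeI) auto
  with True show ?thesis by (simp add: growth_factor_def)
next
  case False
  have "\<theta> t \<omega> \<in> saturation G" using assms by (rule saturation_flow)
  then have "U (\<theta> t \<omega>) (- t) (w (\<theta> t \<omega>)) \<in> C - {0}"
    using False assms saturation_space w_cone time_minus by (intro U_cone_nonzero nonneg_timeI) auto
  with False show ?thesis by (simp add: growth_factor_def)
qed

lemma growth_add_nonneg:
  assumes "\<omega> \<in> saturation G" "s \<in> nonneg_time T" "t \<in> nonneg_time T"
  shows "growth (s + t) \<omega> = growth s (\<theta> t \<omega>) * growth t \<omega>"
proof -
  have \<omega>: "\<omega> \<in> space M" using assms saturation_space by blast
  have st: "0 \<le> s" "0 \<le> t" "s \<in> T" "t \<in> T" using assms nonneg_timeD by auto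
  interpret bounded_linear "U (\<theta> t \<omega>) s"
    using st assms \<omega> by (intro semiflow_linear flow_in_space)
  have nz: "norm (U \<omega> t (w \<omega>)) \<noteq> 0"
    using growth_pos[OF assms(1) st(4)] st by (simp add: growth_nonneg_time)
  have "norm (U (\<theta> t \<omega>) s (w (\<theta> t \<omega>))) * norm (U \<omega> t (w \<omega>)) = norm (U (\<theta> t \<omega>) s (U \<omega> t (w \<omega>)))"
    unfolding w_flow[OF assms(1,3)] sgn_div_norm scale using nz by simp
  also have "U (\<theta> t \<omega>) s (U \<omega> t (w \<omega>)) = U \<omega> (s + t) (w \<omega>)"
    using semiflow_add[OF \<omega> assms(3,2)] .
  finally show ?thesis using st by (simp add: growth_nonneg_time)
qed

text \<open>From a base point far enough in the past all times are nonnegative, and two-sided growth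
  is a quotient of forward growths. This frees the cocycle identity from a distinction of
  signs.\<close>

lemma growth_from_past:
  assumes \<omega>: "\<omega> \<in> saturation G" and m: "m \<in> T" "0 \<le> m" and u: "u \<in> T" "- m \<le> u"
  shows "growth u \<omega> = growth (m + u) (\<theta> (- m) \<omega>) / growth m (\<theta> (- m) \<omega>)"
proof -
  define \<eta> where "\<eta> = \<theta> (- m) \<omega>"
  have \<omega>s: "\<omega> \<in> space M" using \<omega> saturation_space by blast
  have \<eta>: "\<eta> \<in> saturation G" unfolding \<eta>_def using \<omega> m by (intro saturation_flow time_minus)
  have \<eta>m: "\<theta> m \<eta> = \<omega>" unfolding \<eta>_def using m(1) \<omega>s by (rule flow_inverse)
  have mu: "m + u \<in> nonneg_time T" using u m by (intro nonneg_timeI time_add) auto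
  have pos: "0 < growth m \<eta>" "0 < growth (m + u) \<eta>"
    using growth_pos[OF \<eta>] m mu nonneg_timeD by auto
  show ?thesis
  proof (cases "0 \<le> u")
    case True
    then have "growth (u + m) \<eta> = growth u (\<theta> m \<eta>) * growth m \<eta>"
      using u m by (intro growth_add_nonneg[OF \<eta>] nonneg_timeI)
    then show ?thesis using pos by (simp add: \<eta>m \<eta>_def[symmetric] add.commute)
  next
    case False
    have "growth (- u + (m + u)) \<eta> = growth (- u) (\<theta> (m + u) \<eta>) * growth (m + u) \<eta>"
      using u m mu False by (intro growth_add_nonneg[OF \<eta>] nonneg_timeI[OF time_minus]) auto
    moreover have "\<theta> (m + u) \<eta> = \<theta> u \<omega>"
      unfolding \<eta>_def using m u \<omega>s by (subst flow_add') (auto intro: time_add time_minus)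
    ultimately have "growth m \<eta> = growth (- u) (\<theta> u \<omega>) * growth (m + u) \<eta>" by simp
    moreover have "growth u \<omega> = 1 / growth (- u) (\<theta> u \<omega>)" using False by (simp add: growth_factor_def)
    moreover have "0 < growth (- u) (\<theta> u \<omega>)"
      using \<omega> u by (intro growth_pos saturation_flow time_minus)
    ultimately show ?thesis using pos by (simp add: \<eta>_def[symmetric])
  qed
qed

lemma growth_add:
  assumes \<omega>: "\<omega> \<in> saturation G" and s: "s \<in> T" and t: "t \<in> T"
  shows "growth (s + t) \<omega> = growth s (\<theta> t \<omega>) * growth t \<omega>"
proof -
  \<comment> \<open>Large enough that 0, t and s + t all come after time -m.\<close>
  define m where "m = real (nat \<lceil>\<bar>s\<bar> + \<bar>t\<bar>\<rceil>)"
  have m: "m \<in> T" "0 \<le> m" "\<bar>s\<bar> + \<bar>t\<bar> \<le> m" unfolding m_def by (auto simp: real_nat_ceiling_ge)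
  define \<eta> where "\<eta> = \<theta> (- m) \<omega>"
  have \<omega>s: "\<omega> \<in> space M" using \<omega> saturation_space by blast
  have mt: "m + t \<in> T" "0 \<le> m + t" using m t by (auto intro: time_add)
  have "\<theta> (- (m + t)) (\<theta> t \<omega>) = \<eta>"
    unfolding \<eta>_def using flow_add'[OF time_minus[OF mt(1)] t \<omega>s] by simp
  then have "growth s (\<theta> t \<omega>) = growth (m + t + s) \<eta> / growth (m + t) \<eta>"
    using growth_from_past[OF saturation_flow[OF \<omega> t] mt s] m by simp
  moreover have "growth t \<omega> = growth (m + t) \<eta> / growth m \<eta>"
    unfolding \<eta>_def using m by (intro growth_from_past \<omega> t) auto
  moreover have "growth (s + t) \<omega> = growth (m + (s + t)) \<eta> / growth m \<eta>"
    unfolding \<eta>_def using m s t by (intro growth_from_past \<omega> time_add) auto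
  moreover have "0 < growth (m + t) \<eta>"
    unfolding \<eta>_def using m mt \<omega> by (intro growth_pos saturation_flow time_minus)
  ultimately show ?thesis by (simp add: add_ac)
qed

lemma growth_0: "\<omega> \<in> saturation G \<Longrightarrow> growth 0 \<omega> = 1"
  using w_cone[of \<omega>] saturation_space by (auto simp: growth_nonneg_time semiflow_zero)

definition log_growth :: "'w \<Rightarrow> real \<Rightarrow> real" where
  "log_growth \<omega> t = ln (growth t \<omega>)"

lemma exp_log_growth: "\<omega> \<in> saturation G \<Longrightarrow> t \<in> T \<Longrightarrow> exp (log_growth \<omega> t) = growth t \<omega>"
  using growth_pos by (simp add: log_growth_def)

lemma log_growth_add:
  "\<omega> \<in> saturation G \<Longrightarrow> s \<in> T \<Longrightarrow> t \<in> T \<Longrightarrow>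
     log_growth \<omega> (s + t) = log_growth (\<theta> t \<omega>) s + log_growth \<omega> t"
  using growth_add[of \<omega> s t] growth_pos[of \<omega> t] growth_pos[of "\<theta> t \<omega>" s] saturation_flow[of \<omega> t]
  by (simp add: log_growth_def ln_mult)

lemma growth_le_onorm:
  assumes "\<omega> \<in> saturation G" "t \<in> nonneg_time T" shows "growth t \<omega> \<le> onorm (U \<omega> t)"
proof -
  have "norm (U \<omega> t (w \<omega>)) \<le> onorm (U \<omega> t) * norm (w \<omega>)"
    using assms saturation_space by (intro onorm semiflow_linear) auto
  then show ?thesis using w_cone[OF assms(1)] nonneg_timeD[OF assms(2)] by (simp add: growth_nonneg_time)
qed

text \<open>The two norm bounds control the growth from k to k + s and from k + s to k + 1; the
  second one excludes a collapse at time k + s that is undone by time k + 1.\<close>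

lemma log_growth_between:
  assumes \<omega>: "\<omega> \<in> G" and s: "s \<in> T" "0 \<le> s" "s \<le> 1"
  shows "log_growth \<omega> (of_int k + s) \<le> log_growth \<omega> (of_int k) + a (\<theta> (of_int k) \<omega>)"
    and "log_growth \<omega> (of_int k + 1) \<le> log_growth \<omega> (of_int k + s) + a (\<theta> (of_int k) \<omega>)"
proof -
  define \<eta> where "\<eta> = \<theta> (of_int k) \<omega>"
  have \<eta>G: "\<eta> \<in> G" unfolding \<eta>_def using G \<omega> by blast
  note sat = subsetD[OF G_subset_saturation]
  have \<eta>: "\<eta> \<in> saturation G" using \<eta>G by (rule sat)
  have le: "ln x \<le> c" if "0 < x" "x \<le> exp c" for x c :: real
    using that by (metis ln_exp ln_mono)
  have "log_growth \<eta> s \<le> a \<eta>" unfolding log_growth_def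
    using growth_le_onorm[OF \<eta> nonneg_timeI[OF s(1,2)]] G_bound[OF \<eta>G s] growth_pos[OF \<eta> s(1)]
    by (intro le) auto
  then show 1: "log_growth \<omega> (of_int k + s) \<le> log_growth \<omega> (of_int k) + a (\<theta> (of_int k) \<omega>)"
    using log_growth_add[OF sat[OF \<omega>] s(1), of "of_int k"] by (simp add: \<eta>_def add.commute)
  have s': "1 - s \<in> nonneg_time T" using s by (intro nonneg_time_diff) auto
  have \<eta>s: "\<theta> s \<eta> \<in> saturation G" using \<eta> s by (intro saturation_flow)
  have "log_growth (\<theta> s \<eta>) (1 - s) \<le> a \<eta>" unfolding log_growth_def
    using growth_le_onorm[OF \<eta>s s'] G_bound[OF \<eta>G s] growth_pos[OF \<eta>s] nonneg_timeD[OF s']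
    by (intro le) auto
  moreover have "\<theta> s \<eta> = \<theta> (of_int k + s) \<omega>"
    unfolding \<eta>_def using s \<omega> G_space by (subst flow_add') (auto simp: add.commute)
  moreover have "log_growth \<omega> ((1 - s) + (of_int k + s)) =
      log_growth (\<theta> (of_int k + s) \<omega>) (1 - s) + log_growth \<omega> (of_int k + s)"
    using s nonneg_timeD[OF s'] by (intro log_growth_add sat \<omega> time_add) auto
  ultimately show "log_growth \<omega> (of_int k + 1) \<le> log_growth \<omega> (of_int k + s) + a (\<theta> (of_int k) \<omega>)"
    by (simp add: \<eta>_def add.commute)
qed

section \<open>The exponent as a Birkhoff limit\<close>

text \<open>The value 0 off G makes the bound by the nonnegative function a hold everywhere.\<close>

definition log_step :: "'w \<Rightarrow> real" where
  "log_step \<omega> = indicator G \<omega> * ln (norm (U \<omega> 1 (w \<omega>)))"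

lemma log_step_measurable [measurable]: "log_step \<in> borel_measurable M"
proof -
  have [measurable]: "G \<in> sets M" by (rule G)
  have [measurable]: "(\<lambda>\<omega>. U \<omega> 1 (w \<omega>)) \<in> borel_measurable M" by (rule U_measurable) auto
  show ?thesis unfolding log_step_def by measurable
qed

lemma log_step_eq: "\<omega> \<in> G \<Longrightarrow> log_step \<omega> = log_growth \<omega> 1"
  by (simp add: log_step_def log_growth_def growth_nonneg_time)

lemma log_growth_0: "\<omega> \<in> saturation G \<Longrightarrow> log_growth \<omega> 0 = 0"
  by (simp add: log_growth_def growth_0)

lemma log_step_le: "log_step \<omega> \<le> a \<omega>"
proof (cases "\<omega> \<in> G")
  case True
  then show ?thesis
    using log_growth_between(1)[OF True, of 1 0] log_growth_0[OF subsetD[OF G_subset_saturation True]]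
      flow_zero[OF subsetD[OF G_space True]] by (simp add: log_step_eq)
qed (use a in \<open>simp add: log_step_def\<close>)

lemma log_step_fin: "(\<integral>\<^sup>+\<omega>. ennreal (log_step \<omega>) \<partial>M) < \<infinity>"
proof -
  have "(\<integral>\<^sup>+\<omega>. ennreal (log_step \<omega>) \<partial>M) \<le> (\<integral>\<^sup>+\<omega>. ennreal (a \<omega>) \<partial>M)"
    by (intro nn_integral_mono ennreal_leI log_step_le)
  also have "\<dots> < \<infinity>" using a by (simp add: real_integrable_def less_top[symmetric])
  finally show ?thesis .
qed

lemma birkhoff_log_step:
  assumes "\<omega> \<in> G" shows "birkhoff_sum (\<theta> 1) log_step \<omega> n = log_growth \<omega> (real n)"
proof (induction n)
  case 0
  then show ?case using assms G_subset_saturation log_growth_0 by auto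
next
  case (Suc n)
  have "\<theta> (real n) \<omega> \<in> G" using G(3)[OF assms, of "int n"] by simp
  moreover have "log_growth \<omega> (1 + real n) = log_growth (\<theta> (real n) \<omega>) 1 + log_growth \<omega> (real n)"
    using assms G_subset_saturation by (intro log_growth_add) auto
  ultimately show ?case
    using Suc assms G_space flow_iterate[of 1 \<omega> n] by (auto simp: birkhoff_sum_Suc_right log_step_eq)
qed

text \<open>The function summed is the step that ends at the current point, so its sums along the
  inverse map undo the growth unit by unit.\<close>

lemma birkhoff_log_step_backward:
  assumes "\<omega> \<in> G"
  shows "birkhoff_sum (\<theta> (- 1)) (\<lambda>\<omega>. log_step (\<theta> (- 1) \<omega>)) \<omega> n = - log_growth \<omega> (- real n)"
proof (induction n)
  case 0
  then show ?case using assms G_subset_saturation log_growth_0 by auto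
next
  case (Suc n)
  have s: "\<omega> \<in> space M" using assms G_space by blast
  have "\<theta> (- 1) (\<theta> (- real n) \<omega>) = \<theta> (- real (Suc n)) \<omega>"
    using flow_add'[of "- 1" "- real n" \<omega>] s by simp
  moreover have "\<theta> (- real (Suc n)) \<omega> \<in> G" using G(3)[OF assms, of "- int (Suc n)"] by simp
  moreover have "log_growth \<omega> (1 + - real (Suc n)) =
      log_growth (\<theta> (- real (Suc n)) \<omega>) 1 + log_growth \<omega> (- real (Suc n))"
    using assms G_subset_saturation time_simps(2)[of "Suc n"] by (intro log_growth_add) auto
  ultimately show ?case
    using Suc s flow_iterate[of "- 1" \<omega> n] by (simp add: birkhoff_sum_Suc_right log_step_eq)
qed

definition exponent :: ereal where
  "exponent = extended_integral M log_step"

lemma log_growth_flow: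
  "\<omega> \<in> G \<Longrightarrow> s \<in> T \<Longrightarrow> t \<in> T \<Longrightarrow> log_growth (\<theta> s \<omega>) t = log_growth \<omega> (t + s) - log_growth \<omega> s"
  using log_growth_add[of \<omega> t s] G_subset_saturation by auto

lemma zero_one:
  assumes "Measurable.pred M P"
    and "\<And>\<omega>. \<omega> \<in> G \<Longrightarrow> P \<omega> \<longleftrightarrow> Q (log_growth \<omega>)"
    and "\<And>\<omega> s. \<omega> \<in> G \<Longrightarrow> s \<in> T \<Longrightarrow> 0 \<le> s \<Longrightarrow> s \<le> 1 \<Longrightarrow>
      Q (log_growth (\<theta> s \<omega>)) \<longleftrightarrow> Q (log_growth \<omega>)"
  shows "(AE \<omega> in M. P \<omega>) \<or> (AE \<omega> in M. \<not> P \<omega>)"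
  using assms by (intro AE_zero_one[OF complete_if_continuous ergodic G]) auto

text \<open>From \<open>\<theta> s \<omega>\<close> the growth of \<omega> is sampled at the times n
  + s, which interlace with the integers; temperedness makes the errors sublinear. This admits the
  rates to the zero-one law of the flow.\<close>

lemma rate_forward_invariant:
  assumes \<omega>: "\<omega> \<in> G" and s: "s \<in> T" "0 \<le> s" "s \<le> 1"
  shows "rate_le (\<lambda>n. log_growth (\<theta> s \<omega>) (real n)) c \<longleftrightarrow> rate_le (\<lambda>n. log_growth \<omega> (real n)) c"
    and "rate_le (\<lambda>n. - log_growth (\<theta> s \<omega>) (real n)) c \<longleftrightarrow> rate_le (\<lambda>n. - log_growth \<omega> (real n)) c"
proof -
  note r = tendsto_over_n_add_const[OF G_tempered(1)[OF \<omega>]]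
  have up: "log_growth (\<theta> s \<omega>) (real n) \<le> log_growth \<omega> (real n) + (a (\<theta> (real n) \<omega>) + - log_growth \<omega> s)"
    and lo: "log_growth \<omega> (real (Suc n)) \<le> log_growth (\<theta> s \<omega>) (real n) + (a (\<theta> (real n) \<omega>) + log_growth \<omega> s)"
    for n
    using log_growth_between[OF \<omega> s, of "int n"] log_growth_flow[OF \<omega> s(1) time_of_nat, of n]
    by (simp_all add: add.commute)
  show "rate_le (\<lambda>n. log_growth (\<theta> s \<omega>) (real n)) c \<longleftrightarrow> rate_le (\<lambda>n. log_growth \<omega> (real n)) c"
    by (rule rate_le_interlace[OF r r up lo])
  show "rate_le (\<lambda>n. - log_growth (\<theta> s \<omega>) (real n)) c \<longleftrightarrow> rate_le (\<lambda>n. - log_growth \<omega> (real n)) c"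
  proof (rule rate_le_interlace'[OF r r])
    fix n
    show "- log_growth \<omega> (real n) \<le> - log_growth (\<theta> s \<omega>) (real n) + (a (\<theta> (real n) \<omega>) + - log_growth \<omega> s)"
      using up[of n] by linarith
    show "- log_growth (\<theta> s \<omega>) (real n) \<le> - log_growth \<omega> (real (Suc n)) + (a (\<theta> (real n) \<omega>) + log_growth \<omega> s)"
      using lo[of n] by linarith
  qed
qed

lemma rate_backward_invariant:
  assumes \<omega>: "\<omega> \<in> G" and s: "s \<in> T" "0 \<le> s" "s \<le> 1"
  shows "rate_le (\<lambda>n. - log_growth (\<theta> s \<omega>) (- real n)) c \<longleftrightarrow> rate_le (\<lambda>n. - log_growth \<omega> (- real n)) c"
    and "rate_le (\<lambda>n. log_growth (\<theta> s \<omega>) (- real n)) c \<longleftrightarrow> rate_le (\<lambda>n. log_growth \<omega> (- real n)) c"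
proof -
  note r = tendsto_over_n_add_const[OF G_tempered(2)[OF \<omega>]]
  \<comment> \<open>The interval that ends at -n is controlled by a at its left end -n - 1, hence
    the shifted index.\<close>
  note r' = tendsto_over_n_add_const[OF tendsto_0_over_n_Suc[OF G_tempered(2)[OF \<omega>]]]
  have up: "log_growth (\<theta> s \<omega>) (- real n) \<le> log_growth \<omega> (- real n) + (a (\<theta> (- real n) \<omega>) + - log_growth \<omega> s)"
    for n
    using log_growth_between(1)[OF \<omega> s, of "- int n"] log_growth_flow[OF \<omega> s(1) time_simps(2), of n]
    by simp
  have lo: "log_growth \<omega> (- real n) \<le>
      log_growth (\<theta> s \<omega>) (- real (Suc n)) + (a (\<theta> (- real (Suc n)) \<omega>) + log_growth \<omega> s)" for n
    using log_growth_between(2)[OF \<omega> s, of "- int (Suc n)"]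
      log_growth_flow[OF \<omega> s(1) time_simps(2), of "Suc n"] by simp
  show "rate_le (\<lambda>n. - log_growth (\<theta> s \<omega>) (- real n)) c \<longleftrightarrow> rate_le (\<lambda>n. - log_growth \<omega> (- real n)) c"
  proof (rule rate_le_interlace[OF r r', symmetric])
    fix n
    show "- log_growth \<omega> (- real n) \<le> - log_growth (\<theta> s \<omega>) (- real n) + (a (\<theta> (- real n) \<omega>) + - log_growth \<omega> s)"
      using up[of n] by linarith
    show "- log_growth (\<theta> s \<omega>) (- real (Suc n)) \<le>
        - log_growth \<omega> (- real n) + (a (\<theta> (- real (Suc n)) \<omega>) + log_growth \<omega> s)"
      using lo[of n] by linarith
  qed
  show "rate_le (\<lambda>n. log_growth (\<theta> s \<omega>) (- real n)) c \<longleftrightarrow> rate_le (\<lambda>n. log_growth \<omega> (- real n)) c"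
    by (rule rate_le_interlace'[OF r r' up lo, symmetric])
qed

lemma AE_G: "AE \<omega> in M. \<omega> \<in> G"
  using G by (simp add: AE_in_set_eq_1)

text \<open>Serves both time directions, h selecting the sequence. Lower bounds are upper bounds for
  -g if g is integrable; otherwise the extended integral is -infinity and no lower bound is
  claimed.\<close>

lemma AE_rates:
  assumes "measure_preserving_map M \<tau>" and g [measurable]: "g \<in> borel_measurable M"
    and fin: "(\<integral>\<^sup>+\<omega>. ennreal (g \<omega>) \<partial>M) < \<infinity>"
    and birkhoff: "\<And>\<omega> n. \<omega> \<in> G \<Longrightarrow> birkhoff_sum \<tau> g \<omega> n = h (log_growth \<omega>) n"
    and inv: "\<And>\<omega> s c. \<omega> \<in> G \<Longrightarrow> s \<in> T \<Longrightarrow> 0 \<le> s \<Longrightarrow> s \<le> 1 \<Longrightarrow>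
      rate_le (h (log_growth (\<theta> s \<omega>))) c \<longleftrightarrow> rate_le (h (log_growth \<omega>)) c"
    and inv': "\<And>\<omega> s c. \<omega> \<in> G \<Longrightarrow> s \<in> T \<Longrightarrow> 0 \<le> s \<Longrightarrow> s \<le> 1 \<Longrightarrow>
      rate_le (\<lambda>n. - h (log_growth (\<theta> s \<omega>)) n) c \<longleftrightarrow> rate_le (\<lambda>n. - h (log_growth \<omega>) n) c"
  shows "AE \<omega> in M. \<forall>c. (extended_integral M g < ereal c \<longrightarrow> rate_le (h (log_growth \<omega>)) c) \<and>
    (ereal c < extended_integral M g \<longrightarrow> rate_le (\<lambda>n. - h (log_growth \<omega>) n) (- c))"
proof -
  interpret measure_preserving_map M \<tau> by fact
  have birk: "birkhoff_sum \<tau> g \<omega> = h (log_growth \<omega>)" if "\<omega> \<in> G" for \<omega>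
    using birkhoff[OF that] by auto
  have birk': "birkhoff_sum \<tau> (\<lambda>\<omega>. - g \<omega>) \<omega> = (\<lambda>n. - h (log_growth \<omega>) n)" if "\<omega> \<in> G" for \<omega>
    using birk[OF that] by (auto simp: birkhoff_sum_def sum_negf fun_eq_iff)
  have "AE \<omega> in M. \<forall>c. extended_integral M g < ereal c \<longrightarrow> rate_le (birkhoff_sum \<tau> g \<omega>) c"
    by (intro AE_rate_le_birkhoff g fin zero_one[where Q = "\<lambda>\<phi>. rate_le (h \<phi>) c" for c])
      (use birk inv in auto)
  moreover have "AE \<omega> in M. \<forall>c. ereal c < extended_integral M g \<longrightarrow>
      rate_le (birkhoff_sum \<tau> (\<lambda>\<omega>. - g \<omega>) \<omega>) (- c)"
  proof (cases "integrable M g")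
    case True
    have "AE \<omega> in M. \<forall>c. extended_integral M (\<lambda>\<omega>. - g \<omega>) < ereal c \<longrightarrow>
        rate_le (birkhoff_sum \<tau> (\<lambda>\<omega>. - g \<omega>) \<omega>) c"
      by (intro AE_rate_le_birkhoff zero_one[where Q = "\<lambda>\<phi>. rate_le (\<lambda>n. - h \<phi> n) c" for c])
        (use True birk' inv' in \<open>auto simp: real_integrable_def less_top[symmetric]\<close>)
    then show ?thesis
    proof eventually_elim
      case (elim \<omega>)
      then show ?case using True by (auto simp: extended_integral_eq)
    qed
  next
    case False
    then have "extended_integral M g = - \<infinity>" using fin by (intro extended_integral_eq_minf) auto
    then show ?thesis by simp
  qed
  ultimately show ?thesis using AE_G
    by eventually_elim (auto simp: birk birk')
qed

lemma AE_rates_forward: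
  "AE \<omega> in M. \<forall>c. (exponent < ereal c \<longrightarrow> rate_le (\<lambda>n. log_growth \<omega> (real n)) c) \<and>
     (ereal c < exponent \<longrightarrow> rate_le (\<lambda>n. - log_growth \<omega> (real n)) (- c))"
  unfolding exponent_def
  using rate_forward_invariant birkhoff_log_step
  by (intro AE_rates[OF measure_preserving_flow[OF time_1] log_step_measurable log_step_fin,
        where h = "\<lambda>\<phi> n. \<phi> (real n)"]) auto

lemma AE_rates_backward:
  "AE \<omega> in M. \<forall>c. (exponent < ereal c \<longrightarrow> rate_le (\<lambda>n. - log_growth \<omega> (- real n)) c) \<and>
     (ereal c < exponent \<longrightarrow> rate_le (\<lambda>n. log_growth \<omega> (- real n)) (- c))"
proof -
  have [measurable]: "\<theta> (- 1) \<in> M \<rightarrow>\<^sub>M M" by (intro flow_map_measurable) simp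
  have eq: "(\<integral>\<^sup>+\<omega>. ennreal (F (log_step (\<theta> (- 1) \<omega>))) \<partial>M) = (\<integral>\<^sup>+\<omega>. ennreal (F (log_step \<omega>)) \<partial>M)"
    if [measurable]: "F \<in> borel_measurable borel" for F :: "real \<Rightarrow> real"
    by (subst (2) flow_preserving[of "- 1", symmetric], simp, subst nn_integral_distr) auto
  have ext: "extended_integral M (\<lambda>\<omega>. log_step (\<theta> (- 1) \<omega>)) = exponent"
    unfolding exponent_def extended_integral_def using eq[of "\<lambda>x. x"] eq[of uminus] by simp
  have "AE \<omega> in M. \<forall>c. (extended_integral M (\<lambda>\<omega>. log_step (\<theta> (- 1) \<omega>)) < ereal c \<longrightarrow>
      rate_le (\<lambda>n. - log_growth \<omega> (- real n)) c) \<and>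
     (ereal c < extended_integral M (\<lambda>\<omega>. log_step (\<theta> (- 1) \<omega>)) \<longrightarrow>
      rate_le (\<lambda>n. - (- log_growth \<omega> (- real n))) (- c))"
    using rate_backward_invariant birkhoff_log_step_backward log_step_fin eq[of "\<lambda>x. x"]
    by (intro AE_rates[OF measure_preserving_flow[OF time_simps(3)], where h = "\<lambda>\<phi> n. - \<phi> (- real n)"]) auto
  then show ?thesis by (simp add: ext)
qed

text \<open>Both limits are stored as growth bounds, which are stable under time shifts and constant
  factors. At time -t a factor of rate r behaves like exp (- r * t), so there the factor and its
  inverse exchange roles.\<close>

definition has_growth_rate :: "'w \<Rightarrow> bool" where
  "has_growth_rate \<omega> \<longleftrightarrow>
     (\<forall>c. (exponent < ereal c \<longrightarrow>
            growth_le T (\<lambda>t. growth t \<omega>) c \<and> growth_le T (\<lambda>t. inverse (growth (- t) \<omega>)) c) \<and>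
          (ereal c < exponent \<longrightarrow>
            growth_le T (\<lambda>t. inverse (growth t \<omega>)) (- c) \<and> growth_le T (\<lambda>t. growth (- t) \<omega>) (- c)))"

lemma AE_has_growth_rate: "AE \<omega> in M. has_growth_rate \<omega>"
  using AE_G AE_rates_forward AE_rates_backward
proof eventually_elim
  case (elim \<omega>)
  then have \<omega>: "\<omega> \<in> G" by simp
  have sat: "\<omega> \<in> saturation G" using \<omega> G_subset_saturation by blast
  note t1 = G_tempered(1)[OF \<omega>]
  note t2 = tendsto_0_over_n_Suc[OF G_tempered(2)[OF \<omega>]]
  have in_T: "s \<in> T" if "real n + s \<in> T" for n s
    using time_diff[OF that time_of_nat[of n]] by simp
  have up: "growth (real n + s) \<omega> \<le> exp (log_growth \<omega> (real n) + a (\<theta> (real n) \<omega>))"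
    if "0 \<le> s" "s \<le> 1" "real n + s \<in> T" for n s
    using log_growth_between(1)[OF \<omega> in_T[OF that(3)] that(1,2), of "int n"] that(3)
    by (subst exp_log_growth[OF sat, symmetric]) auto
  have lo: "inverse (growth (real n + s) \<omega>) \<le> exp (- log_growth \<omega> (real (Suc n)) + a (\<theta> (real n) \<omega>))"
    if "0 \<le> s" "s \<le> 1" "real n + s \<in> T" for n s
    using log_growth_between(2)[OF \<omega> in_T[OF that(3)] that(1,2), of "int n"] that(3)
    by (subst exp_log_growth[OF sat, symmetric]) (auto simp: exp_minus[symmetric] add.commute)
  have neg: "- (real n + s) \<in> T \<and> 1 - s \<in> T" if "real n + s \<in> T" for n s
    using time_minus[OF that] time_diff[OF time_1 in_T[OF that]] by simp
  \<comment> \<open>The time -(n + s) sits at position 1 - s in the unit interval that starts at -(n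
    + 1).\<close>
  have up': "inverse (growth (- (real n + s)) \<omega>) \<le> exp (- log_growth \<omega> (- real n) + a (\<theta> (- real (Suc n)) \<omega>))"
    if "0 \<le> s" "s \<le> 1" "real n + s \<in> T" for n s
  proof -
    have "log_growth \<omega> (- real n) \<le> log_growth \<omega> (- (real n + s)) + a (\<theta> (- real (Suc n)) \<omega>)"
      using log_growth_between(2)[OF \<omega>, of "1 - s" "- int (Suc n)"] neg[OF that(3)] that by (simp add: algebra_simps)
    then show ?thesis using neg[OF that(3)]
      by (subst exp_log_growth[OF sat, symmetric]) (auto simp: exp_minus[symmetric])
  qed
  have lo': "growth (- (real n + s)) \<omega> \<le> exp (log_growth \<omega> (- real (Suc n)) + a (\<theta> (- real (Suc n)) \<omega>))"
    if "0 \<le> s" "s \<le> 1" "real n + s \<in> T" for n s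
  proof -
    have "log_growth \<omega> (- (real n + s)) \<le> log_growth \<omega> (- real (Suc n)) + a (\<theta> (- real (Suc n)) \<omega>)"
      using log_growth_between(1)[OF \<omega>, of "1 - s" "- int (Suc n)"] neg[OF that(3)] that by (simp add: algebra_simps)
    then show ?thesis using neg[OF that(3)]
      by (subst exp_log_growth[OF sat, symmetric]) auto
  qed
  show ?case
    unfolding has_growth_rate_def
  proof (intro allI conjI impI)
    fix c
    assume c: "exponent < ereal c"
    show "growth_le T (\<lambda>t. growth t \<omega>) c"
      by (rule growth_le_interpolate[OF _ t1 up]) (use elim c in auto)
    show "growth_le T (\<lambda>t. inverse (growth (- t) \<omega>)) c"
      by (rule growth_le_interpolate[OF _ t2 up']) (use elim c in auto)
  next
    fix c
    assume c: "ereal c < exponent"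
    show "growth_le T (\<lambda>t. inverse (growth t \<omega>)) (- c)"
      by (rule growth_le_interpolate[OF _ t1 lo], rule rate_le_Suc[THEN iffD2]) (use elim c in auto)
    show "growth_le T (\<lambda>t. growth (- t) \<omega>) (- c)"
      by (rule growth_le_interpolate[OF _ t2 lo'], rule rate_le_Suc[THEN iffD2]) (use elim c in auto)
  qed
qed

lemma has_growth_rate_flow:
  assumes \<omega>: "\<omega> \<in> saturation G" and rate: "has_growth_rate \<omega>" and s: "s \<in> T"
  shows "has_growth_rate (\<theta> s \<omega>)"
proof -
  have eq: "growth t (\<theta> s \<omega>) = inverse (growth s \<omega>) * growth (t + s) \<omega>" if "t \<in> T" for t
    using growth_add[OF \<omega> that s] growth_pos[OF \<omega> s] by simp
  have pos: "0 \<le> inverse (growth s \<omega>)" "0 \<le> growth s \<omega>" using growth_pos[OF \<omega> s] by auto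
  have *: "t + s \<in> T" "t + - s \<in> T" if "t \<in> T" for t
    using that s time_add time_minus by blast+
  have 1: "growth_le T (\<lambda>t. growth t (\<theta> s \<omega>)) c" if "growth_le T (\<lambda>t. growth t \<omega>) c" for c
    by (rule growth_le_shift[OF that *(1) _ pos(1)]) (auto intro: eventually_time_at_topI simp: eq)
  have 2: "growth_le T (\<lambda>t. inverse (growth t (\<theta> s \<omega>))) c" if "growth_le T (\<lambda>t. inverse (growth t \<omega>)) c" for c
    by (rule growth_le_shift[OF that *(1) _ pos(2)]) (auto intro: eventually_time_at_topI simp: eq)
  have 3: "growth_le T (\<lambda>t. growth (- t) (\<theta> s \<omega>)) c" if "growth_le T (\<lambda>t. growth (- t) \<omega>) c" for c
    by (rule growth_le_shift[OF that *(2) _ pos(1)]) (auto intro: eventually_time_at_topI simp: eq time_minus)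
  have 4: "growth_le T (\<lambda>t. inverse (growth (- t) (\<theta> s \<omega>))) c" if "growth_le T (\<lambda>t. inverse (growth (- t) \<omega>)) c" for c
    by (rule growth_le_shift[OF that *(2) _ pos(2)]) (auto intro: eventually_time_at_topI simp: eq time_minus)
  from rate show ?thesis unfolding has_growth_rate_def using 1 2 3 4 by blast
qed

lemma has_growth_rate_tendsto:
  assumes \<omega>: "\<omega> \<in> saturation G" and rate: "has_growth_rate \<omega>"
  shows "((\<lambda>t. exp_rate t (growth t \<omega>)) \<longlongrightarrow> exponent) (time_at_top T)"
    and "((\<lambda>t. exp_rate t (growth t \<omega>)) \<longlongrightarrow> exponent) (time_at_bot T)"
proof -
  show "((\<lambda>t. exp_rate t (growth t \<omega>)) \<longlongrightarrow> exponent) (time_at_top T)"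
    using rate growth_pos[OF \<omega>]
    by (intro tendsto_exp_rate) (auto simp: has_growth_rate_def intro: eventually_time_at_topI)
  have "((\<lambda>t. exp_rate t (inverse (growth (- t) \<omega>))) \<longlongrightarrow> exponent) (time_at_top T)"
    using rate growth_pos[OF \<omega>] time_minus
    by (intro tendsto_exp_rate) (auto simp: has_growth_rate_def intro: eventually_time_at_topI)
  then show "((\<lambda>t. exp_rate t (growth t \<omega>)) \<longlongrightarrow> exponent) (time_at_bot T)"
    by (rule tendsto_exp_rate_bot[OF uminus_time]) (use growth_pos[OF \<omega>] time_minus in \<open>auto simp: divide_simps\<close>)
qed

end

section \<open>The growth of arbitrary vectors\<close>

context regular_flow
begin

lemma U_zero: "\<omega> \<in> space M \<Longrightarrow> t \<in> nonneg_time T \<Longrightarrow> U \<omega> t 0 = 0"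
  by (rule linear_simps(3)[OF semiflow_linear])

lemma U_add': "\<omega> \<in> space M \<Longrightarrow> t \<in> nonneg_time T \<Longrightarrow> U \<omega> t (x + y) = U \<omega> t x + U \<omega> t y"
  and U_diff': "\<omega> \<in> space M \<Longrightarrow> t \<in> nonneg_time T \<Longrightarrow> U \<omega> t (x - y) = U \<omega> t x - U \<omega> t y"
  and U_scale: "\<omega> \<in> space M \<Longrightarrow> t \<in> nonneg_time T \<Longrightarrow> U \<omega> t (c *\<^sub>R x) = c *\<^sub>R U \<omega> t x"
  using linear_simps[OF semiflow_linear] by blast+

lemma U_norm_mono:
  assumes "\<omega> \<in> space M" "t \<in> nonneg_time T" "x \<in> C" "y - x \<in> C"
  shows "norm (U \<omega> t x) \<le> norm (U \<omega> t y)"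
  using U_cone[OF assms(1-3)] U_cone[OF assms(1,2,4)] assms by (intro norm_mono) (auto simp: U_diff')

text \<open>After one unit step the images of u and w are comparable, and positivity with the
  monotone norm preserves this at all later times.\<close>

lemma cone_growth:
  assumes \<omega>: "\<omega> \<in> saturation G" and u: "u \<in> C - {0}"
  shows "\<exists>l>0. \<exists>r>0. \<forall>t\<in>T. 1 \<le> t \<longrightarrow>
    l * growth t \<omega> \<le> norm (U \<omega> t u) \<and> norm (U \<omega> t u) \<le> r * growth t \<omega>"
proof -
  have \<omega>s: "\<omega> \<in> space M" using \<omega> saturation_space by blast
  define d where "d = (\<kappa> \<omega>)\<^sup>2 - 1"
  have d: "0 \<le> d" unfolding d_def using kappa_ge[OF \<omega>s] by (simp add: one_le_power)
  have wC: "w \<omega> \<in> C - {0}" using w_cone[OF \<omega>] by blast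
  have "near C d (U \<omega> 1 u) (U \<omega> 1 (w \<omega>))" unfolding d_def by (rule U_near_one[OF \<omega>s u wC])
  then obtain l where l: "0 < l" "U \<omega> 1 u - l *\<^sub>R U \<omega> 1 (w \<omega>) \<in> C" "(l * (1 + d)) *\<^sub>R U \<omega> 1 (w \<omega>) - U \<omega> 1 u \<in> C"
    by (auto simp: near_def)
  have r: "0 < l * (1 + d)" using l d by simp
  have \<omega>1: "\<theta> 1 \<omega> \<in> space M" using \<omega>s by (intro flow_in_space) auto
  have "l * growth t \<omega> \<le> norm (U \<omega> t u) \<and> norm (U \<omega> t u) \<le> l * (1 + d) * growth t \<omega>"
    if t: "t \<in> T" "1 \<le> t" for t
  proof -
    have t1: "t - 1 \<in> nonneg_time T" using t by (intro nonneg_time_diff) auto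
    have split: "U \<omega> t x = U (\<theta> 1 \<omega>) (t - 1) (U \<omega> 1 x)" for x
      using \<omega>s t by (intro U_split) auto
    have g: "growth t \<omega> = norm (U (\<theta> 1 \<omega>) (t - 1) (U \<omega> 1 (w \<omega>)))"
      using t by (simp add: growth_nonneg_time split)
    have C1: "U \<omega> 1 u \<in> C" "U \<omega> 1 (w \<omega>) \<in> C" using U_cone[OF \<omega>s _, of 1] u wC by auto
    have "norm (U (\<theta> 1 \<omega>) (t - 1) (l *\<^sub>R U \<omega> 1 (w \<omega>))) \<le> norm (U \<omega> t u)"
      unfolding split using l C1 by (intro U_norm_mono[OF \<omega>1 t1] cone_scale) auto
    moreover have "norm (U \<omega> t u) \<le> norm (U (\<theta> 1 \<omega>) (t - 1) ((l * (1 + d)) *\<^sub>R U \<omega> 1 (w \<omega>)))"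
      unfolding split using l C1 by (intro U_norm_mono[OF \<omega>1 t1]) auto
    ultimately show ?thesis using l r d by (simp add: U_scale[OF \<omega>1 t1] g)
  qed
  with l(1) r show ?thesis by blast
qed

lemma cone_growth_le:
  assumes \<omega>: "\<omega> \<in> saturation G" and rate: "has_growth_rate \<omega>" and c: "exponent < ereal c" and u: "u \<in> C"
  shows "growth_le T (\<lambda>t. norm (U \<omega> t u)) c"
proof (cases "u = 0")
  case True
  have "U \<omega> t u = 0" if "t \<in> T" "0 \<le> t" for t
    unfolding True using \<omega> saturation_space that by (intro U_zero nonneg_timeI) auto
  then show ?thesis unfolding growth_le_def by (auto intro!: eventually_time_at_topI[of _ 0])
next
  case False
  with u have "u \<in> C - {0}" by simp
  then obtain l r where "0 < l" and r: "0 < r"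
    "\<And>t. t \<in> T \<Longrightarrow> 1 \<le> t \<Longrightarrow> l * growth t \<omega> \<le> norm (U \<omega> t u) \<and> norm (U \<omega> t u) \<le> r * growth t \<omega>"
    using cone_growth[OF \<omega>] by blast
  have "growth_le T (\<lambda>t. growth t \<omega>) c" using rate c by (simp add: has_growth_rate_def)
  then show ?thesis
    by (rule growth_le_cmult[where k = r]) (use r in \<open>auto intro: eventually_time_at_topI\<close>)
qed

lemma cone_growth_tendsto:
  assumes \<omega>: "\<omega> \<in> saturation G" and rate: "has_growth_rate \<omega>" and u: "u \<in> C - {0}"
  shows "((\<lambda>t. exp_rate t (norm (U \<omega> t u))) \<longlongrightarrow> exponent) (time_at_top T)"
proof -
  obtain l r where l: "0 < l" and "0 < r" and
    lr: "\<And>t. t \<in> T \<Longrightarrow> 1 \<le> t \<Longrightarrow> l * growth t \<omega> \<le> norm (U \<omega> t u) \<and> norm (U \<omega> t u) \<le> r * growth t \<omega>"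
    using cone_growth[OF \<omega> u] by blast
  have pos: "0 < l * growth t \<omega>" if "t \<in> T" for t using l growth_pos[OF \<omega> that] by simp
  show ?thesis
  proof (rule tendsto_exp_rate)
    fix c assume "exponent < ereal c"
    then show "growth_le T (\<lambda>t. norm (U \<omega> t u)) c" using u by (intro cone_growth_le[OF \<omega> rate]) auto
  next
    fix c assume "ereal c < exponent"
    then have "growth_le T (\<lambda>t. inverse (growth t \<omega>)) (- c)" using rate by (simp add: has_growth_rate_def)
    then show "growth_le T (\<lambda>t. inverse (norm (U \<omega> t u))) (- c)"
    proof (rule growth_le_cmult[where k = "inverse l"])
      show "eventually (\<lambda>t. inverse (norm (U \<omega> t u)) \<le> inverse l * inverse (growth t \<omega>)) (time_at_top T)"
      proof (rule eventually_time_at_topI[of _ 1])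
        fix t assume t: "t \<in> T" "1 \<le> t"
        have "inverse (norm (U \<omega> t u)) \<le> inverse (l * growth t \<omega>)"
          using lr[OF t] pos[OF t(1)] by (intro le_imp_inverse_le) auto
        then show "inverse (norm (U \<omega> t u)) \<le> inverse l * inverse (growth t \<omega>)" by simp
      qed
    qed (use l in simp)
  next
    show "eventually (\<lambda>t. 0 < norm (U \<omega> t u)) (time_at_top T)"
      by (rule eventually_time_at_topI[of _ 1]) (use lr pos in \<open>metis less_le_trans\<close>)
  qed
qed

section \<open>Iterated splitting into vectors of the cone\<close>

text \<open>Bounds the growth of a cone vector p relative to w, linearly in its norm. If b and c are
  the focusing multiples of e for p and w, then the image of p is at most \<kappa> * b / c times
  that of w, where b \<le> exp a * norm p and c is at least the norm of the image of w divided by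
  \<kappa>.\<close>

definition domination :: "'w \<Rightarrow> real" where
  "domination \<omega> = (\<kappa> \<omega>)\<^sup>2 * exp (a \<omega>) / norm (U \<omega> 1 (w \<omega>))"

lemma domination_measurable [measurable]: "domination \<in> borel_measurable M"
proof -
  have [measurable]: "(\<lambda>\<omega>. U \<omega> 1 (w \<omega>)) \<in> borel_measurable M" by (rule U_measurable) auto
  have [measurable]: "a \<in> borel_measurable M" using a by simp
  show ?thesis unfolding domination_def by measurable
qed

lemma norm_U_one_le:
  assumes "\<omega> \<in> G" "s \<in> T" "0 \<le> s" "s \<le> 1" shows "norm (U \<omega> s x) \<le> exp (a \<omega>) * norm x"
proof -
  have "norm (U \<omega> s x) \<le> onorm (U \<omega> s) * norm x"
    using assms G_space by (intro onorm semiflow_linear nonneg_timeI) auto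
  also have "\<dots> \<le> exp (a \<omega>) * norm x" using G_bound[OF assms] by (intro mult_right_mono) auto
  finally show ?thesis .
qed

lemma norm_U_cone_le:
  assumes \<omega>: "\<omega> \<in> G" and p: "p \<in> C"
  shows "norm (U \<omega> (real m) p) \<le> domination \<omega> * norm p * growth (real m) \<omega>"
proof -
  have \<omega>s: "\<omega> \<in> space M" and sat: "\<omega> \<in> saturation G" using \<omega> G_space G_subset_saturation by auto
  have \<omega>1: "\<theta> 1 \<omega> \<in> space M" using \<omega>s by (intro flow_in_space) auto
  have wC: "w \<omega> \<in> C - {0}" "norm (w \<omega>) = 1" using w_cone[OF sat] by auto
  have K: "1 \<le> \<kappa> \<omega>" by (rule kappa_ge[OF \<omega>s])
  define g where "g = norm (U \<omega> 1 (w \<omega>))"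
  have g: "0 < g" unfolding g_def using growth_pos[OF sat, of 1] by (simp add: growth_nonneg_time)
  have g_le: "g \<le> exp (a \<omega>)" unfolding g_def using norm_U_one_le[OF \<omega>, of 1 "w \<omega>"] wC by simp
  show ?thesis
  proof (cases "m = 0 \<or> p = 0")
    case True
    \<comment> \<open>At m = 0 there is no unit step to use; the claim reduces to
      \<open>1 \<le> domination \<omega>\<close>, which follows from \<kappa> \<ge> 1 and g \<le>
      exp a.\<close>
    have "1 \<le> (\<kappa> \<omega>)\<^sup>2 * (exp (a \<omega>) / g)"
      using mult_mono[of 1 "(\<kappa> \<omega>)\<^sup>2" 1 "exp (a \<omega>) / g"] K g g_le by (simp add: one_le_power)
    then have "norm p \<le> domination \<omega> * norm p"
      using mult_right_mono[of 1 "domination \<omega>" "norm p"] by (simp add: domination_def g_def)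
    with True show ?thesis
      by (auto simp: semiflow_zero[OF \<omega>s] growth_0[OF sat] U_zero[OF \<omega>s])
  next
    case False
    obtain b where b: "0 < b" "U \<omega> 1 p - b *\<^sub>R e \<in> C" "(\<kappa> \<omega> * b) *\<^sub>R e - U \<omega> 1 p \<in> C"
      using U_focus[OF \<omega>s, of p] False p by auto
    obtain c where c: "0 < c" "U \<omega> 1 (w \<omega>) - c *\<^sub>R e \<in> C" "(\<kappa> \<omega> * c) *\<^sub>R e - U \<omega> 1 (w \<omega>) \<in> C"
      using U_focus[OF \<omega>s wC(1)] by blast
    have C1: "U \<omega> 1 p \<in> C" "U \<omega> 1 (w \<omega>) \<in> C" using U_cone[OF \<omega>s _, of 1] p wC by auto
    have "norm (b *\<^sub>R e) \<le> norm (U \<omega> 1 p)" using b e by (intro norm_mono cone_scale) auto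
    then have b_le: "b \<le> exp (a \<omega>) * norm p"
      using norm_U_one_le[OF \<omega>, of 1 p] b e by simp
    have "g \<le> norm ((\<kappa> \<omega> * c) *\<^sub>R e)" unfolding g_def using c C1 by (intro norm_mono) auto
    then have g_c: "g \<le> \<kappa> \<omega> * c" using K c e by simp
    define q where "q = \<kappa> \<omega> * b / c"
    have q: "0 \<le> q" using K b c by (simp add: q_def)
    have "((\<kappa> \<omega> * b) *\<^sub>R e - U \<omega> 1 p) + q *\<^sub>R (U \<omega> 1 (w \<omega>) - c *\<^sub>R e) \<in> C"
      using b c q by (intro cone_add cone_scale)
    then have "q *\<^sub>R U \<omega> 1 (w \<omega>) - U \<omega> 1 p \<in> C" using c by (simp add: q_def scaleR_diff_right)
    moreover have m1: "real m - 1 \<in> nonneg_time T" using False by (intro nonneg_time_diff) auto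
    have split: "U \<omega> (real m) x = U (\<theta> 1 \<omega>) (real m - 1) (U \<omega> 1 x)" for x
      using \<omega>s False by (intro U_split) auto
    ultimately have "norm (U \<omega> (real m) p) \<le> norm (U (\<theta> 1 \<omega>) (real m - 1) (q *\<^sub>R U \<omega> 1 (w \<omega>)))"
      unfolding split using C1 by (intro U_norm_mono[OF \<omega>1 m1]) auto
    also have "\<dots> = q * growth (real m) \<omega>"
      using q by (simp add: U_scale[OF \<omega>1 m1] growth_nonneg_time split)
    also have "\<dots> \<le> domination \<omega> * norm p * growth (real m) \<omega>"
    proof (rule mult_right_mono)
      have "q = \<kappa> \<omega> * \<kappa> \<omega> * b / (\<kappa> \<omega> * c)" using K by (simp add: q_def)
      also have "\<dots> \<le> \<kappa> \<omega> * \<kappa> \<omega> * (exp (a \<omega>) * norm p) / g"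
        using K b_le g_c g b by (intro frac_le mult_left_mono mult_nonneg_nonneg) auto
      finally show "q \<le> domination \<omega> * norm p"
        by (simp add: domination_def g_def power2_eq_square)
    qed (use growth_pos[OF sat, of "real m"] in auto)
    finally show ?thesis .
  qed
qed

definition truncated_step :: "nat \<Rightarrow> 'w \<Rightarrow> real" where
  "truncated_step N \<omega> = max (log_step \<omega>) (- real N)"

text \<open>Increments are compared rather than sums, because a vector split off at time i only
  shares the growth of w after i.\<close>

lemma log_growth_diff_le:
  assumes \<omega>: "\<omega> \<in> G"
  shows "log_growth \<omega> (real (i + m)) - log_growth \<omega> (real i) \<le>
    birkhoff_sum (\<theta> 1) (truncated_step N) \<omega> (i + m) - birkhoff_sum (\<theta> 1) (truncated_step N) \<omega> i"
proof (induction m)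
  case (Suc m)
  have "log_growth \<omega> (real (i + Suc m)) - log_growth \<omega> (real (i + m)) = log_step ((\<theta> 1 ^^ (i + m)) \<omega>)"
    using birkhoff_log_step[OF \<omega>, of "i + Suc m"] birkhoff_log_step[OF \<omega>, of "i + m"]
    by (simp add: birkhoff_sum_Suc_right del: of_nat_add of_nat_Suc)
  also have "\<dots> \<le> truncated_step N ((\<theta> 1 ^^ (i + m)) \<omega>)" by (simp add: truncated_step_def)
  finally show ?case using Suc by (simp add: birkhoff_sum_Suc_right del: of_nat_add of_nat_Suc)
qed simp

lemma truncated_sum_ge: "- (real N * real n) \<le> birkhoff_sum \<tau> (truncated_step N) \<omega> n"
proof -
  have "(\<Sum>i<n. - real N) \<le> birkhoff_sum \<tau> (truncated_step N) \<omega> n"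
    unfolding birkhoff_sum_def by (intro sum_mono) (simp add: truncated_step_def)
  then show ?thesis by (simp add: mult.commute)
qed

text \<open>
  A set \<open>B\<close> of good base points is one where every vector \<open>U \<omega> 1 x\<close> is the difference of two vectors
  in the cone, of size at most \<open>K * norm x\<close>, up to an error \<open>exp (- L) * norm x\<close>. Splitting the
  error again at each later visit to \<open>B\<close> expresses \<open>U \<omega> n x\<close> through orbits of cone vectors.
\<close>

definition error_rate :: "'w set \<Rightarrow> real \<Rightarrow> 'w \<Rightarrow> real" where
  "error_rate B L \<omega> = (if \<omega> \<in> B then - L else a \<omega>)"

text \<open>z is the remainder not yet split, and y collects the orbits of the cone vectors split
  off so far. The bound on y is asked for all later m because y is only pushed forward. In the k-th
  term one K comes from the size of the pieces and one from domination, 2 counts the pieces p and q,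
  and the factor with N pays for counting \<open>Sf\<close> from time 0 instead of k + 1.\<close>

lemma iterated_splitting:
  fixes K L :: real and N :: nat
  assumes \<omega>: "\<omega> \<in> G" and K: "0 \<le> K"
    and split: "\<And>\<eta> x. \<eta> \<in> B \<Longrightarrow> \<eta> \<in> G \<Longrightarrow> \<exists>p\<in>C. \<exists>q\<in>C. \<exists>z. U \<eta> 1 x = p - q + z \<and>
       norm p \<le> K * norm x \<and> norm q \<le> K * norm x \<and> norm z \<le> exp (- L) * norm x"
    and dom: "\<And>\<eta>. \<eta> \<in> B \<Longrightarrow> \<eta> \<in> G \<Longrightarrow> domination (\<theta> 1 \<eta>) \<le> K"
  defines "Sa \<equiv> birkhoff_sum (\<theta> 1) (error_rate B L) \<omega>"
    and "Sf \<equiv> birkhoff_sum (\<theta> 1) (truncated_step N) \<omega>"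
  shows "\<exists>y z. U \<omega> (real n) x = y + z \<and> norm z \<le> exp (Sa n) * norm x \<and>
    (\<forall>m. norm (U (\<theta> (real n) \<omega>) (real m) y) \<le>
       (\<Sum>k<n. 2 * K\<^sup>2 * norm x * exp (Sa k + real N * real (Suc k))) * exp (Sf (n + m)))"
proof (induction n)
  case 0
  have "\<omega> \<in> space M" using \<omega> G_space by blast
  then show ?case by (intro exI[of _ 0] exI[of _ x]) (auto simp: semiflow_zero Sa_def flow_zero U_zero)
next
  case (Suc n)
  then obtain y z where y: "U \<omega> (real n) x = y + z" and z: "norm z \<le> exp (Sa n) * norm x"
    and ym: "\<And>m. norm (U (\<theta> (real n) \<omega>) (real m) y) \<le>
       (\<Sum>k<n. 2 * K\<^sup>2 * norm x * exp (Sa k + real N * real (Suc k))) * exp (Sf (n + m))"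
    by blast
  have \<omega>s: "\<omega> \<in> space M" using \<omega> G_space by blast
  define \<eta> where "\<eta> = \<theta> (real n) \<omega>"
  have \<eta>: "\<eta> \<in> G" using G(3)[OF \<omega>, of "int n"] by (simp add: \<eta>_def)
  have \<eta>s: "\<eta> \<in> space M" using \<eta> G_space by blast
  have \<eta>1: "\<theta> 1 \<eta> \<in> G" "\<theta> 1 \<eta> = \<theta> (real (Suc n)) \<omega>"
    using G(3)[OF \<eta>, of 1] flow_add'[of 1 "real n" \<omega>] \<omega>s by (auto simp: \<eta>_def)
  have \<eta>1s: "\<theta> 1 \<eta> \<in> space M" using \<eta>1 G_space by blast
  have U1: "U \<omega> (real (Suc n)) x = U \<eta> 1 y + U \<eta> 1 z"
    unfolding \<eta>_def using U_split[OF \<omega>s, of "real n" "real (Suc n)" x] y \<eta>s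
    by (simp add: U_add' \<eta>_def)
  have UU: "U (\<theta> 1 \<eta>) (real m) (U \<eta> 1 v) = U \<eta> (real (Suc m)) v" for m v
    using semiflow_add[OF \<eta>s, of 1 "real m" v] by (simp add: add.commute)
  have SaS: "Sa (Suc n) = Sa n + error_rate B L \<eta>"
    using flow_iterate[of 1 \<omega> n] \<omega>s by (simp add: Sa_def birkhoff_sum_Suc_right \<eta>_def)
  have Sfs: "Sf (n + Suc m) = Sf (Suc n + m)" for m by simp
  have pos: "0 \<le> 2 * K\<^sup>2 * norm x * exp (Sa n + real N * real (Suc n)) * exp (Sf (Suc n + m))" for m
    by simp
  show ?case
  proof (cases "\<eta> \<in> B")
    case False
    \<comment> \<open>Outside B nothing is split: the remainder grows by at most exp a, and the
      additional nonnegative term only weakens the bound on y.\<close>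
    have "norm (U \<eta> 1 z) \<le> exp (a \<eta>) * norm z" using \<eta> by (intro norm_U_one_le) auto
    also have "\<dots> \<le> exp (a \<eta>) * (exp (Sa n) * norm x)" using z by (intro mult_left_mono) auto
    also have "\<dots> = exp (Sa (Suc n)) * norm x"
      using False by (simp add: SaS error_rate_def exp_add)
    finally have 1: "norm (U \<eta> 1 z) \<le> exp (Sa (Suc n)) * norm x" .
    have 2: "norm (U (\<theta> (real (Suc n)) \<omega>) (real m) (U \<eta> 1 y)) \<le>
       (\<Sum>k<Suc n. 2 * K\<^sup>2 * norm x * exp (Sa k + real N * real (Suc k))) * exp (Sf (Suc n + m))" for m
      using ym[of "Suc m"] pos[of m]
      unfolding \<eta>1(2)[symmetric] UU Sfs \<eta>_def[symmetric] sum.lessThan_Suc distrib_right by linarith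
    show ?thesis using U1 1 2 by blast
  next
    case True
    obtain p q z' where p: "p \<in> C" and q: "q \<in> C" and s: "U \<eta> 1 z = p - q + z'"
      and le: "norm p \<le> K * norm z" "norm q \<le> K * norm z" "norm z' \<le> exp (- L) * norm z"
      using split[OF True \<eta>, of z] by blast
    have "norm z' \<le> exp (- L) * (exp (Sa n) * norm x)"
      using le(3) z by (meson exp_ge_zero mult_left_mono order_trans)
    also have "\<dots> = exp (Sa (Suc n)) * norm x"
      using True by (simp add: SaS error_rate_def exp_diff exp_minus field_simps)
    finally have 1: "norm z' \<le> exp (Sa (Suc n)) * norm x" .
    have cone: "norm (U (\<theta> 1 \<eta>) (real m) v) \<le>
        K\<^sup>2 * norm x * exp (Sa n + real N * real (Suc n)) * exp (Sf (Suc n + m))"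
      if v: "v \<in> C" "norm v \<le> K * norm z" for v m
    proof -
      have sat: "\<omega> \<in> saturation G" "\<theta> 1 \<eta> \<in> saturation G" using \<omega> \<eta>1 G_subset_saturation by auto
      have gr: "growth (real m) (\<theta> 1 \<eta>) \<le> exp (real N * real (Suc n)) * exp (Sf (Suc n + m))"
      proof -
        have "log_growth \<omega> (real m + real (Suc n)) = log_growth (\<theta> 1 \<eta>) (real m) + log_growth \<omega> (real (Suc n))"
          unfolding \<eta>1(2) by (rule log_growth_add[OF sat(1)]) (auto simp del: of_nat_Suc)
        then have "log_growth (\<theta> 1 \<eta>) (real m) = log_growth \<omega> (real (Suc n + m)) - log_growth \<omega> (real (Suc n))"
          by (simp add: add_ac)
        also have "\<dots> \<le> Sf (Suc n + m) - Sf (Suc n)"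
          unfolding Sf_def by (rule log_growth_diff_le[OF \<omega>])
        also have "\<dots> \<le> Sf (Suc n + m) + real N * real (Suc n)"
          using truncated_sum_ge[of N "Suc n" "\<theta> 1" \<omega>] unfolding Sf_def by linarith
        finally show ?thesis
          unfolding exp_add[symmetric] exp_log_growth[OF sat(2) time_of_nat, symmetric] exp_le_cancel_iff by simp
      qed
      have "norm (U (\<theta> 1 \<eta>) (real m) v) \<le> domination (\<theta> 1 \<eta>) * norm v * growth (real m) (\<theta> 1 \<eta>)"
        by (rule norm_U_cone_le[OF \<eta>1(1) v(1)])
      also have "\<dots> \<le> K * (K * (exp (Sa n) * norm x)) * (exp (real N * real (Suc n)) * exp (Sf (Suc n + m)))"
      proof (intro mult_mono gr)
        show "domination (\<theta> 1 \<eta>) \<le> K" by (rule dom[OF True \<eta>])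
        show "norm v \<le> K * (exp (Sa n) * norm x)"
          using v(2) z K by (meson mult_left_mono order_trans)
      qed (use K growth_pos[OF sat(2), of "real m"] in auto)
      finally show ?thesis by (simp add: exp_add power2_eq_square mult_ac)
    qed
    have 2: "norm (U (\<theta> (real (Suc n)) \<omega>) (real m) (U \<eta> 1 y + (p - q))) \<le>
       (\<Sum>k<Suc n. 2 * K\<^sup>2 * norm x * exp (Sa k + real N * real (Suc k))) * exp (Sf (Suc n + m))" for m
    proof -
      define S where "S = (\<Sum>k<n. 2 * K\<^sup>2 * norm x * exp (Sa k + real N * real (Suc k)))"
      define E where "E = K\<^sup>2 * norm x * exp (Sa n + real N * real (Suc n)) * exp (Sf (Suc n + m))"
      have sum: "U (\<theta> 1 \<eta>) (real m) (U \<eta> 1 y + (p - q)) =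
          U \<eta> (real (Suc m)) y + (U (\<theta> 1 \<eta>) (real m) p - U (\<theta> 1 \<eta>) (real m) q)"
        by (simp only: U_add'[OF \<eta>1s nonneg_time_simps(3)] U_diff'[OF \<eta>1s nonneg_time_simps(3)] UU)
      have "norm (U (\<theta> 1 \<eta>) (real m) (U \<eta> 1 y + (p - q))) \<le>
          norm (U \<eta> (real (Suc m)) y) + (norm (U (\<theta> 1 \<eta>) (real m) p) + norm (U (\<theta> 1 \<eta>) (real m) q))"
        unfolding sum
        using norm_triangle_ineq[of "U \<eta> (real (Suc m)) y" "U (\<theta> 1 \<eta>) (real m) p - U (\<theta> 1 \<eta>) (real m) q"]
          norm_triangle_ineq4[of "U (\<theta> 1 \<eta>) (real m) p" "U (\<theta> 1 \<eta>) (real m) q"] by linarith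
      also have "\<dots> \<le> S * exp (Sf (Suc n + m)) + (E + E)"
        using ym[of "Suc m"] cone[OF p le(1), of m] cone[OF q le(2), of m]
        unfolding Sfs \<eta>_def[symmetric] S_def[symmetric] E_def[symmetric] by (intro add_mono)
      also have "\<dots> = (S + 2 * K\<^sup>2 * norm x * exp (Sa n + real N * real (Suc n))) * exp (Sf (Suc n + m))"
        by (simp add: E_def algebra_simps)
      also have "\<dots> = (\<Sum>k<Suc n. 2 * K\<^sup>2 * norm x * exp (Sa k + real N * real (Suc k))) * exp (Sf (Suc n + m))"
        unfolding S_def by simp
      finally show ?thesis unfolding \<eta>1(2) .
    qed
    have "U \<omega> (real (Suc n)) x = (U \<eta> 1 y + (p - q)) + z'" using U1 s by simp
    with 1 2 show ?thesis by blast
  qed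
qed

text \<open>The remainder decays with slope 2 - L. The condition N + 2 \<le> L lets this beat the
  cost exp (N * k), so the terms of the sum stay bounded; 2 - c \<le> L brings the remainder itself
  below rate c.\<close>

lemma growth_le_of_splitting:
  fixes K L :: real
  assumes \<omega>: "\<omega> \<in> G" and K: "0 \<le> K"
    and split: "\<And>\<eta> x. \<eta> \<in> B \<Longrightarrow> \<eta> \<in> G \<Longrightarrow> \<exists>p\<in>C. \<exists>q\<in>C. \<exists>z. U \<eta> 1 x = p - q + z \<and>
       norm p \<le> K * norm x \<and> norm q \<le> K * norm x \<and> norm z \<le> exp (- L) * norm x"
    and dom: "\<And>\<eta>. \<eta> \<in> B \<Longrightarrow> \<eta> \<in> G \<Longrightarrow> domination (\<theta> 1 \<eta>) \<le> K"
    and rate_f: "rate_le (birkhoff_sum (\<theta> 1) (truncated_step N) \<omega>) c"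
    and rate_a: "rate_le (birkhoff_sum (\<theta> 1) (error_rate B L) \<omega>) (1 - L)"
    and L: "real N + 2 \<le> L" "2 - c \<le> L"
  shows "growth_le T (\<lambda>t. norm (U \<omega> t x)) c"
proof -
  have "growth_le T (\<lambda>t. norm (U \<omega> t x)) d" if d: "c < d" for d
  proof -
    define Sa where "Sa = birkhoff_sum (\<theta> 1) (error_rate B L) \<omega>"
    define Sf where "Sf = birkhoff_sum (\<theta> 1) (truncated_step N) \<omega>"
    obtain d' where d': "c < d'" "d' < d" using dense d by blast
    obtain Ra where Ra: "0 \<le> Ra" "\<And>n. Sa n \<le> Ra + (2 - L) * real n"
      using rate_le_bounded[OF rate_a, of "2 - L"] unfolding Sa_def by auto
    obtain Rf where Rf: "0 \<le> Rf" "\<And>n. Sf n \<le> Rf + d' * real n"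
      using rate_le_bounded[OF rate_f d'(1)] unfolding Sf_def by auto
    define R where "R = 2 * K\<^sup>2 * norm x * exp (Ra + real N)"
    have R: "0 \<le> R" by (simp add: R_def)
    define R' where "R' = R * exp Rf / (d - d') + exp Ra * norm x"
    have R': "0 \<le> R'" using R d' by (simp add: R'_def)
    have bound: "norm (U \<omega> (real n) x) \<le> R' * exp (d * real n)" for n
    proof -
      obtain y z where y: "U \<omega> (real n) x = y + z" and z: "norm z \<le> exp (Sa n) * norm x"
        and ym: "norm (U (\<theta> (real n) \<omega>) (real 0) y) \<le>
          (\<Sum>k<n. 2 * K\<^sup>2 * norm x * exp (Sa k + real N * real (Suc k))) * exp (Sf (n + 0))"
        using iterated_splitting[OF \<omega> K split dom, where x = x and n = n and N = N] unfolding Sa_def Sf_def by blast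
      have "\<theta> (real n) \<omega> \<in> space M" using \<omega> G_space by (intro flow_in_space) auto
      then have "norm y \<le> (\<Sum>k<n. 2 * K\<^sup>2 * norm x * exp (Sa k + real N * real (Suc k))) * exp (Sf n)"
        using ym by (simp add: semiflow_zero)
      also have "\<dots> \<le> (\<Sum>k<n. R) * exp (Rf + d' * real n)"
      proof (intro mult_mono sum_mono)
        fix k
        have "(real N + 2 - L) * real k \<le> 0" using L by (simp add: mult_nonpos_nonneg)
        then have "Sa k + real N * real (Suc k) \<le> Ra + real N"
          using Ra(2)[of k] by (simp add: algebra_simps)
        then show "2 * K\<^sup>2 * norm x * exp (Sa k + real N * real (Suc k)) \<le> R"
          unfolding R_def by (intro mult_left_mono) auto
      qed (use Rf R in \<open>auto intro: sum_nonneg\<close>)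
      also have "\<dots> = (real n * R) * exp Rf * exp (d' * real n)" by (simp add: exp_add)
      \<comment> \<open>The number n of terms is absorbed by the gap between the rates d' and
        d.\<close>
      also have "\<dots> \<le> (exp ((d - d') * real n) / (d - d') * R) * exp Rf * exp (d' * real n)"
      proof -
        have "(d - d') * real n \<le> exp ((d - d') * real n)"
          using exp_ge_add_one_self[of "(d - d') * real n"] by linarith
        then have "real n \<le> exp ((d - d') * real n) / (d - d')"
          using d' by (simp add: pos_le_divide_eq mult.commute)
        then show ?thesis using R by (intro mult_right_mono) auto
      qed
      also have "\<dots> = R * exp Rf / (d - d') * exp (d * real n)"
      proof -
        have "exp ((d - d') * real n) * exp (d' * real n) = exp (d * real n)"
          by (simp add: exp_add[symmetric] algebra_simps)
        then show ?thesis by (simp add: field_simps)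
      qed
      finally have 1: "norm y \<le> R * exp Rf / (d - d') * exp (d * real n)" .
      have "exp (Sa n) * norm x \<le> exp (Ra + d * real n) * norm x"
      proof (intro mult_right_mono)
        have "(2 - L) * real n \<le> d * real n" using L d by (intro mult_right_mono) auto
        then show "exp (Sa n) \<le> exp (Ra + d * real n)" using Ra(2)[of n] by simp
      qed simp
      with z have 2: "norm z \<le> exp Ra * norm x * exp (d * real n)" by (simp add: exp_add mult_ac)
      show ?thesis unfolding y R'_def distrib_right
        using 1 2 norm_triangle_ineq[of y z] by linarith
    qed
    show ?thesis
    \<comment> \<open>\<open>R' + 1\<close> replaces R', which may be 0, so that its logarithm can
      be used.\<close>
    proof (rule growth_le_interpolate[where x = "\<lambda>n. ln (R' + 1) + d * real n" and r = "\<lambda>n. a (\<theta> (real n) \<omega>)"])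
      show "rate_le (\<lambda>n. ln (R' + 1) + d * real n) d"
        by (rule rate_le_perturb[where x = "\<lambda>n. d * real n", OF _ lim_const_over_n[of "ln (R' + 1)"]])
          (auto simp: rate_le_def intro!: always_eventually mult_right_mono)
      show "(\<lambda>n. a (\<theta> (real n) \<omega>) / real n) \<longlonglongrightarrow> 0" by (rule G_tempered[OF \<omega>])
      fix n s assume s: "0 \<le> s" "s \<le> 1" "real n + s \<in> T"
      have sT: "s \<in> T" using time_diff[OF s(3) time_of_nat[of n]] by simp
      have \<eta>: "\<theta> (real n) \<omega> \<in> G" using G(3)[OF \<omega>, of "int n"] by simp
      have "U \<omega> (real n + s) x = U (\<theta> (real n) \<omega>) s (U \<omega> (real n) x)"
        using U_split[of \<omega> "real n" "real n + s" x] \<omega> G_space s by auto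
      then have "norm (U \<omega> (real n + s) x) \<le> exp (a (\<theta> (real n) \<omega>)) * norm (U \<omega> (real n) x)"
        using norm_U_one_le[OF \<eta> sT s(1,2)] by simp
      also have "\<dots> \<le> exp (a (\<theta> (real n) \<omega>)) * ((R' + 1) * exp (d * real n))"
      proof (rule mult_left_mono)
        have "R' * exp (d * real n) \<le> (R' + 1) * exp (d * real n)" by (intro mult_right_mono) auto
        with bound[of n] show "norm (U \<omega> (real n) x) \<le> (R' + 1) * exp (d * real n)" by linarith
      qed simp
      also have "\<dots> = exp (ln (R' + 1) + d * real n + a (\<theta> (real n) \<omega>))"
        using R' by (simp add: exp_add)
      finally show "norm (U \<omega> (real n + s) x) \<le> exp (ln (R' + 1) + d * real n + a (\<theta> (real n) \<omega>))" .
    qed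
  qed
  then show ?thesis unfolding growth_le_def by (meson dense)
qed

end

lemma infdist_lessE:
  assumes "infdist x A < r" "A \<noteq> {}"
  obtains y where "y \<in> A" "dist x y < r"
  using assms by (auto simp: infdist_def cINF_less_iff)

context regular_flow
begin

section \<open>Good base points from compactness and totality\<close>

definition spread :: "real \<Rightarrow> 'x set" where
  "spread K = {p - q | p q. p \<in> C \<and> q \<in> C \<and> norm p \<le> K \<and> norm q \<le> K}"

text \<open>Testing on a sequence of vectors keeps the set measurable. Radius 2 leaves an open
  neighbourhood of the unit sphere for the density argument, and exp (- L) / 2 leaves room for a
  strict bound by exp (- L) on all unit vectors.\<close>

definition good_base :: "(nat \<Rightarrow> 'x) \<Rightarrow> real \<Rightarrow> real \<Rightarrow> 'w set" where
  "good_base d K L = {\<omega> \<in> space M.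
     (\<forall>n. norm (d n) < 2 \<longrightarrow> infdist (U \<omega> 1 (d n)) (spread K) \<le> exp (- L) / 2) \<and>
     domination (\<theta> 1 \<omega>) \<le> K}"

lemma good_base_measurable: "good_base d K L \<in> sets M"
proof -
  have [measurable]: "\<theta> 1 \<in> M \<rightarrow>\<^sub>M M" by (intro flow_map_measurable) simp
  have [measurable]: "(\<lambda>\<omega>. infdist (U \<omega> 1 x) (spread K)) \<in> borel_measurable M" for x
  proof (rule measurable_compose[where f = "\<lambda>\<omega>. U \<omega> 1 x" and g = "\<lambda>y. infdist y (spread K)"])
    show "(\<lambda>\<omega>. U \<omega> 1 x) \<in> borel_measurable M" by (rule U_measurable) auto
    show "(\<lambda>y. infdist y (spread K)) \<in> borel_measurable borel"
      by (intro borel_measurable_continuous_onI continuous_intros)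
  qed
  show ?thesis unfolding good_base_def by measurable
qed

lemma zero_in_spread: "0 \<le> K \<Longrightarrow> 0 \<in> spread K"
  unfolding spread_def using cone_0 by (auto intro!: exI[of _ 0])

text \<open>Continuity extends the distance bound from the dense sequence to unit vectors, and
  homogeneity to all vectors; a point of \<open>spread K\<close> closer than exp (- L) supplies p
  and q.\<close>

lemma good_base_splitting:
  assumes dense: "\<And>X. open X \<Longrightarrow> X \<noteq> {} \<Longrightarrow> \<exists>n. d n \<in> X"
    and \<eta>: "\<eta> \<in> good_base d K L" and K: "0 \<le> K"
  shows "\<exists>p\<in>C. \<exists>q\<in>C. \<exists>z. U \<eta> 1 x = p - q + z \<and>
    norm p \<le> K * norm x \<and> norm q \<le> K * norm x \<and> norm z \<le> exp (- L) * norm x"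
proof (cases "x = 0")
  case True
  have "\<eta> \<in> space M" using \<eta> by (simp add: good_base_def)
  with True show ?thesis using cone_0 by (intro bexI[of _ 0] exI[of _ 0]) (auto simp: U_zero)
next
  case False
  have \<eta>s: "\<eta> \<in> space M" using \<eta> by (simp add: good_base_def)
  define r where "r = norm x"
  have r: "0 < r" using False by (simp add: r_def)
  define y where "y = (1 / r) *\<^sub>R x"
  have y: "norm y = 1" using r by (simp add: y_def r_def)
  define h where "h v = infdist (U \<eta> 1 v) (spread K)" for v
  have hc: "continuous_on UNIV h" unfolding h_def
    by (intro continuous_on_infdist linear_continuous_on semiflow_linear \<eta>s) auto
  have "h y \<le> exp (- L) / 2"
  proof (rule ccontr)
    assume not: "\<not> ?thesis"
    define W where "W = ball 0 2 \<inter> {v. exp (- L) / 2 < h v}"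
    have "open W"
      unfolding W_def by (intro open_Int open_ball open_Collect_less hc continuous_intros)
    moreover have "y \<in> W" using not y by (simp add: W_def)
    ultimately obtain n where "d n \<in> W" using dense[of W] by blast
    then have "norm (d n) < 2" "exp (- L) / 2 < infdist (U \<eta> 1 (d n)) (spread K)"
      by (simp_all add: W_def h_def)
    moreover have "infdist (U \<eta> 1 (d n)) (spread K) \<le> exp (- L) / 2" if "norm (d n) < 2"
      using \<eta> that unfolding good_base_def by blast
    ultimately show False by linarith
  qed
  also have "\<dots> < exp (- L)" by simp
  finally obtain s where s: "s \<in> spread K" "dist (U \<eta> 1 y) s < exp (- L)"
    using infdist_lessE[of "U \<eta> 1 y" "spread K" "exp (- L)"] zero_in_spread[OF K] by (auto simp: h_def)
  then obtain p q where pq: "s = p - q" "p \<in> C" "q \<in> C" "norm p \<le> K" "norm q \<le> K"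
    by (auto simp: spread_def)
  have x: "x = r *\<^sub>R y" using r by (simp add: y_def)
  have "U \<eta> 1 x = r *\<^sub>R p - r *\<^sub>R q + r *\<^sub>R (U \<eta> 1 y - s)"
    unfolding x U_scale[OF \<eta>s nonneg_time_simps(2)] pq(1) by (simp add: algebra_simps)
  moreover have "norm (r *\<^sub>R (U \<eta> 1 y - s)) \<le> exp (- L) * norm x"
    using s(2) r by (simp add: dist_norm r_def mult.commute)
  moreover have "norm (r *\<^sub>R p) \<le> K * norm x" "norm (r *\<^sub>R q) \<le> K * norm x"
    using pq r by (auto simp: r_def mult.commute)
  moreover have "r *\<^sub>R p \<in> C" "r *\<^sub>R q \<in> C" using pq r by (auto intro: cone_scale)
  ultimately show ?thesis by blast
qed

text \<open>By totality the neighbourhoods of fixed width of the sets \<open>spread K\<close> cover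
  the space, and by compactness finitely many cover the image of the ball. They increase with K, so
  every large K works alone.\<close>

lemma eventually_good_base:
  assumes total: "total_cone C" and \<omega>: "\<omega> \<in> space M"
    and compact: "\<forall>B. bounded B \<longrightarrow> compact (closure (U \<omega> 1 ` B))"
  shows "eventually (\<lambda>K. \<omega> \<in> good_base d (real K) L) sequentially"
proof -
  define O' where "O' K = {y. infdist y (spread (real K)) < exp (- L) / 2}" for K :: nat
  have mono: "O' m \<subseteq> O' n" if "m \<le> n" for m n
  proof -
    have "spread (real m) \<subseteq> spread (real n)" "spread (real m) \<noteq> {}"
      using that zero_in_spread[of "real m"] unfolding spread_def by (fastforce, auto)
    then have le: "infdist y (spread (real n)) \<le> infdist y (spread (real m))" for y
      by (rule infdist_mono)
    show ?thesis
      unfolding O'_def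
    proof (intro subsetI CollectI, elim CollectE)
      fix y assume "infdist y (spread (real m)) < exp (- L) / 2"
      with le[of y] show "infdist y (spread (real n)) < exp (- L) / 2" by linarith
    qed
  qed
  have "compact (closure (U \<omega> 1 ` ball 0 2))" using compact by simp
  moreover have "open (O' K)" for K
    unfolding O'_def by (intro open_Collect_less continuous_intros)
  moreover have "closure (U \<omega> 1 ` ball 0 2) \<subseteq> (\<Union>K\<in>UNIV. O' K)"
  proof
    fix y
    have "y \<in> closure {u - v | u v. u \<in> C \<and> v \<in> C}" using total by (simp add: total_cone_def)
    moreover have "0 < exp (- L) / 2" by simp
    ultimately obtain u v where uv: "u \<in> C" "v \<in> C" "dist (u - v) y < exp (- L) / 2"
      unfolding closure_approachable by blast
    obtain K :: nat where "max (norm u) (norm v) \<le> real K" using real_arch_simple by blast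
    then have "u - v \<in> spread (real K)" using uv by (auto simp: spread_def)
    then have "infdist y (spread (real K)) \<le> dist y (u - v)" by (rule infdist_le)
    then have "y \<in> O' K" using uv by (simp add: O'_def dist_commute)
    then show "y \<in> (\<Union>K\<in>UNIV. O' K)" by blast
  qed
  ultimately obtain J where J: "finite J" "closure (U \<omega> 1 ` ball 0 2) \<subseteq> (\<Union>K\<in>J. O' K)"
    by (rule compactE_image) auto
  obtain K0 :: nat where K0: "domination (\<theta> 1 \<omega>) \<le> real K0" using real_arch_simple by blast
  have "eventually (\<lambda>K. Max (insert K0 J) \<le> K) sequentially" by (rule eventually_ge_at_top)
  then show ?thesis
  proof eventually_elim
    case (elim K)
    then have le: "\<And>j. j \<in> insert K0 J \<Longrightarrow> j \<le> K" using J(1) by auto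
    have "infdist (U \<omega> 1 x) (spread (real K)) \<le> exp (- L) / 2" if "norm x < 2" for x
    proof -
      have "U \<omega> 1 x \<in> closure (U \<omega> 1 ` ball 0 2)"
        using that by (intro subsetD[OF closure_subset]) auto
      then obtain j where "j \<in> J" "U \<omega> 1 x \<in> O' j" using J by blast
      then have "U \<omega> 1 x \<in> O' K" using mono[of j K] le by blast
      then show ?thesis by (simp add: O'_def)
    qed
    moreover have "domination (\<theta> 1 \<omega>) \<le> real K" using K0 le[of K0] by simp
    ultimately show ?case using \<omega> by (simp add: good_base_def)
  qed
qed

section \<open>Domination of all vectors by w\<close>

definition dominated :: "'w \<Rightarrow> bool" where
  "dominated \<omega> \<longleftrightarrow> (\<forall>x c. exponent < ereal c \<longrightarrow> growth_le T (\<lambda>t. norm (U \<omega> t x)) c)"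

lemma AE_dominated:
  assumes compact: "compact_semiflow M U" and total: "total_cone C"
  shows "AE \<omega> in M. dominated \<omega>"
proof -
  interpret fwd: measure_preserving_map M "\<theta> 1" by (rule measure_preserving_flow) simp
  obtain D :: "'x set" where D: "countable D" "\<And>X. open X \<Longrightarrow> X \<noteq> {} \<Longrightarrow> \<exists>d\<in>D. d \<in> X"
    using countable_dense_exists by blast
  have D0: "D \<noteq> {}" using D(2)[of UNIV] by auto
  define d where "d = from_nat_into D"
  have dense: "\<exists>n. d n \<in> X" if "open X" "X \<noteq> {}" for X
    using D(2)[OF that] range_from_nat_into[OF D0 D(1)] unfolding d_def by (metis imageE)
  have [measurable]: "a \<in> borel_measurable M" using a by simp
  have [measurable]: "error_rate (good_base d (real K) (real L)) (real L) \<in> borel_measurable M" for K L :: nat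
    unfolding error_rate_def using good_base_measurable by measurable
  \<comment> \<open>For fixed L almost every point is good for all large K, so
    \<open>error_rate\<close> tends to -L under an integrable bound. The target 1 - L leaves one
    unit of slack.\<close>
  have "AE \<omega> in M. \<exists>K::nat. rate_le (birkhoff_sum (\<theta> 1) (error_rate (good_base d (real K) (real L)) (real L)) \<omega>) (1 - real L)"
    for L :: nat
  proof (rule fwd.AE_ex_rate_le_of_tendsto[where b = "\<lambda>\<omega>. a \<omega> + real L" and l = "- real L"])
    show "integrable M (\<lambda>\<omega>. a \<omega> + real L)" using a by simp
    show "AE \<omega> in M. \<bar>error_rate (good_base d (real K) (real L)) (real L) \<omega>\<bar> \<le> a \<omega> + real L" for K
      using a(2) by (auto simp: error_rate_def abs_of_nonneg)
    show "AE \<omega> in M. (\<lambda>K. error_rate (good_base d (real K) (real L)) (real L) \<omega>) \<longlonglongrightarrow> - real L"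
      using AE_space compact[unfolded compact_semiflow_def]
    proof eventually_elim
      case (elim \<omega>)
      have "eventually (\<lambda>K. \<omega> \<in> good_base d (real K) (real L)) sequentially"
        by (rule eventually_good_base[OF total elim])
      then have "eventually (\<lambda>K. error_rate (good_base d (real K) (real L)) (real L) \<omega> = - real L) sequentially"
        by eventually_elim (simp add: error_rate_def)
      then show ?case by (rule tendsto_eventually)
    qed
  qed auto
  then have rate_a: "AE \<omega> in M. \<forall>L::nat. \<exists>K::nat.
      rate_le (birkhoff_sum (\<theta> 1) (error_rate (good_base d (real K) (real L)) (real L)) \<omega>) (1 - real L)"
    unfolding AE_all_countable by blast
  have up: "AE \<omega> in M. \<forall>c. exponent < ereal c \<longrightarrow> rate_le (birkhoff_sum (\<theta> 1) log_step \<omega>) c"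
    using AE_G AE_rates_forward
  proof eventually_elim
    case (elim \<omega>)
    then have "birkhoff_sum (\<theta> 1) log_step \<omega> = (\<lambda>n. log_growth \<omega> (real n))"
      using birkhoff_log_step by auto
    with elim show ?case by simp
  qed
  have "AE \<omega> in M. \<forall>c. exponent < ereal c \<longrightarrow>
      (\<exists>N. rate_le (birkhoff_sum (\<theta> 1) (truncated_step N) \<omega>) c)"
    unfolding truncated_step_def[abs_def]
    by (rule fwd.AE_rate_le_truncation[OF log_step_measurable log_step_fin up])
  with AE_G rate_a show ?thesis
  proof eventually_elim
    case (elim \<omega>)
    show ?case
      unfolding dominated_def
    proof (intro allI impI)
      fix x c assume "exponent < ereal c"
      \<comment> \<open>The order of choices matters: c fixes the truncation N, L is then taken
        large against N and c, and K is found last. This is harmless because K affects constants but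
        not the rate.\<close>
      then obtain N where N: "rate_le (birkhoff_sum (\<theta> 1) (truncated_step N) \<omega>) c" using elim by blast
      obtain L :: nat where L: "max (real N + 2) (2 - c) \<le> real L" using real_arch_simple by blast
      obtain K :: nat where K: "rate_le (birkhoff_sum (\<theta> 1)
          (error_rate (good_base d (real K) (real L)) (real L)) \<omega>) (1 - real L)"
        using elim by blast
      show "growth_le T (\<lambda>t. norm (U \<omega> t x)) c"
      proof (rule growth_le_of_splitting[OF _ _ _ _ N K])
        show "\<exists>p\<in>C. \<exists>q\<in>C. \<exists>z. U \<eta> 1 x = p - q + z \<and> norm p \<le> real K * norm x \<and>
            norm q \<le> real K * norm x \<and> norm z \<le> exp (- real L) * norm x"
          if "\<eta> \<in> good_base d (real K) (real L)" for \<eta> x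
          by (rule good_base_splitting[OF dense that]) auto
        show "domination (\<theta> 1 \<eta>) \<le> real K" if "\<eta> \<in> good_base d (real K) (real L)" for \<eta>
          using that by (simp add: good_base_def)
      qed (use elim L in auto)
    qed
  qed
qed

text \<open>After the time h the orbit sits over an integer translate of \<omega>, where
  \<open>U \<eta> h x\<close> is dominated; only the time is shifted by h.\<close>

lemma dominated_flow:
  assumes \<omega>: "\<omega> \<in> space M" and dom: "\<And>k::int. dominated (\<theta> (of_int k) \<omega>)" and s: "s \<in> T"
  shows "dominated (\<theta> s \<omega>)"
  unfolding dominated_def
proof (intro allI impI)
  fix x c assume c: "exponent < ereal c"
  define h where "h = of_int \<lceil>s\<rceil> - s"
  have h: "h \<in> T" "0 \<le> h" unfolding h_def using s by (auto intro: time_diff)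
  define \<eta> where "\<eta> = \<theta> s \<omega>"
  have \<eta>: "\<eta> \<in> space M" unfolding \<eta>_def using \<omega> s by (intro flow_in_space)
  have \<eta>h: "\<theta> h \<eta> = \<theta> (of_int \<lceil>s\<rceil>) \<omega>" unfolding \<eta>_def using flow_add'[OF h(1) s \<omega>] by (simp add: h_def)
  have "growth_le T (\<lambda>t. norm (U (\<theta> h \<eta>) t (U \<eta> h x))) c"
    unfolding \<eta>h using dom c by (simp add: dominated_def)
  then have "growth_le T (\<lambda>t. norm (U \<eta> t x)) c"
  proof (rule growth_le_shift[where s = "- h" and k = 1])
    show "t + - h \<in> T" if "t \<in> T" for t using that h time_diff by simp
    show "eventually (\<lambda>t. norm (U \<eta> t x) \<le> 1 * norm (U (\<theta> h \<eta>) (t + - h) (U \<eta> h x))) (time_at_top T)"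
      by (rule eventually_time_at_topI[of _ h]) (use U_split[OF \<eta> nonneg_timeI[OF h], of _ x] in simp)
  qed simp
  then show "growth_le T (\<lambda>t. norm (U (\<theta> s \<omega>) t x)) c" by (simp add: \<eta>_def)
qed

lemma reproducing_dominated:
  assumes \<omega>: "\<omega> \<in> saturation G" and rate: "has_growth_rate \<omega>"
    and repr: "\<And>x. \<exists>u\<in>C. \<exists>v\<in>C. x = u - v"
  shows "dominated \<omega>"
  unfolding dominated_def
proof (intro allI impI)
  fix x c assume c: "exponent < ereal c"
  obtain u v where uv: "u \<in> C" "v \<in> C" "x = u - v" using repr by blast
  have "growth_le T (\<lambda>t. norm (U \<omega> t u) + norm (U \<omega> t v)) c"
    by (intro growth_le_add cone_growth_le[OF \<omega> rate c] uv)
  then show "growth_le T (\<lambda>t. norm (U \<omega> t x)) c"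
  proof (rule growth_le_cmult[where k = 1])
    have "norm (U \<omega> t x) \<le> 1 * (norm (U \<omega> t u) + norm (U \<omega> t v))" if "t \<in> T" "0 \<le> t" for t
    proof -
      have "U \<omega> t x = U \<omega> t u - U \<omega> t v"
        unfolding uv(3) using \<omega> saturation_space that by (intro U_diff' nonneg_timeI) auto
      then show ?thesis using norm_triangle_ineq4[of "U \<omega> t u" "U \<omega> t v"] by simp
    qed
    then show "eventually (\<lambda>t. norm (U \<omega> t x) \<le> 1 * (norm (U \<omega> t u) + norm (U \<omega> t v))) (time_at_top T)"
      by (intro eventually_time_at_topI[of _ 0])
  qed simp
qed

lemma dominated_Limsup:
  "dominated \<omega> \<Longrightarrow> Limsup (time_at_top T) (\<lambda>t. exp_rate t (norm (U \<omega> t x))) \<le> exponent"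
  by (rule Limsup_exp_rate_le) (simp add: dominated_def)

section \<open>Floquet subspaces, entire orbits and the integral formula\<close>

lemma span_scaleR_singleton: "c \<noteq> 0 \<Longrightarrow> span {c *\<^sub>R y} = span {y::'x}"
  using span_image_scale[of "{y}" "\<lambda>_. c"] by simp

lemma U_span_w:
  assumes \<omega>: "\<omega> \<in> saturation G" and t: "t \<in> nonneg_time T"
  shows "U \<omega> t ` span {w \<omega>} = span {w (\<theta> t \<omega>)}"
proof -
  have \<omega>s: "\<omega> \<in> space M" using \<omega> saturation_space by blast
  have "U \<omega> t ` span {w \<omega>} = span (U \<omega> t ` {w \<omega>})"
    by (rule linear_span_image[symmetric]) (rule bounded_linear.linear[OF semiflow_linear[OF \<omega>s t]])
  also have "\<dots> = span {sgn (U \<omega> t (w \<omega>))}"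
    using U_cone_nonzero[OF \<omega>s t, of "w \<omega>"] w_cone[OF \<omega>]
    by (simp add: sgn_div_norm span_scaleR_singleton)
  finally show ?thesis using w_flow[OF \<omega> t] by simp
qed

lemma principal_floquet:
  assumes full: "full_invariant_set M T \<theta> \<Omega>" and sub: "\<Omega> \<subseteq> saturation G"
    and rate: "\<And>\<omega>. \<omega> \<in> \<Omega> \<Longrightarrow> has_growth_rate \<omega>" and dom: "\<And>\<omega>. \<omega> \<in> \<Omega> \<Longrightarrow> dominated \<omega>"
  shows "principal_floquet_subspaces M T \<theta> U C \<Omega> (\<lambda>\<omega>. span {w \<omega>})"
  unfolding principal_floquet_subspaces_def
proof (intro conjI exI[of _ w] exI[of _ exponent] ballI allI impI full)
  show "w \<in> restrict_space M \<Omega> \<rightarrow>\<^sub>M borel" by (rule measurable_restrict_space1) measurable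
  show "exponent < \<infinity>" unfolding exponent_def
    by (rule extended_integral_less_top[OF log_step_measurable log_step_fin])
  fix \<omega> assume \<omega>: "\<omega> \<in> \<Omega>"
  then have sat: "\<omega> \<in> saturation G" using sub by blast
  show "w \<omega> \<in> C - {0}" using w_cone[OF sat] by blast
  show "span {w \<omega>} = span {w \<omega>}" ..
  show "((\<lambda>t. exp_rate t (norm (U \<omega> t (w \<omega>)))) \<longlongrightarrow> exponent) (time_at_top T)"
    using w_cone[OF sat] by (intro cone_growth_tendsto[OF sat rate[OF \<omega>]]) auto
  show "U \<omega> t ` span {w \<omega>} = span {w (\<theta> t \<omega>)}" if "t \<in> nonneg_time T" for t
    by (rule U_span_w[OF sat that])
  show "Limsup (time_at_top T) (\<lambda>t. exp_rate t (norm (U \<omega> t u))) \<le> exponent" for u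
    by (rule dominated_Limsup[OF dom[OF \<omega>]])
qed

lemma entire_orbit_principal:
  assumes \<omega>: "\<omega> \<in> saturation G" and v: "\<And>t. t \<in> T \<Longrightarrow> v t \<in> C - {0}" and orbit: "entire_orbit T \<theta> U \<omega> v"
    and t: "t \<in> T"
  shows "v t = norm (v 0) *\<^sub>R principal_orbit \<theta> U w \<omega> t"
proof -
  have \<omega>s: "\<omega> \<in> space M" using \<omega> saturation_space by blast
  have step: "v (s + r) = U (\<theta> s \<omega>) r (v s)" if "s \<in> T" "r \<in> nonneg_time T" for s r
    using orbit that by (simp add: entire_orbit_def)
  \<comment> \<open>\<open>v s\<close> has preimages in the cone at all earlier integer distances,
    which confines it to the ray of w over that point.\<close>
  have line: "v s = norm (v s) *\<^sub>R w (\<theta> s \<omega>)" if s: "s \<in> T" for s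
  proof (rule principal_orbit_unique[OF principal_w[OF saturation_flow[OF \<omega> s]] v[OF s]])
    fix n :: nat
    have sn: "s - real n \<in> T" using s by (intro time_diff) auto
    have "v (s - real n + real n) = U (\<theta> (s - real n) \<omega>) (real n) (v (s - real n))"
      by (rule step[OF sn]) simp
    moreover have "\<theta> (- real n) (\<theta> s \<omega>) = \<theta> (s - real n) \<omega>"
      using flow_add'[OF time_simps(2) s \<omega>s, of n] by simp
    ultimately have "v s = U (\<theta> (- real n) (\<theta> s \<omega>)) (real n) (v (s - real n))" by simp
    with v[OF sn] show "\<exists>u\<in>C - {0}. v s = U (\<theta> (- real n) (\<theta> s \<omega>)) (real n) u" by blast
  qed
  have v0: "v 0 = norm (v 0) *\<^sub>R w \<omega>" "norm (v 0) \<noteq> 0"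
    using line[of 0] v[of 0] \<omega>s by (auto simp: flow_zero)
  show ?thesis
  proof (cases "0 \<le> t")
    case True
    then have "v (0 + t) = U (\<theta> 0 \<omega>) t (v 0)" using t by (intro step nonneg_timeI) auto
    also have "\<dots> = norm (v 0) *\<^sub>R U \<omega> t (w \<omega>)"
      using True t by (subst v0(1)) (simp add: flow_zero[OF \<omega>s] U_scale[OF \<omega>s nonneg_timeI])
    finally show ?thesis using True by (simp add: principal_orbit_def)
  next
    case False
    define \<eta> where "\<eta> = \<theta> t \<omega>"
    have \<eta>: "\<eta> \<in> saturation G" unfolding \<eta>_def by (rule saturation_flow[OF \<omega> t])
    have \<eta>s: "\<eta> \<in> space M" using \<eta> saturation_space by blast
    have nt: "- t \<in> nonneg_time T" using False t by (intro nonneg_timeI time_minus) auto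
    have Uw: "U \<eta> (- t) (w \<eta>) \<in> C - {0}" using w_cone[OF \<eta>] by (intro U_cone_nonzero \<eta>s nt) auto
    \<comment> \<open>Injectivity on the line lets \<open>inv_into\<close> be evaluated at
      \<open>w \<omega>\<close> by exhibiting a preimage.\<close>
    have inj: "inj_on (U \<eta> (- t)) (span {w \<eta>})"
      using Uw by (auto simp: inj_on_def span_singleton U_scale[OF \<eta>s nt])
    have "v 0 = U \<eta> (- t) (v t)" using step[OF t nt] by (simp add: \<eta>_def)
    then have "U \<eta> (- t) ((1 / norm (v 0)) *\<^sub>R v t) = (1 / norm (v 0)) *\<^sub>R v 0"
      by (simp add: U_scale[OF \<eta>s nt])
    also have "\<dots> = w \<omega>" using v0 by (metis (no_types) divide_self_if one_divide_eq_0_iff scaleR_one scaleR_scaleR times_divide_eq_left mult_1)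
    finally have im: "U \<eta> (- t) ((1 / norm (v 0)) *\<^sub>R v t) = w \<omega>" .
    have "(1 / norm (v 0)) *\<^sub>R v t \<in> span {w \<eta>}"
      using line[OF t] by (metis \<eta>_def insertI1 span_base span_scale)
    then have "inv_into (span {w \<eta>}) (U \<eta> (- t)) (w \<omega>) = (1 / norm (v 0)) *\<^sub>R v t"
      using im by (intro inv_into_f_eq inj)
    then show ?thesis using False v0(2) by (simp add: principal_orbit_def \<eta>_def)
  qed
qed

lemma extended_integral_growth:
  assumes full: "full_invariant_set M T \<theta> \<Omega>" and sub: "\<Omega> \<subseteq> saturation G"
  shows "has_extended_integral (restrict_space M \<Omega>) (\<lambda>\<omega>. eln (growth 1 \<omega>)) exponent"
proof -
  have \<Omega>: "\<Omega> \<in> sets M" "prob \<Omega> = 1" using full by (auto simp: full_invariant_set_def)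
  have \<Omega>s: "\<Omega> \<subseteq> space M" by (rule sets.sets_into_space[OF \<Omega>(1)])
  have [measurable]: "(\<lambda>\<omega>. U \<omega> 1 (w \<omega>)) \<in> borel_measurable M" by (rule U_measurable) auto
  have eq: "eln (growth 1 \<omega>) = ereal (ln (norm (U \<omega> 1 (w \<omega>))))" if "\<omega> \<in> \<Omega>" for \<omega>
    using growth_pos[of \<omega> 1] that sub by (auto simp: eln_def growth_nonneg_time)
  have "(\<lambda>\<omega>. ereal (ln (norm (U \<omega> 1 (w \<omega>))))) \<in> borel_measurable (restrict_space M \<Omega>)"
    by (rule measurable_restrict_space1) measurable
  then have meas: "(\<lambda>\<omega>. eln (growth 1 \<omega>)) \<in> borel_measurable (restrict_space M \<Omega>)"
    by (rule measurable_cong[THEN iffD1, rotated]) (use eq in \<open>auto simp: space_restrict_space\<close>)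
  have ae: "AE \<omega> in M. \<omega> \<in> \<Omega>" using \<Omega> by (simp add: AE_in_set_eq_1)
  \<comment> \<open>F and H cover positive and negative part at once. Both \<Omega> and G have full
    measure, so neither the restriction nor the indicator in \<open>log_step\<close> changes the
    integral.\<close>
  have int: "(\<integral>\<^sup>+\<omega>. e2ennreal (F (eln (growth 1 \<omega>))) \<partial>restrict_space M \<Omega>) = (\<integral>\<^sup>+\<omega>. ennreal (H (log_step \<omega>)) \<partial>M)"
    if F: "\<And>r. F (ereal r) = ereal (H r)" for F H
  proof -
    have "(\<integral>\<^sup>+\<omega>. e2ennreal (F (eln (growth 1 \<omega>))) \<partial>restrict_space M \<Omega>) =
        (\<integral>\<^sup>+\<omega>. e2ennreal (F (eln (growth 1 \<omega>))) * indicator \<Omega> \<omega> \<partial>M)"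
      using \<Omega> \<Omega>s by (intro nn_integral_restrict_space) (simp add: Int_absorb2)
    also have "\<dots> = (\<integral>\<^sup>+\<omega>. ennreal (H (log_step \<omega>)) \<partial>M)"
      using ae AE_G by (intro nn_integral_cong_AE, eventually_elim) (simp add: eq F log_step_def)
    finally show ?thesis .
  qed
  show ?thesis
    unfolding has_extended_integral_def exponent_def extended_integral_def
    using meas int[of "\<lambda>x. x" "\<lambda>x. x"] int[of uminus uminus] log_step_fin by simp
qed

end

section \<open>The Oseledets alternative\<close>

text \<open>If v is at distance r > 0 from S, the coefficient of v in a vector x of the span is at
  most norm x / r. Along a convergent sequence these coefficients are Cauchy, so the parts in S
  converge too.\<close>

lemma closed_span_insert:
  fixes S :: "'x::banach set"
  assumes S: "subspace S" and closed: "closed S"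
  shows "closed (span (insert v S))"
proof (cases "v \<in> S")
  case True
  then show ?thesis using S closed by (simp add: insert_absorb span_eq_iff[THEN iffD2])
next
  case False
  define r where "r = infdist v S"
  have S0: "S \<noteq> {}" using subspace_0[OF S] by blast
  have r: "0 < r"
    unfolding r_def using False in_closed_iff_infdist_zero[OF closed S0, of v] infdist_nonneg[of v S] by linarith
  have mem: "x \<in> span (insert v S) \<longleftrightarrow> (\<exists>k. x - k *\<^sub>R v \<in> S)" for x
    using S by (simp add: span_breakdown_eq span_eq_iff[THEN iffD2])
  have lower: "\<bar>k\<bar> * r \<le> norm (k *\<^sub>R v + s)" if s: "s \<in> S" for k s
  proof (cases "k = 0")
    case False
    have "(- 1 / k) *\<^sub>R s \<in> S" using S s by (rule subspace_scale)
    then have "r \<le> dist v ((- 1 / k) *\<^sub>R s)"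
      unfolding r_def by (rule infdist_le)
    then have "\<bar>k\<bar> * r \<le> \<bar>k\<bar> * norm (v + (1 / k) *\<^sub>R s)"
      by (intro mult_left_mono) (auto simp: dist_norm)
    also have "\<dots> = norm (k *\<^sub>R (v + (1 / k) *\<^sub>R s))" by simp
    also have "k *\<^sub>R (v + (1 / k) *\<^sub>R s) = k *\<^sub>R v + s" using False by (simp add: scaleR_add_right)
    finally show ?thesis .
  qed simp
  show ?thesis
    unfolding closed_sequential_limits
  proof (intro allI impI, elim conjE)
    fix x l assume x: "\<forall>n. x n \<in> span (insert v S)" and l: "x \<longlonglongrightarrow> l"
    from x obtain k where k: "\<And>n. x n - k n *\<^sub>R v \<in> S" unfolding mem by metis
    have "Cauchy k"
    proof (rule metric_CauchyI)
      fix d :: real assume d: "0 < d"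
      have "Cauchy x" using l by (rule LIMSEQ_imp_Cauchy)
      then obtain m where m: "\<And>i j. m \<le> i \<Longrightarrow> m \<le> j \<Longrightarrow> dist (x i) (x j) < d * r"
        using metric_CauchyD[of x "d * r"] d r by auto
      have "dist (k i) (k j) < d" if ij: "m \<le> i" "m \<le> j" for i j
      proof -
        have "(x i - k i *\<^sub>R v) - (x j - k j *\<^sub>R v) \<in> S" by (intro subspace_diff[OF S] k)
        then have "\<bar>k i - k j\<bar> * r \<le> norm ((k i - k j) *\<^sub>R v + ((x i - k i *\<^sub>R v) - (x j - k j *\<^sub>R v)))"
          by (rule lower)
        also have "\<dots> = dist (x i) (x j)" by (simp add: dist_norm algebra_simps)
        also have "\<dots> < d * r" using m ij by blast
        finally show ?thesis using r by (simp add: dist_real_def)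
      qed
      then show "\<exists>m. \<forall>i\<ge>m. \<forall>j\<ge>m. dist (k i) (k j) < d" by blast
    qed
    then obtain c where c: "k \<longlonglongrightarrow> c" using Cauchy_convergent_iff convergent_def by blast
    have "(\<lambda>n. x n - k n *\<^sub>R v) \<longlonglongrightarrow> l - c *\<^sub>R v" by (intro tendsto_intros l c)
    then have "l - c *\<^sub>R v \<in> S" by (rule closed_sequentially[OF closed k])
    then show "l \<in> span (insert v S)" unfolding mem by blast
  qed
qed

lemma closed_span_Un_finite:
  fixes S :: "'x::banach set"
  assumes "finite B" "subspace S" "closed S"
  shows "closed (span (S \<union> B))"
  using assms
proof (induction B)
  case empty
  then show ?case by (simp add: span_eq_iff[THEN iffD2])
next
  case (insert v B)
  have "span (insert v (span (S \<union> B))) = span (S \<union> insert v B)"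
    by (simp add: set_eq_iff span_breakdown_eq span_span)
  with closed_span_insert[of "span (S \<union> B)" v] insert show ?case by simp
qed

lemma sum_span_add:
  fixes F :: "'x::banach set"
  assumes "finite J" "\<And>j. j \<in> J \<Longrightarrow> E j = span (B j)" "subspace F"
  shows "(\<Sum>j\<in>J. E j) + F = span (F \<union> (\<Union>j\<in>J. B j))"
  using assms
proof (induction J)
  case empty
  then show ?case by (simp add: span_eq_iff[THEN iffD2])
next
  case (insert i J)
  have "(\<Sum>j\<in>insert i J. E j) + F = E i + ((\<Sum>j\<in>J. E j) + F)"
    using insert by (simp add: add.assoc)
  also have "\<dots> = span (B i) + span (F \<union> (\<Union>j\<in>J. B j))" using insert by simp
  also have "\<dots> = span (B i \<union> (F \<union> (\<Union>j\<in>J. B j)))"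
    unfolding span_Un[of "B i"] by (auto simp: set_plus_def)
  also have "B i \<union> (F \<union> (\<Union>j\<in>J. B j)) = F \<union> (\<Union>j\<in>insert i J. B j)" by auto
  finally show ?case .
qed

lemma direct_sum_remove:
  fixes S :: "'i \<Rightarrow> 'x::real_vector set"
  assumes dir: "direct_sum I S V" and I: "finite I" "i \<in> I"
  shows "subspace (S i)" "S i + (\<Sum>j\<in>I - {i}. S j) = V" "S i \<inter> (\<Sum>j\<in>I - {i}. S j) \<subseteq> {0}"
proof -
  have sub: "\<And>j. j \<in> I \<Longrightarrow> subspace (S j)" and sum: "(\<Sum>j\<in>I. S j) = V"
    and ind: "\<And>f. (\<And>j. j \<in> I \<Longrightarrow> f j \<in> S j) \<Longrightarrow> (\<Sum>j\<in>I. f j) = 0 \<Longrightarrow> \<forall>j\<in>I. f j = 0"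
    using dir by (auto simp: direct_sum_def)
  show "subspace (S i)" by (rule sub[OF I(2)])
  show "S i + (\<Sum>j\<in>I - {i}. S j) = V" using sum I by (simp add: sum.remove)
  show "S i \<inter> (\<Sum>j\<in>I - {i}. S j) \<subseteq> {0}"
  proof
    fix x assume "x \<in> S i \<inter> (\<Sum>j\<in>I - {i}. S j)"
    then obtain s where x: "x \<in> S i" "x = sum s (I - {i})" "\<forall>j\<in>I - {i}. s j \<in> S j"
      using I by (auto simp: set_sum_alt)
    \<comment> \<open>Rewrites x = sum of the s j as a vanishing sum with one entry from each
      summand.\<close>
    define f where "f = (\<lambda>j. - s j)(i := x)"
    have "f j \<in> S j" if "j \<in> I" for j using that x sub by (auto simp: f_def intro: subspace_neg)
    moreover have "sum f I = 0"
    proof -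
      have "sum f I = f i + sum f (I - {i})" using I by (simp add: sum.remove)
      also have "sum f (I - {i}) = sum (\<lambda>j. - s j) (I - {i})" by (rule sum.cong) (auto simp: f_def)
      finally show ?thesis using x by (simp add: f_def sum_negf)
    qed
    ultimately have "f i = 0" using ind I(2) by blast
    then show "x \<in> {0}" by (simp add: f_def)
  qed
qed

text \<open>On the zero space \<open>onorm_on\<close> is 0, since division by zero gives 0; its rate
  is -infinity, contradicting a real exponent.\<close>

lemma two_sided_exponent_nontrivial:
  assumes T: "T = \<int> \<or> T = UNIV" and ex: "two_sided_exponent T \<theta> U \<Omega> E \<mu>" and \<omega>: "\<omega> \<in> \<Omega>"
  shows "E \<omega> \<noteq> {0}"
proof
  assume E: "E \<omega> = {0}"
  have lim: "((\<lambda>t. exp_rate t (onorm_on (E \<omega>) (two_sided_semiflow \<theta> U E \<omega> t))) \<longlongrightarrow> ereal \<mu>) (time_at_top T)"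
    using ex \<omega> by (simp add: two_sided_exponent_def)
  have "eventually (\<lambda>t. exp_rate t (onorm_on (E \<omega>) (two_sided_semiflow \<theta> U E \<omega> t)) = - \<infinity>) (time_at_top T)"
    by (rule eventually_time_at_topI[of _ 1]) (auto simp: E onorm_on_def exp_rate_def eln_def)
  then have "((\<lambda>t. exp_rate t (onorm_on (E \<omega>) (two_sided_semiflow \<theta> U E \<omega> t))) \<longlongrightarrow> - \<infinity>) (time_at_top T)"
    by (rule tendsto_eventually)
  with lim have "ereal \<mu> = - \<infinity>"
    using tendsto_unique[OF time_at_top_neq_bot[OF T]] by blast
  then show False by simp
qed

context regular_flow
begin

text \<open>E nonzero makes F proper. If the cone lay in F, so would all differences of its vectors
  and, F being closed, their closure. Some cone vector thus lies outside F, and uniqueness of its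
  limit identifies the two rates.\<close>

lemma exponent_eq_top:
  assumes total: "total_cone C" and \<omega>: "\<omega> \<in> saturation G" and rate: "has_growth_rate \<omega>"
    and F: "subspace F" "closed F" and E: "E + F = UNIV" "E \<inter> F \<subseteq> {0}" "subspace E" "E \<noteq> {0}"
    and lim: "\<And>u. u \<in> (E + F) - F \<Longrightarrow> ((\<lambda>t. exp_rate t (norm (U \<omega> t u))) \<longlongrightarrow> ereal \<mu>) (time_at_top T)"
  shows "exponent = ereal \<mu>"
proof -
  obtain y where "y \<in> E" "y \<noteq> 0" using E(3,4) subspace_0[of E] by blast
  then have y: "y \<notin> F" using E(2) by blast
  have "\<exists>u\<in>C. u \<notin> F"
  proof (rule ccontr)
    assume "\<not> ?thesis"
    then have "{u - v | u v. u \<in> C \<and> v \<in> C} \<subseteq> F" using subspace_diff[OF F(1)] by blast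
    then have "closure {u - v | u v. u \<in> C \<and> v \<in> C} \<subseteq> F" using F(2) by (rule closure_minimal)
    then show False using total y by (auto simp: total_cone_def)
  qed
  then obtain u where u: "u \<in> C" "u \<notin> F" by blast
  then have u0: "u \<in> C - {0}" using subspace_0[OF F(1)] by auto
  show ?thesis
    using tendsto_unique[OF time_at_top_neq_bot[OF time_set] cone_growth_tendsto[OF \<omega> rate u0] lim] u E(1) by simp
qed

lemma exponent_O1:
  assumes \<omega>: "\<omega> \<in> saturation G" and rate: "has_growth_rate \<omega>" and O1: "oseledets_O1 T U \<Omega>" "\<omega> \<in> \<Omega>"
  shows "exponent = - \<infinity>"
proof -
  have lim: "((\<lambda>t. exp_rate t (onorm (U \<omega> t))) \<longlongrightarrow> - \<infinity>) (time_at_top T)"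
    using O1 by (simp add: oseledets_O1_def)
  have "exponent \<le> - \<infinity>"
  proof (rule tendsto_le[OF time_at_top_neq_bot[OF time_set] lim has_growth_rate_tendsto(1)[OF \<omega> rate]])
    show "eventually (\<lambda>t. exp_rate t (growth t \<omega>) \<le> exp_rate t (onorm (U \<omega> t))) (time_at_top T)"
    proof (rule eventually_time_at_topI[of _ 1])
      fix t assume t: "t \<in> T" "1 \<le> t"
      have "0 < growth t \<omega>" "growth t \<omega> \<le> onorm (U \<omega> t)"
        using growth_pos[OF \<omega> t(1)] growth_le_onorm[OF \<omega> nonneg_timeI] t by auto
      then show "exp_rate t (growth t \<omega>) \<le> exp_rate t (onorm (U \<omega> t))"
        using t by (simp add: exp_rate_def eln_def divide_right_mono)
    qed
  qed
  then show ?thesis by simp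
qed

lemma exponent_O2:
  assumes total: "total_cone C" and \<omega>: "\<omega> \<in> saturation G" and rate: "has_growth_rate \<omega>"
    and O2: "oseledets_O2 M T \<theta> U \<Omega> k \<mu> E Finf" "\<omega> \<in> \<Omega>"
  shows "exponent = ereal (\<mu> 1)"
proof -
  have k: "1 \<le> k" and meas: "\<And>i. i \<in> {1..k} \<Longrightarrow> measurable_subspaces M \<Omega> (E i)"
    and codim: "closed_finite_codim (Finf \<omega>)"
    and dir: "direct_sum {1..Suc k} ((\<lambda>j. E j \<omega>)(Suc k := Finf \<omega>)) UNIV"
    and ex: "\<And>i. i \<in> {1..k} \<Longrightarrow> two_sided_exponent T \<theta> U \<Omega> (E i) (\<mu> i)"
    and lim: "\<And>i u. i \<in> {1..k} \<Longrightarrow> u \<in> (E i \<omega> + tail_sum k E Finf i \<omega>) - tail_sum k E Finf i \<omega> \<Longrightarrow>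
        ((\<lambda>t. exp_rate t (norm (U \<omega> t u))) \<longlongrightarrow> ereal (\<mu> i)) (time_at_top T)"
    using O2 unfolding oseledets_O2_def by blast+
  have one: "1 \<in> {1..k}" using k by simp
  have F: "subspace (Finf \<omega>)" "closed (Finf \<omega>)" using codim by (auto simp: closed_finite_codim_def)
  have "\<exists>B. finite B \<and> E j \<omega> = span B" if j: "j \<in> {1..k}" for j
  proof -
    obtain l :: nat and v where "\<forall>\<omega>\<in>\<Omega>. span ((\<lambda>i. v i \<omega>) ` {..<l}) = E j \<omega>"
      using meas[OF j] unfolding measurable_subspaces_def by blast
    then show ?thesis using O2(2) by (intro exI[of _ "(\<lambda>i. v i \<omega>) ` {..<l}"]) auto
  qed
  then obtain B where B: "\<And>j. j \<in> {1..k} \<Longrightarrow> finite (B j) \<and> E j \<omega> = span (B j)" by metis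
  \<comment> \<open>Closedness is given for \<open>Finf \<omega>\<close> only; the tail sum is
    closed because it adds finitely many vectors.\<close>
  have tail: "tail_sum k E Finf 1 \<omega> = span (Finf \<omega> \<union> (\<Union>j\<in>{1<..k}. B j))"
    unfolding tail_sum_def using B F by (intro sum_span_add) auto
  have "closed (tail_sum k E Finf 1 \<omega>)" "subspace (tail_sum k E Finf 1 \<omega>)"
    unfolding tail using B F by (auto intro!: closed_span_Un_finite)
  moreover have "(\<Sum>j\<in>{1..Suc k} - {1}. ((\<lambda>j. E j \<omega>)(Suc k := Finf \<omega>)) j) = tail_sum k E Finf 1 \<omega>"
  proof -
    have "{1..Suc k} - {1} = insert (Suc k) {1<..k}" using k by auto
    then have "(\<Sum>j\<in>{1..Suc k} - {1}. ((\<lambda>j. E j \<omega>)(Suc k := Finf \<omega>)) j) =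
        Finf \<omega> + (\<Sum>j\<in>{1<..k}. ((\<lambda>j. E j \<omega>)(Suc k := Finf \<omega>)) j)" by simp
    also have "(\<Sum>j\<in>{1<..k}. ((\<lambda>j. E j \<omega>)(Suc k := Finf \<omega>)) j) = (\<Sum>j\<in>{1<..k}. E j \<omega>)"
      by (rule sum.cong) auto
    finally show ?thesis by (simp add: tail_sum_def add.commute)
  qed
  moreover have "((\<lambda>j. E j \<omega>)(Suc k := Finf \<omega>)) 1 = E 1 \<omega>" using k by simp
  ultimately show ?thesis
    using direct_sum_remove[OF dir finite_atLeastAtMost, of 1] k
      two_sided_exponent_nontrivial[OF time_set ex[OF one] O2(2)] lim[OF one]
    by (intro exponent_eq_top[OF total \<omega> rate, where F = "tail_sum k E Finf 1 \<omega>" and E = "E 1 \<omega>"]) auto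
qed

lemma exponent_O3:
  assumes total: "total_cone C" and \<omega>: "\<omega> \<in> saturation G" and rate: "has_growth_rate \<omega>"
    and O3: "oseledets_O3 M T \<theta> U \<Omega> \<mu> E F" "\<omega> \<in> \<Omega>"
  shows "exponent = ereal (\<mu> 1)"
proof -
  have one: "(1::nat) \<le> 1" by simp
  have all: "\<forall>i\<ge>1. \<forall>\<omega>\<in>\<Omega>. closed_finite_codim (F i \<omega>)"
    "\<forall>i\<ge>1. \<forall>\<omega>\<in>\<Omega>. direct_sum {1..Suc i} ((\<lambda>j. E j \<omega>)(Suc i := F i \<omega>)) UNIV"
    "\<forall>i\<ge>1. two_sided_exponent T \<theta> U \<Omega> (E i) (\<mu> i)"
    "\<forall>i\<ge>1. \<forall>\<omega>\<in>\<Omega>. \<forall>u\<in>(E i \<omega> + F i \<omega>) - F i \<omega>.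
        ((\<lambda>t. exp_rate t (norm (U \<omega> t u))) \<longlongrightarrow> ereal (\<mu> i)) (time_at_top T)"
    using O3(1) unfolding oseledets_O3_def by - (elim conjE, assumption)+
  note codim = all(1)[rule_format, OF one O3(2)] and dir = all(2)[rule_format, OF one O3(2)]
    and ex = all(3)[rule_format, OF one] and lim = all(4)[rule_format, OF one O3(2)]
  have "{1..Suc 1} - {1} = {Suc 1}" by auto
  then have "(\<Sum>j\<in>{1..Suc 1} - {1}. ((\<lambda>j. E j \<omega>)(Suc 1 := F 1 \<omega>)) j) = F 1 \<omega>" by simp
  moreover have "((\<lambda>j. E j \<omega>)(Suc 1 := F 1 \<omega>)) 1 = E 1 \<omega>" by simp
  ultimately show ?thesis
    using direct_sum_remove[OF dir finite_atLeastAtMost, of 1] codim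
      two_sided_exponent_nontrivial[OF time_set ex O3(2)] lim
    by (intro exponent_eq_top[OF total \<omega> rate, where F = "F 1 \<omega>" and E = "E 1 \<omega>"])
      (auto simp: closed_finite_codim_def)
qed

text \<open>The exponent is one constant, so it can be compared with the Oseledets data at a single
  common base point.\<close>

lemma full_sets_meet:
  assumes "full_invariant_set M T \<theta> A" "full_invariant_set M T \<theta> B"
  shows "A \<inter> B \<noteq> {}"
proof
  assume disjoint: "A \<inter> B = {}"
  have "AE \<omega> in M. \<omega> \<in> A" "AE \<omega> in M. \<omega> \<in> B"
    using assms by (auto simp: full_invariant_set_def AE_in_set_eq_1)
  then have "AE \<omega> in M. False" by eventually_elim (use disjoint in blast)
  then show False by simp
qed

end

text \<open>u is the positive part of x and v is u - x.\<close>

lemma banach_lattice_reproducing: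
  assumes "banach_lattice C" shows "\<exists>u\<in>C. \<exists>v\<in>C. x = u - v"
proof -
  obtain ip sp where "class.lattice ip (cone_le C) (cone_less C) sp"
    using assms by (auto simp: banach_lattice_def)
  then interpret lattice ip "cone_le C" "cone_less C" sp .
  have "sp x 0 \<in> C" "sp x 0 - x \<in> C"
    using sup_ge2[of 0 x] sup_ge1[of x 0] by (auto simp: cone_le_def)
  then show ?thesis by (intro bexI[of _ "sp x 0"] bexI[of _ "sp x 0 - x"]) auto
qed

theorem theorem3p6:
  fixes M :: "'w measure" and T :: "real set" and \<theta> :: "real \<Rightarrow> 'w \<Rightarrow> 'w"
    and U :: "'w \<Rightarrow> real \<Rightarrow> 'x::{banach, second_countable_topology} \<Rightarrow> 'x"
    and C :: "'x set" and e :: 'x and \<kappa> :: "'w \<Rightarrow> real"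
  assumes "normally_ordered C"
    and "\<exists>B::'x set. independent B \<and> finite B \<and> card B = 2"
    and "skew_product_semiflow M T \<theta> U"
    and "integrable_semiflow M T \<theta> U"
    and "positive_semiflow M T U C"
    and "focusing_semiflow M U C e \<kappa>"
  shows "\<exists>\<Omega>1 w.
    full_invariant_set M T \<theta> \<Omega>1 \<and>
    w \<in> restrict_space M \<Omega>1 \<rightarrow>\<^sub>M borel \<and>
    (\<forall>\<omega>\<in>\<Omega>1. w \<omega> \<in> comparability_class C e \<and> norm (w \<omega>) = 1) \<and>
    \<comment> \<open>(1)\<close>
    (\<forall>\<omega>\<in>\<Omega>1. \<forall>t\<in>nonneg_time T.
       w (\<theta> t \<omega>) = (1 / norm (U \<omega> t (w \<omega>))) *\<^sub>R U \<omega> t (w \<omega>)) \<and>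
    \<comment> \<open>(2)\<close>
    (\<forall>\<omega>\<in>\<Omega>1. \<forall>v. (\<forall>t\<in>T. v t \<in> C - {0}) \<and> entire_orbit T \<theta> U \<omega> v \<longrightarrow>
       (\<forall>t\<in>T. v t = norm (v 0) *\<^sub>R principal_orbit \<theta> U w \<omega> t)) \<and>
    \<comment> \<open>(3)\<close>
    (\<exists>\<Lambda>1::ereal. \<Lambda>1 < \<infinity> \<and>
       (\<forall>\<omega>\<in>\<Omega>1.
          ((\<lambda>t. exp_rate t (growth_factor \<theta> U w t \<omega>)) \<longlongrightarrow> \<Lambda>1) (time_at_top T) \<and>
          ((\<lambda>t. exp_rate t (growth_factor \<theta> U w t \<omega>)) \<longlongrightarrow> \<Lambda>1) (time_at_bot T)) \<and>
       has_extended_integral (restrict_space M \<Omega>1) (\<lambda>\<omega>. eln (growth_factor \<theta> U w 1 \<omega>)) \<Lambda>1 \<and>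
       \<comment> \<open>(4)\<close>
       (injective_semiflow M U \<and> compact_semiflow M U \<and> total_cone C \<longrightarrow>
          (\<forall>\<Omega>0. full_invariant_set M T \<theta> \<Omega>0 \<and> oseledets_O1 T U \<Omega>0 \<longrightarrow> \<Lambda>1 = - \<infinity>) \<and>
          (\<forall>\<Omega>0 k \<mu> E Finf.
             full_invariant_set M T \<theta> \<Omega>0 \<and> oseledets_O2 M T \<theta> U \<Omega>0 k \<mu> E Finf \<longrightarrow>
             \<Lambda>1 = ereal (\<mu> 1)) \<and>
          (\<forall>\<Omega>0 \<mu> E F.
             full_invariant_set M T \<theta> \<Omega>0 \<and> oseledets_O3 M T \<theta> U \<Omega>0 \<mu> E F \<longrightarrow>
             \<Lambda>1 = ereal (\<mu> 1)) \<and>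
          (\<forall>\<omega>\<in>\<Omega>1. \<forall>u. u \<noteq> 0 \<longrightarrow>
             Limsup (time_at_top T) (\<lambda>t. exp_rate t (norm (U \<omega> t u))) \<le> \<Lambda>1) \<and>
          principal_floquet_subspaces M T \<theta> U C \<Omega>1 (\<lambda>\<omega>. span {w \<omega>})) \<and>
       \<comment> \<open>(5)\<close>
       (banach_lattice C \<longrightarrow>
          (\<forall>\<omega>\<in>\<Omega>1. \<forall>u. u \<noteq> 0 \<longrightarrow>
             Limsup (time_at_top T) (\<lambda>t. exp_rate t (norm (U \<omega> t u))) \<le> \<Lambda>1) \<and>
          principal_floquet_subspaces M T \<theta> U C \<Omega>1 (\<lambda>\<omega>. span {w \<omega>})))"
proof -
  interpret skew_product_semiflow M T \<theta> U by fact
  interpret focusing_flow M T \<theta> U C e \<kappa>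
    using assms by unfold_locales
  obtain a G where "regular_flow M T \<theta> U C e \<kappa> a G" using ex_regular by blast
  then interpret regular_flow M T \<theta> U C e \<kappa> a G .
  \<comment> \<open>Domination enters as an implication, because the same \<Omega>1 must serve
    whether or not the assumptions of (4) hold.\<close>
  have "AE \<omega> in M. \<omega> \<in> G \<and> has_growth_rate \<omega> \<and>
    (compact_semiflow M U \<and> total_cone C \<longrightarrow> dominated \<omega>)"
    using AE_G AE_has_growth_rate AE_dominated by auto
  then obtain G' where G': "G' \<in> sets M" "prob G' = 1"
    and good: "\<And>\<omega>. \<omega> \<in> G' \<Longrightarrow> \<omega> \<in> G \<and> has_growth_rate \<omega> \<and>
      (compact_semiflow M U \<and> total_cone C \<longrightarrow> dominated \<omega>)"
    and shift: "\<And>\<omega> (k::int). \<omega> \<in> G' \<Longrightarrow> \<theta> (of_int k) \<omega> \<in> G'"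
    by (rule AE_imp_shift_invariant) blast
  \<comment> \<open>Saturation gives invariance under all times; the flow then carries rate and
    domination from G' to the added points.\<close>
  define \<Omega>1 where "\<Omega>1 = saturation G'"
  have full: "full_invariant_set M T \<theta> \<Omega>1"
    unfolding \<Omega>1_def by (rule full_saturation[OF complete_if_continuous G' shift])
  have sub: "\<Omega>1 \<subseteq> saturation G" unfolding \<Omega>1_def saturation_def using good by blast
  have rate: "has_growth_rate \<omega>" if \<omega>: "\<omega> \<in> \<Omega>1" for \<omega>
  proof -
    obtain s \<omega>' where s: "s \<in> T" "\<omega>' \<in> G'" "\<omega> = \<theta> s \<omega>'" using \<omega> by (auto simp: \<Omega>1_def saturation_def)
    show ?thesis unfolding s(3)
      using good[OF s(2)] G_subset_saturation s(1) by (intro has_growth_rate_flow) auto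
  qed
  have dom: "dominated \<omega>"
    if \<omega>: "\<omega> \<in> \<Omega>1" and compact: "compact_semiflow M U" "total_cone C" for \<omega>
  proof -
    obtain s \<omega>' where s: "s \<in> T" "\<omega>' \<in> G'" "\<omega> = \<theta> s \<omega>'" using \<omega> by (auto simp: \<Omega>1_def saturation_def)
    show ?thesis unfolding s(3)
    proof (rule dominated_flow)
      show "\<omega>' \<in> space M" using good[OF s(2)] G_space by blast
      show "dominated (\<theta> (of_int k) \<omega>')" for k :: int
        using good[OF shift[OF s(2), of k]] compact by blast
    qed (rule s(1))
  qed
  have meet: "\<exists>\<omega>\<in>\<Omega>1. \<omega> \<in> \<Omega>0" if "full_invariant_set M T \<theta> \<Omega>0" for \<Omega>0
    using full_sets_meet[OF full that] by blast
  show ?thesis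
  proof (intro exI[of _ \<Omega>1] exI[of _ w] exI[of _ exponent] conjI impI ballI allI full; (elim conjE)?)
    show "w \<in> restrict_space M \<Omega>1 \<rightarrow>\<^sub>M borel" by (rule measurable_restrict_space1) measurable
    show "exponent < \<infinity>" unfolding exponent_def
      by (rule extended_integral_less_top[OF log_step_measurable log_step_fin])
    show "has_extended_integral (restrict_space M \<Omega>1) (\<lambda>\<omega>. eln (growth 1 \<omega>)) exponent"
      by (rule extended_integral_growth[OF full sub])
  next
    fix \<omega> assume \<omega>: "\<omega> \<in> \<Omega>1"
    then have sat: "\<omega> \<in> saturation G" using sub by blast
    show "w \<omega> \<in> comparability_class C e"
      using principal_comparable[OF principal_w[OF sat]] sat saturation_space by blast
    show "norm (w \<omega>) = 1" using w_cone[OF sat] by blast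
    show "w (\<theta> t \<omega>) = (1 / norm (U \<omega> t (w \<omega>))) *\<^sub>R U \<omega> t (w \<omega>)" if "t \<in> nonneg_time T" for t
      using w_flow[OF sat that] by (simp add: sgn_div_norm divide_inverse)
    show "v t = norm (v 0) *\<^sub>R principal_orbit \<theta> U w \<omega> t"
      if "\<forall>t\<in>T. v t \<in> C - {0}" "entire_orbit T \<theta> U \<omega> v" "t \<in> T" for v t
      by (rule entire_orbit_principal[OF sat _ that(2,3)]) (use that(1) in blast)
    show "((\<lambda>t. exp_rate t (growth t \<omega>)) \<longlongrightarrow> exponent) (time_at_top T)"
      "((\<lambda>t. exp_rate t (growth t \<omega>)) \<longlongrightarrow> exponent) (time_at_bot T)"
      by (rule has_growth_rate_tendsto[OF sat rate[OF \<omega>]])+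
  next
    fix \<Omega>0 assume "total_cone C" "full_invariant_set M T \<theta> \<Omega>0" "oseledets_O1 T U \<Omega>0"
    with meet[of \<Omega>0] show "exponent = - \<infinity>" using sub rate exponent_O1 by blast
  next
    fix \<Omega>0 k \<mu> E Finf
    assume "total_cone C" "full_invariant_set M T \<theta> \<Omega>0" "oseledets_O2 M T \<theta> U \<Omega>0 k \<mu> E Finf"
    with meet[of \<Omega>0] show "exponent = ereal (\<mu> 1)" using sub rate exponent_O2 by blast
  next
    fix \<Omega>0 \<mu> E F
    assume "total_cone C" "full_invariant_set M T \<theta> \<Omega>0" "oseledets_O3 M T \<theta> U \<Omega>0 \<mu> E F"
    with meet[of \<Omega>0] show "exponent = ereal (\<mu> 1)" using sub rate exponent_O3 by blast
  next
    fix \<omega> u assume "compact_semiflow M U" "total_cone C" "\<omega> \<in> \<Omega>1"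
    then show "Limsup (time_at_top T) (\<lambda>t. exp_rate t (norm (U \<omega> t u))) \<le> exponent"
      by (intro dominated_Limsup dom)
  next
    assume "compact_semiflow M U" "total_cone C"
    then show "principal_floquet_subspaces M T \<theta> U C \<Omega>1 (\<lambda>\<omega>. span {w \<omega>})"
      by (intro principal_floquet[OF full sub] rate dom)
  next
    fix \<omega> u assume "banach_lattice C" "\<omega> \<in> \<Omega>1"
    then show "Limsup (time_at_top T) (\<lambda>t. exp_rate t (norm (U \<omega> t u))) \<le> exponent"
      using sub rate banach_lattice_reproducing
      by (intro dominated_Limsup reproducing_dominated) blast+
  next
    assume "banach_lattice C"
    then show "principal_floquet_subspaces M T \<theta> U C \<Omega>1 (\<lambda>\<omega>. span {w \<omega>})"
      using sub rate banach_lattice_reproducing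
      by (intro principal_floquet[OF full sub] reproducing_dominated) blast+
  qed
qed

end
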